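(* Let $\Phi$ be a free group and let $G = \langle \mathbf{x}, \Phi; R\rangle$ be the group defined by an $\mathcal{M}_\Phi$-presentation. Then $G$ is a residually finite one-relator group. Moreover, if $K = \langle \mathbf{y}, z; S(\mathbf{y}, z)\rangle$ is a one-relator group (where $\mathbf{y}$ is a set and $z$ a further letter, $\mathbf{x}$ is disjoint from $\mathbf{y}\cup\{z\}$, and $S(\mathbf{y},z)$ is a word on $(\mathbf{y} \cup \{z\})^{\pm 1}$), then the one-relator group $\overline{K} = \langle \mathbf{x}, \mathbf{y}, \Phi; S(\mathbf{y}, R)\rangle$, that is, the quotient of $\Phi * F(\mathbf{x}\cup\mathbf{y})$ by the normal closure of the element $S(\mathbf{y},R)$ obtained by substituting $R$ for $z$ in $S(\mathbf{y},z)$, is residually finite if and only if $K$ is residually finite. In particular, for every integer $n>1$ the group $G_n = \langle \mathbf{x}, \Phi; R^n\rangle$ is residually finite.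
   Context: $F(\mathbf{a})$ denotes the free group on a set $\mathbf{a}$. A one-relator group is a group having a presentation (with an arbitrary set of generators) with a single defining relator. A one-relator relative presentation $\langle \mathbf{x}, H; R\rangle$ consists of a set $\mathbf{x}$, a group $H$, and an expression $R = x_1^{\varepsilon_1} h_1 x_2^{\varepsilon_2} h_2 \cdots x_r^{\varepsilon_r} h_r$ with $r>0$, $x_i \in \mathbf{x}$, $\varepsilon_i = \pm 1$, $h_i \in H$. The word $W = x_1^{\varepsilon_1} x_2^{\varepsilon_2} \cdots x_r^{\varepsilon_r}$ is the $\mathbf{x}$-skeleton of $R$; it is not required to be reduced or cyclically reduced. The group it defines is the quotient of $H * F(\mathbf{x})$ by the normal closure of the element represented by $R$; likewise $\langle \mathbf{x}, H; R^n\rangle$ is the quotient of $H*F(\mathbf{x})$ by the normal closure of $R^n$. A weight function on $\mathbf{x}$ is a function $\theta: \mathbf{x} \to \mathbb{Z}$ whose image generates the additive group $\mathbb{Z}$; it is strict if $\theta(x) \neq 0$ for all $x \in \mathbf{x}$. Given $W$ and $\theta$, define $\phi:\{0,1,\ldots,r\} \to \mathbb{Z}$ by $\phi(j) = \sum_{i=1}^{j} \varepsilon_i \theta(x_i)$ (so $\phi(0)=0$). The weight function is admissible for $W$ if $\phi(r)=0$. $W$ has the unique max-min property if there are an admissible strict weight function $\theta$ and $k,l \in \{1,\ldots,r\}$ such that $\phi(j) < \phi(k)$ for all $j \in \{1,\ldots,r\}\setminus\{k\}$, $\phi(j) > \phi(l)$ for all $j \in \{1,\ldots,r\}\setminus\{l\}$,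 $x_k \neq x_{k+1}$ and $x_l \neq x_{l+1}$ (subscripts modulo $r$). An $\mathcal{M}_H$-presentation is a one-relator relative presentation $\langle \mathbf{x}, H; R\rangle$ whose $\mathbf{x}$-skeleton has the unique max-min property; here $H=\Phi$ is free. *)

theory Defs
  imports "HOL-Algebra.Elementary_Groups"
begin

section \<open>Free groups\<close>

text \<open>A word on \<^term>\<open>X\<close> is a list over \<^term>\<open>X \<times> (UNIV :: bool set)\<close>; the letter
  \<^term>\<open>(x, True)\<close> stands for the generator \<^term>\<open>x\<close> and \<^term>\<open>(x, False)\<close> for its formal
  inverse. The free group is realised on the reduced words.\<close>

type_synonym 'a word = "('a \<times> bool) list"

definition cancelling :: "'a \<times> bool \<Rightarrow> 'a \<times> bool \<Rightarrow> bool" where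
  "cancelling l m \<longleftrightarrow> fst l = fst m \<and> snd l \<noteq> snd m"

definition reduced :: "'a word \<Rightarrow> bool" where
  "reduced = successively (\<lambda>l m. \<not> cancelling l m)"

fun red_cons :: "'a \<times> bool \<Rightarrow> 'a word \<Rightarrow> 'a word" where
  "red_cons l [] = [l]"
| "red_cons l (m # w) = (if cancelling l m then w else l # m # w)"

definition free_group :: "'a set \<Rightarrow> 'a word monoid" where
  "free_group X =
    \<lparr>carrier = {w \<in> lists (X \<times> UNIV). reduced w}, monoid.mult = foldr red_cons, one = []\<rparr>"

lemma reduced_red_cons: "reduced w \<Longrightarrow> reduced (red_cons l w)"
  by (cases w rule: remdups_adj.cases) (auto simp: reduced_def)

lemma red_cons_in_lists: "l \<in> A \<Longrightarrow> w \<in> lists A \<Longrightarrow> red_cons l w \<in> lists A"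
  by (cases w) auto

lemma red_cons_cancel:
  assumes "reduced w" "cancelling l m"
  shows "red_cons l (red_cons m w) = w"
  using assms
  by (cases l; cases m; cases w rule: remdups_adj.cases) (auto simp: reduced_def cancelling_def)

lemma red_cons_reduced: "reduced (l # w) \<Longrightarrow> red_cons l w = l # w"
  by (cases w) (auto simp: reduced_def)

lemma reduced_ConsD: "reduced (l # w) \<Longrightarrow> reduced w"
  by (cases w) (auto simp: reduced_def)

lemma reduced_foldr_red_cons: "reduced v \<Longrightarrow> reduced (foldr red_cons u v)"
  by (induction u) (auto intro: reduced_red_cons)

lemma foldr_red_cons_in_lists:
  "u \<in> lists A \<Longrightarrow> v \<in> lists A \<Longrightarrow> foldr red_cons u v \<in> lists A"
proof (induction u rule: list.induct)
  case (Cons l u)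
  then show ?case
    using red_cons_in_lists[of l A "foldr red_cons u v"] by simp
qed simp

lemma foldr_red_cons_red_cons:
  assumes "reduced w" "reduced t"
  shows "foldr red_cons (red_cons l w) t = red_cons l (foldr red_cons w t)"
proof (cases w)
  case (Cons m w')
  have "reduced (foldr red_cons w' t)"
    by (rule reduced_foldr_red_cons) fact
  then show ?thesis
    using Cons by (auto simp: red_cons_cancel)
qed simp

lemma foldr_red_cons_assoc:
  assumes "reduced v" "reduced t"
  shows "foldr red_cons (foldr red_cons u v) t = foldr red_cons u (foldr red_cons v t)"
  by (induction u)
    (auto simp: foldr_red_cons_red_cons reduced_foldr_red_cons assms)

lemma group_free_group: "group (free_group X)"
proof (rule groupI)
  fix w assume "w \<in> carrier (free_group X)"
  then have "w \<in> lists (X \<times> UNIV)" "reduced w"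
    by (auto simp: free_group_def)
  then show "\<exists>v \<in> carrier (free_group X). v \<otimes>\<^bsub>free_group X\<^esub> w = \<one>\<^bsub>free_group X\<^esub>"
  proof (induction w rule: list.induct)
    case Nil
    then show ?case by (intro bexI[of _ "[]"]) (auto simp: free_group_def reduced_def)
  next
    case (Cons l w)
    then obtain v where v: "v \<in> lists (X \<times> UNIV)" "reduced v" "foldr red_cons v w = []"
      using reduced_ConsD[of l w] by (auto simp: free_group_def)
    let ?l = "(fst l, \<not> snd l)"
    let ?u = "foldr red_cons v [?l]"
    have l: "reduced [?l]" "[?l] \<in> lists (X \<times> UNIV)"
      using Cons.prems by (simp_all add: reduced_def mem_Times_iff)
    have "foldr red_cons ?u (l # w) = foldr red_cons v (foldr red_cons [?l] (l # w))"
      by (rule foldr_red_cons_assoc[OF l(1) Cons.prems(2)])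
    also have "foldr red_cons [?l] (l # w) = w"
      by (simp add: cancelling_def)
    finally have "foldr red_cons ?u (l # w) = []"
      using v by simp
    moreover have "?u \<in> lists (X \<times> UNIV)" "reduced ?u"
      using foldr_red_cons_in_lists[OF v(1) l(2)] reduced_foldr_red_cons[OF l(1)] by auto
    ultimately show ?case
      unfolding free_group_def by auto
  qed
next
  fix u v assume "u \<in> carrier (free_group X)" "v \<in> carrier (free_group X)"
  then show "u \<otimes>\<^bsub>free_group X\<^esub> v \<in> carrier (free_group X)"
    using foldr_red_cons_in_lists[of u "X \<times> UNIV" v]
    by (simp add: free_group_def reduced_foldr_red_cons)
qed (auto simp: free_group_def foldr_red_cons_assoc reduced_def)

text \<open>A basis of \<^term>\<open>G\<close> is a subset of \<^term>\<open>G\<close>, so it may be taken in the element type.\<close>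

definition is_free_group :: "('g, 'b) monoid_scheme \<Rightarrow> bool" where
  "is_free_group G \<longleftrightarrow> group G \<and> (\<exists>B :: 'g set. G \<cong> free_group B)"

definition eval_word :: "('g, 'b) monoid_scheme \<Rightarrow> ('a \<Rightarrow> 'g) \<Rightarrow> 'a word \<Rightarrow> 'g" where
  "eval_word G f w =
    foldr (\<lambda>(x, b) g. (if b then f x else inv\<^bsub>G\<^esub> (f x)) \<otimes>\<^bsub>G\<^esub> g) w \<one>\<^bsub>G\<^esub>"

lemma eval_word_closed:
  assumes "group G" "f \<in> X \<rightarrow> carrier G" "w \<in> lists (X \<times> UNIV)"
  shows "eval_word G f w \<in> carrier G"
proof -
  interpret group G by fact
  show ?thesis
    using assms(3) by (induction w) (auto simp: eval_word_def funcset_mem[OF assms(2)])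
qed

lemma eval_word_red_cons:
  assumes "group G" "f \<in> X \<rightarrow> carrier G" "l \<in> X \<times> UNIV" "w \<in> lists (X \<times> UNIV)"
  shows "eval_word G f (red_cons l w) = eval_word G f (l # w)"
proof -
  interpret group G by fact
  show ?thesis
  proof (cases w)
    case (Cons m w')
    then have "f (fst l) \<in> carrier G" "f (fst m) \<in> carrier G" "eval_word G f w' \<in> carrier G"
      using assms eval_word_closed[OF assms(1,2), of w'] by auto
    then show ?thesis
      using Cons
      by (cases l; cases m)
        (auto simp: eval_word_def cancelling_def m_assoc[symmetric])
  qed (simp add: eval_word_def)
qed

lemma free_group_universal:
  assumes "group G" "f \<in> X \<rightarrow> carrier G"
  shows "eval_word G f \<in> hom (free_group X) G"
proof -
  interpret group G by fact
  note closed = eval_word_closed[OF assms]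
  have "eval_word G f (foldr red_cons u v) = eval_word G f u \<otimes>\<^bsub>G\<^esub> eval_word G f v"
    if "u \<in> lists (X \<times> UNIV)" "v \<in> lists (X \<times> UNIV)" for u v
    using that
  proof (induction u rule: list.induct)
    case Nil
    then show ?case using closed[of v] by (simp add: eval_word_def)
  next
    case (Cons l u)
    obtain x b where l: "l = (x, b)" by (cases l)
    have "f x \<in> carrier G" using Cons.prems l by (simp add: funcset_mem[OF assms(2)])
    moreover have "eval_word G f (foldr red_cons (l # u) v)
        = eval_word G f (l # foldr red_cons u v)"
      using eval_word_red_cons[OF assms, of l "foldr red_cons u v"] Cons.prems
        foldr_red_cons_in_lists[of u "X \<times> UNIV" v] by simp
    ultimately show ?case
      using Cons closed[of u] closed[of v] by (simp add: eval_word_def l m_assoc)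
  qed
  then show ?thesis
    using closed by (auto simp: hom_def free_group_def)
qed

section \<open>Free products\<close>

text \<open>The free product is realised on the alternating words in nontrivial elements of the two
  factors. \<open>fp_cons\<close> multiplies such a word on the left by a nontrivial element.\<close>

fun fp_cons ::
  "('g, 'c) monoid_scheme \<Rightarrow> ('h, 'd) monoid_scheme \<Rightarrow> 'g + 'h \<Rightarrow> ('g + 'h) list \<Rightarrow> ('g + 'h) list"
where
  "fp_cons G H (Inl g) (Inl g' # w) =
    (if g \<otimes>\<^bsub>G\<^esub> g' = \<one>\<^bsub>G\<^esub> then w else Inl (g \<otimes>\<^bsub>G\<^esub> g') # w)"
| "fp_cons G H (Inr h) (Inr h' # w) =
    (if h \<otimes>\<^bsub>H\<^esub> h' = \<one>\<^bsub>H\<^esub> then w else Inr (h \<otimes>\<^bsub>H\<^esub> h') # w)"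
| "fp_cons G H l w = l # w"

definition fp_letters ::
  "('g, 'c) monoid_scheme \<Rightarrow> ('h, 'd) monoid_scheme \<Rightarrow> ('g + 'h) set" where
  "fp_letters G H = Inl ` (carrier G - {\<one>\<^bsub>G\<^esub>}) \<union> Inr ` (carrier H - {\<one>\<^bsub>H\<^esub>})"

definition alternating :: "('g + 'h) list \<Rightarrow> bool" where
  "alternating = successively (\<lambda>l m. isl l \<noteq> isl m)"

definition free_product ::
  "('g, 'c) monoid_scheme \<Rightarrow> ('h, 'd) monoid_scheme \<Rightarrow> ('g + 'h) list monoid" where
  "free_product G H =
    \<lparr>carrier = {w \<in> lists (fp_letters G H). alternating w},
     monoid.mult = foldr (fp_cons G H), one = []\<rparr>"

definition fp_inl :: "('g, 'c) monoid_scheme \<Rightarrow> 'g \<Rightarrow> ('g + 'h) list" where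
  "fp_inl G g = (if g = \<one>\<^bsub>G\<^esub> then [] else [Inl g])"

definition fp_inr :: "('h, 'd) monoid_scheme \<Rightarrow> 'h \<Rightarrow> ('g + 'h) list" where
  "fp_inr H h = (if h = \<one>\<^bsub>H\<^esub> then [] else [Inr h])"

context
  fixes G :: "('g, 'c) monoid_scheme" and H :: "('h, 'd) monoid_scheme"
  assumes grp: "group G" "group H"
begin

interpretation G: group G by (rule grp)
interpretation H: group H by (rule grp)

private abbreviation (input) "N \<equiv> carrier (free_product G H)"
private abbreviation (input) "L \<equiv> fp_letters G H"

private lemma N_Nil: "[] \<in> N"
  by (simp add: free_product_def alternating_def)

private lemma N_ConsD: "l # w \<in> N \<Longrightarrow> l \<in> L \<and> w \<in> N"
  by (cases w) (auto simp: free_product_def alternating_def)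

private lemma fp_cons_closed: "l \<in> L \<Longrightarrow> w \<in> N \<Longrightarrow> fp_cons G H l w \<in> N"
  by (cases l; cases w rule: remdups_adj.cases; cases "hd w"; cases "hd (tl w)")
    (auto simp: free_product_def alternating_def fp_letters_def)

private lemma foldr_closed: "u \<in> lists L \<Longrightarrow> v \<in> N \<Longrightarrow> foldr (fp_cons G H) u v \<in> N"
  by (induction u) (auto intro: fp_cons_closed)

private lemma fp_cons_Inl:
  assumes "Inl g \<in> L" "Inl g' \<in> L" "w \<in> N"
  shows "fp_cons G H (Inl g) (fp_cons G H (Inl g') w) =
    (if g \<otimes>\<^bsub>G\<^esub> g' = \<one>\<^bsub>G\<^esub> then w else fp_cons G H (Inl (g \<otimes>\<^bsub>G\<^esub> g')) w)"
proof (cases w)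
  case (Cons m w')
  show ?thesis
  proof (cases m)
    case (Inl a)
    have c: "g \<in> carrier G" "g' \<in> carrier G" "a \<in> carrier G" "a \<noteq> \<one>\<^bsub>G\<^esub>" "g \<noteq> \<one>\<^bsub>G\<^esub>"
      using assms Cons Inl by (auto simp: free_product_def fp_letters_def)
    have w': "fp_cons G H (Inl b) w' = Inl b # w'" for b
      using assms(3) Cons Inl
      by (cases w'; cases "hd w'") (auto simp: free_product_def alternating_def)
    have 1: "g \<otimes>\<^bsub>G\<^esub> (g' \<otimes>\<^bsub>G\<^esub> a) = g" if "g' \<otimes>\<^bsub>G\<^esub> a = \<one>\<^bsub>G\<^esub>"
      using that c by simp
    have 2: "g \<otimes>\<^bsub>G\<^esub> (g' \<otimes>\<^bsub>G\<^esub> a) = a" if "g \<otimes>\<^bsub>G\<^esub> g' = \<one>\<^bsub>G\<^esub>"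
      using that c by (simp flip: G.m_assoc)
    show ?thesis
      using c 1 2 by (auto simp: Cons Inl w' G.m_assoc)
  qed (use Cons in auto)
qed auto

private lemma fp_cons_Inr:
  assumes "Inr g \<in> L" "Inr g' \<in> L" "w \<in> N"
  shows "fp_cons G H (Inr g) (fp_cons G H (Inr g') w) =
    (if g \<otimes>\<^bsub>H\<^esub> g' = \<one>\<^bsub>H\<^esub> then w else fp_cons G H (Inr (g \<otimes>\<^bsub>H\<^esub> g')) w)"
proof (cases w)
  case (Cons m w')
  show ?thesis
  proof (cases m)
    case (Inr a)
    have c: "g \<in> carrier H" "g' \<in> carrier H" "a \<in> carrier H" "a \<noteq> \<one>\<^bsub>H\<^esub>" "g \<noteq> \<one>\<^bsub>H\<^esub>"
      using assms Cons Inr by (auto simp: free_product_def fp_letters_def)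
    have w': "fp_cons G H (Inr b) w' = Inr b # w'" for b
      using assms(3) Cons Inr
      by (cases w'; cases "hd w'") (auto simp: free_product_def alternating_def)
    have 1: "g \<otimes>\<^bsub>H\<^esub> (g' \<otimes>\<^bsub>H\<^esub> a) = g" if "g' \<otimes>\<^bsub>H\<^esub> a = \<one>\<^bsub>H\<^esub>"
      using that c by simp
    have 2: "g \<otimes>\<^bsub>H\<^esub> (g' \<otimes>\<^bsub>H\<^esub> a) = a" if "g \<otimes>\<^bsub>H\<^esub> g' = \<one>\<^bsub>H\<^esub>"
      using that c by (simp flip: H.m_assoc)
    show ?thesis
      using c 1 2 by (auto simp: Cons Inr w' H.m_assoc)
  qed (use Cons in auto)
qed auto

private lemma foldr_fp_cons:
  assumes "l \<in> L" "w \<in> N" "t \<in> N"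
  shows "foldr (fp_cons G H) (fp_cons G H l w) t = fp_cons G H l (foldr (fp_cons G H) w t)"
proof (cases w)
  case (Cons m w')
  have "m \<in> L" "w' \<in> lists L"
    using N_ConsD[of m w'] assms(2) Cons by (auto simp: free_product_def)
  then have "foldr (fp_cons G H) w' t \<in> N"
    by (intro foldr_closed assms)
  then show ?thesis
    using Cons \<open>m \<in> L\<close> assms(1) by (cases l; cases m) (auto simp: fp_cons_Inl fp_cons_Inr)
qed simp

private lemma foldr_fp_cons_assoc:
  assumes "u \<in> lists L" "v \<in> N" "t \<in> N"
  shows "foldr (fp_cons G H) (foldr (fp_cons G H) u v) t
    = foldr (fp_cons G H) u (foldr (fp_cons G H) v t)"
  using assms by (induction u) (auto simp: foldr_fp_cons foldr_closed)

lemma group_free_product: "group (free_product G H)"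
proof (rule groupI)
  fix w assume "w \<in> N"
  then show "\<exists>v \<in> N. v \<otimes>\<^bsub>free_product G H\<^esub> w = \<one>\<^bsub>free_product G H\<^esub>"
  proof (induction w rule: list.induct)
    case Nil
    then show ?case by (intro bexI[of _ "[]"]) (auto simp: free_product_def)
  next
    case (Cons l w)
    then have lw: "l \<in> L" "w \<in> N" using N_ConsD by blast+
    then obtain v where v: "v \<in> N" "foldr (fp_cons G H) v w = []"
      using Cons.IH by (auto simp: free_product_def)
    define l' where "l' = map_sum (m_inv G) (m_inv H) l"
    have l': "l' \<in> L" "fp_cons G H l' (l # w) = w"
      using lw by (auto simp: l'_def fp_letters_def)
    then have "[l'] \<in> N"
      by (auto simp: free_product_def alternating_def)
    moreover have vL: "v \<in> lists L"
      using v by (simp add: free_product_def)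
    ultimately have "foldr (fp_cons G H) v [l'] \<in> N"
      and "foldr (fp_cons G H) (foldr (fp_cons G H) v [l']) (l # w) = []"
      using foldr_fp_cons_assoc[OF vL _ Cons.prems, of "[l']"] l' v foldr_closed by auto
    then show ?case
      by (auto simp: free_product_def)
  qed
next
  fix u v t assume "u \<in> N" "v \<in> N" "t \<in> N"
  then show "(u \<otimes>\<^bsub>free_product G H\<^esub> v) \<otimes>\<^bsub>free_product G H\<^esub> t
      = u \<otimes>\<^bsub>free_product G H\<^esub> (v \<otimes>\<^bsub>free_product G H\<^esub> t)"
    using foldr_fp_cons_assoc[of u v t] by (simp add: free_product_def)
next
  fix u v assume "u \<in> N" "v \<in> N"
  then show "u \<otimes>\<^bsub>free_product G H\<^esub> v \<in> N"
    using foldr_closed[of u v] by (simp add: free_product_def)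
qed (auto simp: free_product_def alternating_def)

lemma fp_inl_mon: "fp_inl G \<in> mon G (free_product G H)"
  by (auto simp: mon_def hom_def fp_inl_def free_product_def alternating_def fp_letters_def
      inj_on_def)

lemma fp_inr_mon: "fp_inr H \<in> mon H (free_product G H)"
  by (auto simp: mon_def hom_def fp_inr_def free_product_def alternating_def fp_letters_def
      inj_on_def)

end

lemma free_product_universal:
  assumes "group G" "group H" "group K" "f \<in> hom G K" "g \<in> hom H K"
  defines "h \<equiv> \<lambda>w. foldr (\<lambda>l a. case_sum f g l \<otimes>\<^bsub>K\<^esub> a) w \<one>\<^bsub>K\<^esub>"
  shows "h \<in> hom (free_product G H) K"
    and "x \<in> carrier G \<Longrightarrow> h (fp_inl G x) = f x"
    and "y \<in> carrier H \<Longrightarrow> h (fp_inr H y) = g y"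
proof -
  interpret G: group G by fact
  interpret H: group H by fact
  interpret K: group K by fact
  interpret f: group_hom G K f by unfold_locales fact
  interpret g: group_hom H K g by unfold_locales fact
  have cl: "case_sum f g l \<in> carrier K" if "l \<in> fp_letters G H" for l
    using that by (auto simp: fp_letters_def)
  have hcl: "h w \<in> carrier K" if "w \<in> lists (fp_letters G H)" for w
    using that by (induction w) (auto simp: h_def cl)
  have cons: "h (fp_cons G H l w) = case_sum f g l \<otimes>\<^bsub>K\<^esub> h w"
    if "l \<in> fp_letters G H" "w \<in> lists (fp_letters G H)" for l w
  proof (cases w)
    case (Cons m w')
    have "h w' \<in> carrier K" "m \<in> fp_letters G H"
      using that Cons hcl[of w'] by auto
    moreover have "f a \<otimes>\<^bsub>K\<^esub> (f b \<otimes>\<^bsub>K\<^esub> k) = f (a \<otimes>\<^bsub>G\<^esub> b) \<otimes>\<^bsub>K\<^esub> k"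
      if "a \<in> carrier G" "b \<in> carrier G" "k \<in> carrier K" for a b k
      using that by (simp add: K.m_assoc)
    moreover have "g a \<otimes>\<^bsub>K\<^esub> (g b \<otimes>\<^bsub>K\<^esub> k) = g (a \<otimes>\<^bsub>H\<^esub> b) \<otimes>\<^bsub>K\<^esub> k"
      if "a \<in> carrier H" "b \<in> carrier H" "k \<in> carrier K" for a b k
      using that by (simp add: K.m_assoc)
    ultimately show ?thesis
      using Cons that(1)
      by (cases l; cases m)
        (auto simp: h_def fp_letters_def simp del: f.hom_mult g.hom_mult)
  qed (simp add: h_def)
  have lists: "fp_cons G H l w \<in> lists (fp_letters G H)"
    if "l \<in> fp_letters G H" "w \<in> lists (fp_letters G H)" for l w
    using that by (cases "(G, H, l, w)" rule: fp_cons.cases) (auto simp: fp_letters_def)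
  have flists: "foldr (fp_cons G H) u v \<in> lists (fp_letters G H)"
    if "u \<in> lists (fp_letters G H)" "v \<in> lists (fp_letters G H)" for u v
    using that by (induction u) (simp_all add: lists del: in_lists_conv_set)
  have "h (foldr (fp_cons G H) u v) = h u \<otimes>\<^bsub>K\<^esub> h v"
    if "u \<in> lists (fp_letters G H)" "v \<in> lists (fp_letters G H)" for u v
    using that
  proof (induction u rule: list.induct)
    case Nil
    then show ?case using hcl[of v] by (simp add: h_def)
  next
    case (Cons l u)
    then have "l \<in> fp_letters G H" "u \<in> lists (fp_letters G H)" by auto
    then have "h (foldr (fp_cons G H) (l # u) v) = case_sum f g l \<otimes>\<^bsub>K\<^esub> (h u \<otimes>\<^bsub>K\<^esub> h v)"
      using cons[of l "foldr (fp_cons G H) u v"] flists[of u v] Cons by simp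
    also have "\<dots> = h (l # u) \<otimes>\<^bsub>K\<^esub> h v"
      using cl \<open>l \<in> _\<close> hcl[of u] hcl[of v] Cons.prems \<open>u \<in> _\<close>
      by (simp add: h_def K.m_assoc)
    finally show ?case .
  qed
  then show "h \<in> hom (free_product G H) K"
    using hcl by (auto simp: hom_def free_product_def)
  show "x \<in> carrier G \<Longrightarrow> h (fp_inl G x) = f x"
    by (auto simp: h_def fp_inl_def)
  show "y \<in> carrier H \<Longrightarrow> h (fp_inr H y) = g y"
    by (auto simp: h_def fp_inr_def)
qed

section \<open>Quotients by normal closures\<close>

definition normal_closure :: "('g, 'b) monoid_scheme \<Rightarrow> 'g set \<Rightarrow> 'g set" where
  "normal_closure G S = generate G {g \<otimes>\<^bsub>G\<^esub> s \<otimes>\<^bsub>G\<^esub> inv\<^bsub>G\<^esub> g | g s. g \<in> carrier G \<and> s \<in> S}"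

definition add_relator :: "('g, 'b) monoid_scheme \<Rightarrow> 'g \<Rightarrow> 'g set monoid" where
  "add_relator G r = G Mod normal_closure G {r}"

lemma (in group) normal_normal_closure:
  assumes "S \<subseteq> carrier G"
  shows "normal_closure G S \<lhd> G"
  unfolding normal_closure_def
proof (rule normal_generateI)
  fix h x assume h: "h \<in> {g \<otimes> s \<otimes> inv g | g s. g \<in> carrier G \<and> s \<in> S}" and x: "x \<in> carrier G"
  then obtain g s where gs: "h = g \<otimes> s \<otimes> inv g" "g \<in> carrier G" "s \<in> S" by auto
  then have "x \<otimes> h \<otimes> inv x = (x \<otimes> g) \<otimes> s \<otimes> inv (x \<otimes> g)"
    using x assms by (auto simp: m_assoc inv_mult_group subset_iff)
  then show "x \<otimes> h \<otimes> inv x \<in> {g \<otimes> s \<otimes> inv g | g s. g \<in> carrier G \<and> s \<in> S}"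
    using gs x by blast
qed (use assms in auto)

lemma (in group) subset_normal_closure:
  assumes "S \<subseteq> carrier G"
  shows "S \<subseteq> normal_closure G S"
proof
  fix s assume s: "s \<in> S"
  then have "s = \<one> \<otimes> s \<otimes> inv \<one>" using assms by auto
  then show "s \<in> normal_closure G S"
    unfolding normal_closure_def using s by (intro generate.incl) blast
qed

lemma (in group) normal_closure_least:
  assumes "N \<lhd> G" "S \<subseteq> N"
  shows "normal_closure G S \<subseteq> N"
  unfolding normal_closure_def
  using assms
  by (intro generate_subgroup_incl normal_imp_subgroup) (auto simp: normal_inv_iff)

lemma (in group) group_add_relator: "r \<in> carrier G \<Longrightarrow> group (add_relator G r)"
  unfolding add_relator_def by (intro normal.factorgroup_is_group normal_normal_closure) simp

definition residually_finite :: "('g, 'b) monoid_scheme \<Rightarrow> bool" where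
  "residually_finite G \<longleftrightarrow> group G \<and>
    (\<forall>g \<in> carrier G - {\<one>\<^bsub>G\<^esub>}. \<exists>N. N \<lhd> G \<and> finite (carrier (G Mod N)) \<and> g \<notin> N)"

definition free_gen :: "'a \<Rightarrow> 'a word" where
  "free_gen x = [(x, True)]"

definition word_in_free_group :: "'a set \<Rightarrow> 'a word \<Rightarrow> 'a word" where
  "word_in_free_group X w = eval_word (free_group X) free_gen w"

definition one_relator_presented :: "'a set \<Rightarrow> 'a word \<Rightarrow> 'a word set monoid" where
  "one_relator_presented X w = add_relator (free_group X) (word_in_free_group X w)"

text \<open>The generating set may be taken inside the element type \<^typ>\<open>'g\<close> of \<^term>\<open>G\<close> (its members
  need not be the generating elements): a one-relator group on a finite set of at least two
  generators is infinite, and on an infinite set of generators it surjects onto the free group on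
  the generators not occurring in the relator, so a generating set with more than one element
  always injects into the group.\<close>

definition one_relator_group :: "('g, 'b) monoid_scheme \<Rightarrow> bool" where
  "one_relator_group G \<longleftrightarrow> group G \<and>
    (\<exists>(X :: 'g set) w. w \<in> lists (X \<times> UNIV) \<and> G \<cong> one_relator_presented X w)"

section \<open>Relative presentations\<close>

text \<open>The expression \<open>x\<^sub>1\<^sup>\<epsilon>\<^sup>1 h\<^sub>1 \<dots> x\<^sub>r\<^sup>\<epsilon>\<^sup>r h\<^sub>r\<close> is the list of the pairs
  \<open>((x\<^sub>i, \<epsilon>\<^sub>i = 1), h\<^sub>i)\<close>; its skeleton is a word.\<close>

type_synonym ('a, 'h) rel_expr = "(('a \<times> bool) \<times> 'h) list"

definition relative_presentation ::
  "'a set \<Rightarrow> ('h, 'b) monoid_scheme \<Rightarrow> ('a, 'h) rel_expr \<Rightarrow> bool" where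
  "relative_presentation X H R \<longleftrightarrow>
    group H \<and> R \<noteq> [] \<and> R \<in> lists ((X \<times> UNIV) \<times> carrier H)"

definition skeleton :: "('a, 'h) rel_expr \<Rightarrow> 'a word" where
  "skeleton R = map fst R"

definition ambient :: "'a set \<Rightarrow> ('h, 'b) monoid_scheme \<Rightarrow> ('h + 'a word) list monoid" where
  "ambient X H = free_product H (free_group X)"

definition ambient_gen :: "'a set \<Rightarrow> 'a \<Rightarrow> ('h + 'a word) list" where
  "ambient_gen X x = fp_inr (free_group X) (free_gen x)"

definition rel_element ::
  "'a set \<Rightarrow> ('h, 'b) monoid_scheme \<Rightarrow> ('a, 'h) rel_expr \<Rightarrow> ('h + 'a word) list" where
  "rel_element X H R =
    foldr (\<lambda>(l, h) g.
        eval_word (ambient X H) (ambient_gen X) [l] \<otimes>\<^bsub>ambient X H\<^esub>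
          (fp_inl H h \<otimes>\<^bsub>ambient X H\<^esub> g))
      R \<one>\<^bsub>ambient X H\<^esub>"

definition rel_group ::
  "'a set \<Rightarrow> ('h, 'b) monoid_scheme \<Rightarrow> ('a, 'h) rel_expr \<Rightarrow> ('h + 'a word) list set monoid" where
  "rel_group X H R = add_relator (ambient X H) (rel_element X H R)"

definition rel_power_group ::
  "'a set \<Rightarrow> ('h, 'b) monoid_scheme \<Rightarrow> ('a, 'h) rel_expr \<Rightarrow> nat \<Rightarrow> ('h + 'a word) list set monoid"
where
  "rel_power_group X H R n =
    add_relator (ambient X H) (rel_element X H R [^]\<^bsub>ambient X H\<^esub> n)"

definition rel_subst_element ::
  "'a set \<Rightarrow> 'a set \<Rightarrow> 'a \<Rightarrow> ('h, 'b) monoid_scheme \<Rightarrow> ('a, 'h) rel_expr \<Rightarrow> 'a word \<Rightarrow>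
    ('h + 'a word) list" where
  "rel_subst_element X Y z H R S =
    eval_word (ambient (X \<union> Y) H)
      ((ambient_gen (X \<union> Y))(z := rel_element (X \<union> Y) H R)) S"

definition rel_subst_group ::
  "'a set \<Rightarrow> 'a set \<Rightarrow> 'a \<Rightarrow> ('h, 'b) monoid_scheme \<Rightarrow> ('a, 'h) rel_expr \<Rightarrow> 'a word \<Rightarrow>
    ('h + 'a word) list set monoid" where
  "rel_subst_group X Y z H R S =
    add_relator (ambient (X \<union> Y) H) (rel_subst_element X Y z H R S)"

lemma free_gen_closed: "x \<in> X \<Longrightarrow> free_gen x \<in> carrier (free_group X)"
  by (simp add: free_group_def free_gen_def reduced_def)

lemma group_ambient: "group H \<Longrightarrow> group (ambient X H)"
  unfolding ambient_def by (intro group_free_product group_free_group)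

lemma ambient_gen_closed: "group H \<Longrightarrow> x \<in> X \<Longrightarrow> ambient_gen X x \<in> carrier (ambient X H)"
  using fp_inr_mon[OF _ group_free_group, of H X] free_gen_closed[of x X]
  by (auto simp: mon_def hom_def ambient_def ambient_gen_def)

lemma rel_element_closed:
  assumes "relative_presentation X' H R" "X' \<subseteq> X"
  shows "rel_element X H R \<in> carrier (ambient X H)"
proof -
  have H: "group H" and R: "R \<in> lists ((X \<times> UNIV) \<times> carrier H)"
    using assms by (auto simp: relative_presentation_def)
  interpret A: group "ambient X H" by (rule group_ambient[OF H])
  have *: "fp_inl H h \<in> carrier (ambient X H)" if "h \<in> carrier H" for h
    using fp_inl_mon[OF H group_free_group, of X] that by (auto simp: mon_def hom_def ambient_def)
  have **: "eval_word (ambient X H) (ambient_gen X) [l] \<in> carrier (ambient X H)"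
    if "l \<in> X \<times> UNIV" for l
    using that by (intro eval_word_closed[OF A.is_group, of _ X]) (auto simp: ambient_gen_closed[OF H])
  show ?thesis
    using R by (induction R) (auto simp: rel_element_def * **)
qed

lemma group_rel_group: "relative_presentation X H R \<Longrightarrow> group (rel_group X H R)"
  unfolding rel_group_def
  by (intro group.group_add_relator group_ambient rel_element_closed[of X])
    (auto simp: relative_presentation_def)

section \<open>The unique max-min property\<close>

definition weight_function :: "'a set \<Rightarrow> ('a \<Rightarrow> int) \<Rightarrow> bool" where
  "weight_function X \<theta> \<longleftrightarrow> generate integer_group (\<theta> ` X) = carrier integer_group"

definition strict_weight :: "'a set \<Rightarrow> ('a \<Rightarrow> int) \<Rightarrow> bool" where
  "strict_weight X \<theta> \<longleftrightarrow> (\<forall>x \<in> X. \<theta> x \<noteq> 0)"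

text \<open>The letters of a word are numbered from 1, that is, \<open>x\<^sub>i\<close> is \<open>fst (W ! (i - 1))\<close>. With
  subscripts modulo the length \<open>r\<close>, the letter \<open>x\<^bsub>k+1\<^esub>\<close> is \<open>fst (W ! (k mod r))\<close>.\<close>

definition partial_weight :: "('a \<Rightarrow> int) \<Rightarrow> 'a word \<Rightarrow> nat \<Rightarrow> int" where
  "partial_weight \<theta> W j =
    (\<Sum>i = 1..j. (if snd (W ! (i - 1)) then 1 else - 1) * \<theta> (fst (W ! (i - 1))))"

definition admissible :: "('a \<Rightarrow> int) \<Rightarrow> 'a word \<Rightarrow> bool" where
  "admissible \<theta> W \<longleftrightarrow> partial_weight \<theta> W (length W) = 0"

definition unique_max_min :: "'a set \<Rightarrow> 'a word \<Rightarrow> bool" where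
  "unique_max_min X W \<longleftrightarrow>
    (\<exists>\<theta>. weight_function X \<theta> \<and> strict_weight X \<theta> \<and> admissible \<theta> W \<and>
      (let r = length W; \<phi> = partial_weight \<theta> W in
        \<exists>k \<in> {1..r}. \<exists>l \<in> {1..r}.
          (\<forall>j \<in> {1..r} - {k}. \<phi> j < \<phi> k) \<and>
          (\<forall>j \<in> {1..r} - {l}. \<phi> j > \<phi> l) \<and>
          fst (W ! (k - 1)) \<noteq> fst (W ! (k mod r)) \<and>
          fst (W ! (l - 1)) \<noteq> fst (W ! (l mod r))))"

definition M_presentation ::
  "'a set \<Rightarrow> ('h, 'b) monoid_scheme \<Rightarrow> ('a, 'h) rel_expr \<Rightarrow> bool" where
  "M_presentation X H R \<longleftrightarrow> relative_presentation X H R \<and> unique_max_min X (skeleton R)"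

end

theory Submission
  imports Defs "HOL-Combinatorics.Permutations"
begin

text \<open>A weight function makes every word a path in \<open>\<int>\<close>: a letter \<open>x\<^sup>\<plusminus>\<^sup>1\<close> moves the height by \<open>\<plusminus>\<theta> x\<close>
  along an edge of type \<open>x\<close>, and elements of \<open>\<Phi>\<close> do not move it. In \<open>\<langle>\<^bold>x, \<^bold>y, \<Phi>; S(\<^bold>y, R)\<rangle>\<close> the relation is
  \<open>R = z\<close> with \<open>z\<close> in the group \<open>K\<close>, so this is a relative presentation with coefficients in \<open>K\<close>.
  Each translate of \<open>R\<close> passes exactly once through its top edge, of type \<open>a\<close> say, and exactly once
  through its bottom edge, of type \<open>c\<close>. The top edge can hence be eliminated from words, which gives
  a normal form for elements: a reduced word in the remaining edges and elements of \<open>K\<close>. If \<open>K\<close> is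
  residually finite, a nontrivial reduced word moves a point in a finite permutation representation
  \<open>\<Omega>\<close> of \<open>K\<close> and the remaining edges. The relation determines the missing edge values at the top as
  well as those at the bottom, so the values form a reversible recurrence over a finite set, hence are
  periodic, say modulo \<open>q\<close>; this defines an action of the whole group on \<open>\<int>/q \<times> \<Omega>\<close>. The same recurrence
  without periodicity, for the regular action of an arbitrary \<open>K\<close>, shows that \<open>K\<close> embeds. The groups
  \<open>G\<close> and \<open>G\<^sub>n\<close> are the cases \<open>S = z\<close> and \<open>S = z\<^sup>n\<close> with \<open>\<^bold>y\<close> empty.\<close>

section \<open>Words and homomorphisms\<close>

text \<open>The difficulty is to satisfy the relation at all heights at once while keeping
  prescribed values along the path of a given word. Solving upwards alone would give values that are
  only eventually periodic, and the prescribed ones might lie before the cycle. Since a window also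
  determines its predecessor, the shift of windows is injective, and over a finite set the
  prescribed window itself recurs. Only the existence of normal forms is proved beforehand; that a
  reduced word is nontrivial is seen from its action. A word may be read from any starting height,
  and from a high one its path stays at nonnegative heights. So edges are eliminated at the top
  only, and the surviving edges are those whose values, up to any given height, can be prescribed.
  The set \<open>\<Omega>\<close> comes from the word itself: one copy of a finite quotient of
  \<open>K\<close> for each position, with the letters leading from one position to the next. That
  the word is reduced is what lets these partial moves extend to permutations.\<close>

lemma eval_word_Nil [simp]: "eval_word G f [] = \<one>\<^bsub>G\<^esub>"
  by (simp add: eval_word_def)

lemma eval_word_Cons [simp]:
  "eval_word G f ((x, b) # w) = (if b then f x else inv\<^bsub>G\<^esub> (f x)) \<otimes>\<^bsub>G\<^esub> eval_word G f w"
  by (simp add: eval_word_def)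

lemma eval_word_cong:
  assumes "\<And>x. x \<in> fst ` set w \<Longrightarrow> f x = g x"
  shows "eval_word G f w = eval_word G g w"
  using assms by (induction w) auto

lemma eval_word_append:
  assumes "group G" "f \<in> X \<rightarrow> carrier G" "u \<in> lists (X \<times> UNIV)" "v \<in> lists (X \<times> UNIV)"
  shows "eval_word G f (u @ v) = eval_word G f u \<otimes>\<^bsub>G\<^esub> eval_word G f v"
proof -
  interpret group G by fact
  have v: "eval_word G f v \<in> carrier G"
    using assms by (intro eval_word_closed)
  show ?thesis
    using assms(3)
  proof (induction u rule: list.induct)
    case (Cons l u)
    have "eval_word G f u \<in> carrier G"
      using Cons.prems by (intro eval_word_closed[OF assms(1,2)]) auto
    then show ?case
      using Cons v funcset_mem[OF assms(2)] by (cases l) (auto simp: m_assoc)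
  qed (simp add: v)
qed

lemma hom_eval_word:
  assumes "group G" "group T" "h \<in> hom G T" "f \<in> X \<rightarrow> carrier G" "w \<in> lists (X \<times> UNIV)"
  shows "h (eval_word G f w) = eval_word T (h \<circ> f) w"
proof -
  interpret G: group G by fact
  interpret T: group T by fact
  interpret h: group_hom G T h by unfold_locales fact
  show ?thesis
    using assms(5)
  proof (induction w rule: list.induct)
    case (Cons l w)
    have "eval_word G f w \<in> carrier G"
      using Cons.prems by (intro eval_word_closed[OF assms(1,4)]) auto
    then show ?case
      using Cons funcset_mem[OF assms(4)] by (cases l) auto
  qed simp
qed

lemma eval_word_replicate:
  assumes "group G" "f x \<in> carrier G"
  shows "eval_word G f (replicate n (x, True)) = f x [^]\<^bsub>G\<^esub> n"
proof -
  interpret group G by fact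
  show ?thesis
  proof (induction n)
    case (Suc n)
    then show ?case
      using nat_pow_Suc2[OF assms(2), of n] by simp
  qed simp
qed

lemma free_gen_funcset: "free_gen \<in> X \<rightarrow> carrier (free_group X)"
  by (simp add: free_gen_closed)

text \<open>In a reduced word no letter cancels against the rest, so multiplying by the letters one
  after the other rebuilds the word.\<close>

lemma eval_word_free_gen:
  assumes "w \<in> carrier (free_group X)"
  shows "eval_word (free_group X) free_gen w = w"
proof -
  interpret group "free_group X" by (rule group_free_group)
  have letter: "(if b then free_gen x else inv\<^bsub>free_group X\<^esub> free_gen x) = [(x, b)]" if "x \<in> X" for x b
  proof -
    have "[(x, False)] \<in> carrier (free_group X)"
      using that by (simp add: free_group_def reduced_def)
    moreover have "[(x, False)] \<otimes>\<^bsub>free_group X\<^esub> free_gen x = \<one>\<^bsub>free_group X\<^esub>"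
      by (simp add: free_group_def free_gen_def cancelling_def)
    ultimately have "inv\<^bsub>free_group X\<^esub> free_gen x = [(x, False)]"
      by (intro inv_equality free_gen_closed that)
    then show ?thesis by (simp add: free_gen_def)
  qed
  have "w \<in> lists (X \<times> UNIV)" "reduced w"
    using assms by (auto simp: free_group_def)
  then show ?thesis
  proof (induction w rule: list.induct)
    case (Cons l w)
    then have "eval_word (free_group X) free_gen w = w"
      using reduced_ConsD[of l w] by auto
    then have "eval_word (free_group X) free_gen (l # w) = [l] \<otimes>\<^bsub>free_group X\<^esub> w"
      using Cons.prems by (cases l) (auto simp: letter simp del: if_split)
    then show ?case
      using red_cons_reduced[OF Cons.prems(2)] by (simp add: free_group_def)
  qed (simp add: free_group_def)
qed

lemma hom_free_group_eq:
  assumes "group T" "h \<in> hom (free_group X) T" "w \<in> carrier (free_group X)"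
  shows "h w = eval_word T (h \<circ> free_gen) w"
proof -
  have "w \<in> lists (X \<times> UNIV)"
    using assms(3) by (simp add: free_group_def)
  then show ?thesis
    using hom_eval_word[OF group_free_group assms(1,2) free_gen_funcset] eval_word_free_gen[OF assms(3)]
    by metis
qed

section \<open>Residual finiteness and quotients\<close>

lemma residually_finiteI:
  assumes "group G"
    and "\<And>g. g \<in> carrier G \<Longrightarrow> g \<noteq> \<one>\<^bsub>G\<^esub> \<Longrightarrow>
      \<exists>N. N \<lhd> G \<and> finite (carrier (G Mod N)) \<and> g \<notin> N"
  shows "residually_finite G"
  using assms by (auto simp: residually_finite_def)

lemma finite_hom_separates:
  assumes "group G" "group T" "finite (carrier T)" "h \<in> hom G T" "g \<in> carrier G" "h g \<noteq> \<one>\<^bsub>T\<^esub>"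
  shows "\<exists>N. N \<lhd> G \<and> finite (carrier (G Mod N)) \<and> g \<notin> N"
proof -
  interpret G: group G by fact
  interpret T: group T by fact
  interpret h: group_hom G T h by unfold_locales fact
  have "(\<lambda>X. the_elem (h ` X)) ` carrier (G Mod kernel G T h) \<subseteq> carrier T"
    by (auto simp: h.FactGroup_the_elem_mem)
  then have "finite (carrier (G Mod kernel G T h))"
    using inj_on_finite[OF h.FactGroup_inj_on _ assms(3)] by blast
  then show ?thesis
    using h.normal_kernel assms(6) by (auto simp: kernel_def)
qed

lemma residually_finite_finite:
  assumes "group G" "finite (carrier G)"
  shows "residually_finite G"
proof (rule residually_finiteI[OF assms(1)])
  fix g assume "g \<in> carrier G" "g \<noteq> \<one>\<^bsub>G\<^esub>"
  then show "\<exists>N. N \<lhd> G \<and> finite (carrier (G Mod N)) \<and> g \<notin> N"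
    using finite_hom_separates[OF assms(1,1,2), of "\<lambda>x. x" g] by (auto simp: hom_def)
qed

lemma residually_finite_inj_hom:
  assumes "group G" "residually_finite T" "h \<in> hom G T"
    and inj: "\<And>g. g \<in> carrier G \<Longrightarrow> g \<noteq> \<one>\<^bsub>G\<^esub> \<Longrightarrow> h g \<noteq> \<one>\<^bsub>T\<^esub>"
  shows "residually_finite G"
proof (rule residually_finiteI[OF assms(1)])
  fix g assume g: "g \<in> carrier G" "g \<noteq> \<one>\<^bsub>G\<^esub>"
  interpret G: group G by fact
  interpret T: group T using assms(2) by (simp add: residually_finite_def)
  have "h g \<in> carrier T - {\<one>\<^bsub>T\<^esub>}"
    using assms(3) g inj by (auto simp: hom_def)
  then obtain N where N: "N \<lhd> T" "finite (carrier (T Mod N))" "h g \<notin> N"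
    using assms(2) by (auto simp: residually_finite_def)
  interpret N: normal N T by (rule N)
  have "(\<lambda>a. N #>\<^bsub>T\<^esub> a) \<circ> h \<in> hom G (T Mod N)"
    by (rule Group.hom_compose[OF assms(3) N.r_coset_hom_Mod])
  moreover have "((\<lambda>a. N #>\<^bsub>T\<^esub> a) \<circ> h) g \<noteq> \<one>\<^bsub>T Mod N\<^esub>"
    using N(3) \<open>h g \<in> _\<close> T.rcos_self[OF _ N.subgroup_axioms, of "h g"] by auto
  ultimately show "\<exists>N. N \<lhd> G \<and> finite (carrier (G Mod N)) \<and> g \<notin> N"
    by (intro finite_hom_separates[OF assms(1) N.factorgroup_is_group N(2) _ g(1)])
qed

text \<open>Two normal subgroups of finite index meet in another one, because a coset of the
  intersection is determined by the two cosets that contain it. The lemma serves to find one finite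
  quotient in which all nontrivial coefficients of a word stay nontrivial.\<close>

lemma residually_finite_finite_set:
  fixes G (structure)
  assumes "residually_finite G" "finite A" "A \<subseteq> carrier G - {\<one>\<^bsub>G\<^esub>}"
  shows "\<exists>N. N \<lhd> G \<and> finite (carrier (G Mod N)) \<and> A \<inter> N = {}"
  using assms(2,3)
proof (induction A)
  case empty
  interpret group G using assms(1) by (simp add: residually_finite_def)
  have "carrier G \<lhd> G" by (rule normal_self)
  moreover have "carrier (G Mod carrier G) \<subseteq> {carrier G}"
    by (auto simp: carrier_FactGroup coset_join2 subgroup_self)
  ultimately show ?case
    by (intro exI[of _ "carrier G"]) (auto intro: finite_subset)
next
  case (insert g A)
  interpret group G using assms(1) by (simp add: residually_finite_def)
  obtain N where N: "N \<lhd> G" "finite (carrier (G Mod N))" "A \<inter> N = {}"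
    using insert by auto
  obtain M where M: "M \<lhd> G" "finite (carrier (G Mod M))" "g \<notin> M"
    using insert.prems assms(1) by (auto simp: residually_finite_def)
  interpret N: normal N G by (rule N)
  interpret M: normal M G by (rule M)
  have NM: "N \<inter> M \<lhd> G"
    using N(1) M(1) by (auto simp: normal_inv_iff intro: subgroups_Inter_pair)
  \<comment> \<open>\<open>N <#> C\<close> is the coset of \<open>N\<close> that contains the coset
    \<open>C\<close> of \<open>N \<inter> M\<close>.\<close>
  let ?f = "\<lambda>C. (N <#> C, M <#> C)"
  have eqN: "N <#> (N \<inter> M #> x) = N #> x" if "x \<in> carrier G" for x
  proof -
    have "N <#> (N \<inter> M) = N"
      using N.subgroup_axioms NM[THEN normal_imp_subgroup]
      by (auto simp: set_mult_def subset_iff)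
    then show ?thesis
      using setmult_rcos_assoc[of N "N \<inter> M" x] N.subset that by auto
  qed
  have eqM: "M <#> (N \<inter> M #> x) = M #> x" if "x \<in> carrier G" for x
  proof -
    have "M <#> (N \<inter> M) = M"
      using M.subgroup_axioms
      by (auto simp: set_mult_def subset_iff)
    then show ?thesis
      using setmult_rcos_assoc[of M "N \<inter> M" x] N.subset M.subset that by auto
  qed
  have "inj_on ?f (carrier (G Mod (N \<inter> M)))"
  proof (rule inj_onI)
    fix C D assume "C \<in> carrier (G Mod (N \<inter> M))" "D \<in> carrier (G Mod (N \<inter> M))"
      and eq: "?f C = ?f D"
    then obtain x y where xy: "x \<in> carrier G" "y \<in> carrier G" "C = N \<inter> M #> x" "D = N \<inter> M #> y"
      by (auto simp: carrier_FactGroup)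
    then have "N #> x = N #> y" "M #> x = M #> y"
      using eq eqN eqM by auto
    then have "x \<in> N #> y" "x \<in> M #> y"
      using rcos_self[OF xy(1) N.subgroup_axioms] rcos_self[OF xy(1) M.subgroup_axioms] by auto
    then have "x \<otimes> inv y \<in> N" "x \<otimes> inv y \<in> M"
      using N.rcos_module M.rcos_module xy is_group by blast+
    then have "x \<in> N \<inter> M #> y"
      using subgroup.rcos_module[OF normal_imp_subgroup[OF NM] is_group xy(2,1)] by auto
    then show "C = D"
      using repr_independence[OF _ xy(2) normal_imp_subgroup[OF NM]] xy by simp
  qed
  moreover have "?f ` carrier (G Mod (N \<inter> M)) \<subseteq> carrier (G Mod N) \<times> carrier (G Mod M)"
    by (auto simp: carrier_FactGroup eqN eqM)
  ultimately have "finite (carrier (G Mod (N \<inter> M)))"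
    using N(2) M(2) by (meson finite_SigmaI inj_on_finite)
  then show ?case
    using NM N(3) M(3) by (intro exI[of _ "N \<inter> M"]) auto
qed

section \<open>Projection and universal property for a single added relator\<close>

definition quot_map :: "('g, 'b) monoid_scheme \<Rightarrow> 'g \<Rightarrow> 'g \<Rightarrow> 'g set" where
  "quot_map G r g = normal_closure G {r} #>\<^bsub>G\<^esub> g"

lemma quot_map_hom:
  assumes "group G" "r \<in> carrier G"
  shows "quot_map G r \<in> hom G (add_relator G r)"
proof -
  interpret normal "normal_closure G {r}" G
    using assms by (intro group.normal_normal_closure) auto
  show ?thesis
    using r_coset_hom_Mod by (simp add: quot_map_def[abs_def] add_relator_def)
qed

lemma carrier_add_relator: "carrier (add_relator G r) = quot_map G r ` carrier G"
  by (simp add: add_relator_def quot_map_def carrier_FactGroup)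

lemma quot_map_relator:
  assumes "group G" "r \<in> carrier G"
  shows "quot_map G r r = \<one>\<^bsub>add_relator G r\<^esub>"
proof -
  interpret group G by fact
  interpret normal "normal_closure G {r}" G
    using assms by (intro group.normal_normal_closure) auto
  have "r \<in> normal_closure G {r}"
    using subset_normal_closure[of "{r}"] assms by auto
  then show ?thesis
    using rcos_const[OF is_group] assms coset_join2 subgroup_axioms
    by (simp add: add_relator_def quot_map_def)
qed

lemma add_relator_universal:
  assumes "group G" "r \<in> carrier G" "group T" "F \<in> hom G T" "F r = \<one>\<^bsub>T\<^esub>"
  obtains F' where "F' \<in> hom (add_relator G r) T"
    "\<And>g. g \<in> carrier G \<Longrightarrow> F' (quot_map G r g) = F g"
proof -
  interpret G: group G by fact
  interpret T: group T by fact
  interpret F: group_hom G T F by unfold_locales fact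
  have "normal_closure G {r} \<subseteq> kernel G T F"
    using assms by (intro G.normal_closure_least F.normal_kernel) (auto simp: kernel_def)
  then show ?thesis
    using F.FactGroup_universal_kernel[OF G.normal_normal_closure[of "{r}"]] assms that
    unfolding add_relator_def quot_map_def by auto
qed

section \<open>Reversible recurrences\<close>

lemma bij_betw_int_orbit:
  assumes "bij_betw f S S" "s \<in> S"
  shows "\<exists>z :: int \<Rightarrow> 's. z 0 = s \<and> (\<forall>n. z n \<in> S \<and> z (n + 1) = f (z n))"
proof -
  define g where "g = inv_into S f"
  have f: "f x \<in> S" if "x \<in> S" for x
    using that assms(1) by (auto simp: bij_betw_def)
  have g: "g x \<in> S" "f (g x) = x" if "x \<in> S" for x
    using that assms(1) unfolding g_def by (auto simp: bij_betw_def inv_into_into f_inv_into_f)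
  define z where "z n = (if 0 \<le> n then (f ^^ nat n) s else (g ^^ nat (- n)) s)" for n
  have fz: "(f ^^ n) s \<in> S" "(g ^^ n) s \<in> S" for n
    using assms(2) f g by (induction n) auto
  have "z n \<in> S" for n
    using fz by (simp add: z_def)
  moreover have "z (n + 1) = f (z n)" for n
  proof (cases "0 \<le> n")
    case True
    then have "nat (n + 1) = Suc (nat n)" by simp
    then show ?thesis using True by (simp add: z_def)
  next
    case False
    then have *: "nat (- n) = Suc (nat (- n - 1))" by simp
    have "f (z n) = (g ^^ nat (- n - 1)) s"
      using False fz g(2) by (simp add: z_def *)
    moreover have "z (n + 1) = (g ^^ nat (- n - 1)) s"
      using False by (cases "n = - 1") (auto simp: z_def)
    ultimately show ?thesis by simp
  qed
  moreover have "z 0 = s" by (simp add: z_def)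
  ultimately show ?thesis by blast
qed

text \<open>By pigeonhole two values at nonnegative times agree. Injectivity of \<open>f\<close>
  carries the agreement backwards too, so the period holds at all times and not merely from some
  time on.\<close>

lemma int_orbit_periodic:
  fixes z :: "int \<Rightarrow> 's"
  assumes "finite S" "inj_on f S" "\<And>n. z n \<in> S" "\<And>n. z (n + 1) = f (z n)"
  obtains q where "q > 0" "\<And>n. z (n + q) = z n"
proof -
  have "\<not> inj_on (\<lambda>n. z (int n)) UNIV"
    using assms(1,3) by (metis finite_subset finite_imageD image_subsetI infinite_UNIV_nat)
  then obtain i j :: nat where ij: "i < j" "z (int i) = z (int j)"
    unfolding inj_on_def by (metis linorder_neqE_nat)
  define q where "q = int j - int i"
  have "z (n + q) = z n" for n
  proof (induction n rule: int_induct[where k = "int i"])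
    case base
    then show ?case using ij by (simp add: q_def)
  next
    case (step1 n)
    have "n + 1 + q = (n + q) + 1" by simp
    then show ?case using step1 assms(4)[of n] assms(4)[of "n + q"] by metis
  next
    case (step2 n)
    have "f (z (n - 1 + q)) = f (z (n - 1))"
      using step2 assms(4)[of "n - 1"] assms(4)[of "n - 1 + q"] by (simp add: algebra_simps)
    then show ?case
      using assms(2,3) by (auto dest: inj_onD)
  qed
  then show ?thesis
    using that[of q] ij by (simp add: q_def)
qed

text \<open>A relation on windows of length \<open>K + 1\<close> that determines either end of the window from the
  rest has bi-infinite solutions with arbitrary initial values; over a finite set the shift permutes
  the finitely many windows of length \<open>K\<close>, so the solutions are periodic.\<close>

lemma reversible_recurrence:
  fixes Q :: "(int \<Rightarrow> 'v) \<Rightarrow> bool" and K :: int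
  assumes K: "K > 0"
    and local: "\<And>u v. (\<And>i. 0 \<le> i \<Longrightarrow> i \<le> K \<Longrightarrow> u i = v i) \<Longrightarrow> Q u = Q v"
    and up: "\<And>u. (\<And>i. u i \<in> P) \<Longrightarrow> \<exists>!v. v \<in> P \<and> Q (u(K := v))"
    and down: "\<And>u. (\<And>i. u i \<in> P) \<Longrightarrow> \<exists>!v. v \<in> P \<and> Q (u(0 := v))"
    and u\<^sub>0: "\<And>i. u\<^sub>0 i \<in> P"
  obtains u q where "\<And>i. u i \<in> P" "\<And>i. 0 \<le> i \<Longrightarrow> i < K \<Longrightarrow> u i = u\<^sub>0 i"
    "\<And>n. Q (\<lambda>i. u (n + i))" "q \<ge> 0" "finite P \<Longrightarrow> q > 0" "\<And>n. u (n + q) = u n"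
proof -
  define S where "S = ({0..<K} \<rightarrow>\<^sub>E P)"
  have SP: "s i \<in> P" if "s \<in> S" "0 \<le> i" "i < K" for s i
    using that by (auto simp: S_def)
  have up': "\<exists>!v. v \<in> P \<and> Q (s(K := v))" if s: "\<And>i. 0 \<le> i \<Longrightarrow> i < K \<Longrightarrow> s i \<in> P" for s
  proof -
    \<comment> \<open>\<open>up\<close> wants values in \<open>P\<close> at every index. Outside the
      window a fixed element of \<open>P\<close> is filled in, which \<open>local\<close> makes
      invisible to \<open>Q\<close>.\<close>
    let ?u = "\<lambda>i. if 0 \<le> i \<and> i < K then s i else u\<^sub>0 0"
    have "Q (s(K := v)) = Q (?u(K := v))" for v
      by (rule local) auto
    then show ?thesis
      using up[of ?u] s u\<^sub>0 by auto
  qed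
  have down': "\<exists>!v. v \<in> P \<and> Q (s(0 := v))" if s: "\<And>i. 0 < i \<Longrightarrow> i \<le> K \<Longrightarrow> s i \<in> P" for s
  proof -
    let ?u = "\<lambda>i. if 0 < i \<and> i \<le> K then s i else u\<^sub>0 0"
    have "Q (s(0 := v)) = Q (?u(0 := v))" for v
      by (rule local) auto
    then show ?thesis
      using down[of ?u] s u\<^sub>0 by auto
  qed
  define nxt where "nxt s = (THE v. v \<in> P \<and> Q (s(K := v)))" for s
  define prv where "prv s = (THE v. v \<in> P \<and> Q ((\<lambda>i. s (i - 1))(0 := v)))" for s
  \<comment> \<open>States are windows of length \<open>K\<close>. \<open>f\<close> drops the value
    at 0 and appends the one forced at \<open>K\<close>; \<open>g\<close> drops the last value and
    prepends the one forced at 0, so it inverts \<open>f\<close>.\<close>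
  define f where "f s = (\<lambda>i\<in>{0..<K}. if i = K - 1 then nxt s else s (i + 1))" for s
  define g where "g s = (\<lambda>i\<in>{0..<K}. if i = 0 then prv s else s (i - 1))" for s
  have nxt: "nxt s \<in> P" "Q (s(K := nxt s))" if "s \<in> S" for s
    using theI'[OF up'[of s]] SP[OF that] unfolding nxt_def by auto
  have nxt_eq: "nxt s = v" if "s \<in> S" "v \<in> P" "Q (s(K := v))" for s v
    using up'[of s] SP[OF that(1)] nxt[OF that(1)] that(2,3) by blast
  have prv: "prv s \<in> P" "Q ((\<lambda>i. s (i - 1))(0 := prv s))" if "s \<in> S" for s
    using theI'[OF down'[of "\<lambda>i. s (i - 1)"]] SP[OF that] unfolding prv_def by auto
  have prv_eq: "prv s = v" if "s \<in> S" "v \<in> P" "Q ((\<lambda>i. s (i - 1))(0 := v))" for s v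
    using down'[of "\<lambda>i. s (i - 1)"] SP[OF that(1)] prv[OF that(1)] that(2,3) by fastforce
  have fS: "f s \<in> S" if "s \<in> S" for s
    using nxt[OF that] SP[OF that] by (auto simp: f_def S_def)
  have gS: "g s \<in> S" if "s \<in> S" for s
    using prv[OF that] SP[OF that] by (auto simp: g_def S_def)
  have gf: "g (f s) = s" if s: "s \<in> S" for s
  proof -
    have "prv (f s) = s 0"
    proof (rule prv_eq[OF fS[OF s]])
      show "Q ((\<lambda>i. f s (i - 1))(0 := s 0))"
        using nxt(2)[OF s] by (subst local[where v = "s(K := nxt s)"]) (use K in \<open>auto simp: f_def\<close>)
    qed (use SP[OF s] K in auto)
    then show ?thesis
      using s K unfolding S_def by (intro extensionalityI[of _ "{0..<K}"]) (auto simp: g_def f_def PiE_def)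
  qed
  have fg: "f (g s) = s" if s: "s \<in> S" for s
  proof -
    have "nxt (g s) = s (K - 1)"
    proof (rule nxt_eq[OF gS[OF s]])
      show "Q ((g s)(K := s (K - 1)))"
        using prv(2)[OF s]
        by (subst local[where v = "(\<lambda>i. s (i - 1))(0 := prv s)"]) (use K in \<open>auto simp: g_def\<close>)
    qed (use SP[OF s] K in auto)
    then show ?thesis
      using s K unfolding S_def by (intro extensionalityI[of _ "{0..<K}"]) (auto simp: g_def f_def PiE_def)
  qed
  have bij: "bij_betw f S S"
    using fS gS gf fg by (intro bij_betw_byWitness[where f' = g]) auto
  have "restrict u\<^sub>0 {0..<K} \<in> S"
    using u\<^sub>0 by (auto simp: S_def)
  then obtain z :: "int \<Rightarrow> int \<Rightarrow> 'v" where z: "z 0 = restrict u\<^sub>0 {0..<K}" "\<And>n. z n \<in> S" "\<And>n. z (n + 1) = f (z n)"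
    using bij_betw_int_orbit[OF bij] by blast
  \<comment> \<open>Entry \<open>k\<close> of the state at time \<open>n\<close> moves to entry 0
    after \<open>k\<close> steps, so the states are the windows of a single sequence.\<close>
  have zi: "z n (int k) = z (n + int k) 0" if "int k < K" for n k
    using that
  proof (induction k arbitrary: n)
    case (Suc k)
    have "z n (int k + 1) = z (n + 1) (int k)"
      using Suc.prems by (simp add: z(3) f_def)
    also have "\<dots> = z (n + 1 + int k) 0"
      using Suc by simp
    finally show ?case
      by (simp add: add_ac)
  qed simp
  have zi': "z n i = z (n + i) 0" if "0 \<le> i" "i < K" for n i
    using zi[of "nat i" n] that by simp
  have "Q (\<lambda>i. z (n + i) 0)" for n
  proof -
    have "z (n + i) 0 = (if i = K then nxt (z n) else z n i)" if "0 \<le> i" "i \<le> K" for i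
    proof (cases "i = K")
      case True
      have "z (n + K) 0 = z (n + 1) (K - 1)"
        using zi'[of "K - 1" "n + 1"] K by simp
      then show ?thesis
        using True K by (simp add: z(3) f_def)
    qed (use that zi'[of i n] in simp)
    then show ?thesis
      using nxt(2)[OF z(2)[of n]] by (subst local[where v = "(z n)(K := nxt (z n))"]) auto
  qed
  moreover have "\<exists>q \<ge> 0. (finite P \<longrightarrow> q > 0) \<and> (\<forall>n. z (n + q) = z n)"
  proof (cases "finite P")
    case True
    then have "finite S"
      unfolding S_def by (intro finite_PiE) auto
    then show ?thesis
      using int_orbit_periodic[of S f z] bij z by (metis bij_betw_imp_inj_on order_less_imp_le)
  \<comment> \<open>For infinite \<open>P\<close> the trivial period 0 is returned.\<close>
  qed (auto intro: exI[of _ 0])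
  moreover have "z i 0 \<in> P" for i
    using SP[OF z(2)] K by auto
  moreover have "z i 0 = u\<^sub>0 i" if "0 \<le> i" "i < K" for i
    using zi'[OF that, of 0] z(1) that by simp
  ultimately show ?thesis
    using that[of "\<lambda>i. z i 0"] by metis
qed

section \<open>Words as paths in the integers\<close>

text \<open>A letter \<open>x\<^sup>\<plusminus>\<^sup>1\<close> read at height \<open>p\<close> leads to the height \<open>p \<plusminus> \<theta> x\<close>, along the edge of type \<open>x\<close>
  whose lower end is the minimum of the two heights.\<close>

fun height_end :: "('x \<Rightarrow> int) \<Rightarrow> int \<Rightarrow> 'x word \<Rightarrow> int" where
  "height_end \<theta> p [] = p"
| "height_end \<theta> p ((x, b) # w) = height_end \<theta> (p + (if b then \<theta> x else - \<theta> x)) w"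

fun edges :: "('x \<Rightarrow> int) \<Rightarrow> int \<Rightarrow> 'x word \<Rightarrow> ('x \<times> int) list" where
  "edges \<theta> p [] = []"
| "edges \<theta> p ((x, b) # w) = (let p' = p + (if b then \<theta> x else - \<theta> x) in
    (x, min p p') # edges \<theta> p' w)"

text \<open>The label of an edge may depend on its height, so this is a functor on the groupoid of
  paths rather than a homomorphism on words. It becomes an action of words once the height is a
  coordinate of the points acted on.\<close>

fun path_val ::
  "('g, 'm) monoid_scheme \<Rightarrow> ('x \<Rightarrow> int) \<Rightarrow> ('x \<Rightarrow> int \<Rightarrow> 'g) \<Rightarrow> int \<Rightarrow> 'x word \<Rightarrow> 'g"
where
  "path_val P \<theta> E p [] = \<one>\<^bsub>P\<^esub>"
| "path_val P \<theta> E p ((x, b) # w) = (let p' = p + (if b then \<theta> x else - \<theta> x) in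
    (if b then E x (min p p') else inv\<^bsub>P\<^esub> (E x (min p p'))) \<otimes>\<^bsub>P\<^esub> path_val P \<theta> E p' w)"

lemma height_end_append: "height_end \<theta> p (u @ v) = height_end \<theta> (height_end \<theta> p u) v"
  by (induction \<theta> p u rule: height_end.induct) auto

lemma edges_append: "edges \<theta> p (u @ v) = edges \<theta> p u @ edges \<theta> (height_end \<theta> p u) v"
  by (induction \<theta> p u rule: edges.induct) (auto simp: Let_def)

lemma height_end_shift: "height_end \<theta> (p + n) w = height_end \<theta> p w + n"
proof (induction \<theta> p w rule: height_end.induct)
  case (2 \<theta> p x b w)
  then show ?case by (simp add: algebra_simps)
qed simp

lemma edges_shift: "edges \<theta> (p + n) w = map (\<lambda>(x, j). (x, j + n)) (edges \<theta> p w)"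
proof (induction \<theta> p w rule: edges.induct)
  case (2 \<theta> p x b w)
  define q where "q = p + (if b then \<theta> x else - \<theta> x)"
  have q: "p + n + (if b then \<theta> x else - \<theta> x) = q + n" by (simp add: q_def)
  have "min (p + n) (q + n) = min p q + n" by simp
  then show ?case using 2[OF q_def] by (simp only: edges.simps Let_def q list.map prod.case flip: q_def)
qed simp

lemma path_val_shift:
  "path_val P \<theta> E (p + n) w = path_val P \<theta> (\<lambda>x j. E x (j + n)) p w"
proof (induction P \<theta> E p w rule: path_val.induct)
  case (2 P \<theta> E p x b w)
  define q where "q = p + (if b then \<theta> x else - \<theta> x)"
  have q: "p + n + (if b then \<theta> x else - \<theta> x) = q + n" by (simp add: q_def)
  have "min (p + n) (q + n) = min p q + n" by simp
  then show ?case using 2[OF q_def] by (simp only: path_val.simps Let_def q flip: q_def)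
qed simp

lemma path_val_cong:
  assumes "\<And>x j. (x, j) \<in> set (edges \<theta> p w) \<Longrightarrow> E x j = F x j"
  shows "path_val P \<theta> E p w = path_val P \<theta> F p w"
  using assms by (induction P \<theta> E p w rule: path_val.induct) (auto simp: Let_def)

lemma path_val_closed:
  assumes "group P" "\<And>x j. E x j \<in> carrier P"
  shows "path_val P \<theta> E p w \<in> carrier P"
proof -
  interpret group P by fact
  show ?thesis
    by (induction \<theta> p w rule: edges.induct) (auto simp: Let_def assms(2))
qed

text \<open>An equation in a group in which the unknown occurs once, with exponent 1 or -1, has
  exactly one solution: the other factors are moved to the right-hand side one at a time.\<close>

lemma path_val_solve:
  fixes P (structure)
  assumes "group P" "\<And>x j. E x j \<in> carrier P" "t \<in> carrier P"
    and "count_list (edges \<theta> p w) (y, k) = 1"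
  shows "\<exists>!v. v \<in> carrier P \<and>
    path_val P \<theta> (\<lambda>x j. if x = y \<and> j = k then v else E x j) p w = t"
  using assms(3,4)
proof (induction \<theta> p w arbitrary: t rule: edges.induct)
  case (2 \<theta> p x b w)
  interpret group P by fact
  define p' where "p' = p + (if b then \<theta> x else - \<theta> x)"
  let ?E = "\<lambda>v x j. if x = y \<and> j = k then v else E x j"
  have eq: "path_val P \<theta> (?E v) p ((x, b) # w) =
      (if b then ?E v x (min p p') else inv\<^bsub>P\<^esub> (?E v x (min p p'))) \<otimes>\<^bsub>P\<^esub> path_val P \<theta> (?E v) p' w" for v
    by (simp only: path_val.simps Let_def p'_def)
  show ?case
  proof (cases "x = y \<and> min p p' = k")
    case True
    then have "(y, k) \<notin> set (edges \<theta> p' w)"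
      using 2 by (auto simp: Let_def p'_def count_list_0_iff)
    then have B: "path_val P \<theta> (?E v) p' w = path_val P \<theta> E p' w" for v
      by (intro path_val_cong) auto
    have Bc: "path_val P \<theta> E p' w \<in> carrier P"
      by (intro path_val_closed assms)
    define B where "B = path_val P \<theta> E p' w"
    have uniq: "(if b then v else inv v) \<otimes> B = t \<longleftrightarrow> v = (if b then t \<otimes> inv B else B \<otimes> inv t)"
      if "v \<in> carrier P" for v
      using that Bc[folded B_def] 2(2)
      by (auto simp: inv_mult_group m_assoc inv_solve_right' m_assoc[symmetric, of B "inv B" v])
    define v\<^sub>0 where "v\<^sub>0 = (if b then t \<otimes> inv B else B \<otimes> inv t)"
    have "path_val P \<theta> (?E v) p ((x, b) # w) = (if b then v else inv v) \<otimes> B" for v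
      unfolding eq[of v] B B_def using True by simp
    moreover have "v\<^sub>0 \<in> carrier P"
      using Bc[folded B_def] 2(2) by (simp add: v\<^sub>0_def)
    ultimately show ?thesis
      using uniq[folded v\<^sub>0_def] by (intro ex1I[of _ v\<^sub>0]) auto
  next
    case False
    let ?c = "if b then E x (min p p') else inv\<^bsub>P\<^esub> (E x (min p p'))"
    have c: "?c \<in> carrier P" using assms by auto
    have "count_list (edges \<theta> p' w) (y, k) = 1"
      using 2(3) False by (auto simp: Let_def p'_def)
    then have IH: "\<exists>!v. v \<in> carrier P \<and> path_val P \<theta> (?E v) p' w = inv ?c \<otimes> t"
      using 2(1)[OF p'_def, of "inv ?c \<otimes> t"] 2(2) c by auto
    have "path_val P \<theta> (?E v) p ((x, b) # w) = t \<longleftrightarrow> path_val P \<theta> (?E v) p' w = inv ?c \<otimes> t"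
      if "v \<in> carrier P" for v
    proof -
      have "path_val P \<theta> (?E v) p' w \<in> carrier P"
        using assms that by (intro path_val_closed) auto
      moreover have "path_val P \<theta> (?E v) p ((x, b) # w) = ?c \<otimes> path_val P \<theta> (?E v) p' w"
        unfolding eq[of v] using False by auto
      ultimately show ?thesis
        using inv_solve_left[OF _ c 2(2)] by auto
    qed
    then show ?thesis
      using IH by (simp cong: conj_cong)
  qed
qed simp

text \<open>\<open>relator_path\<close> records what the unique max-min property is used for: along the closed path of
  the relator, normalised so that its lowest height is 0, the edge of type \<open>a\<close> at the top and the
  edge of type \<open>c\<close> at the bottom are each traversed exactly once. Here \<open>d\<close> is the height of the lower
  end of that top edge.\<close>

locale relator_path =
  fixes X :: "'x set" and \<theta> :: "'x \<Rightarrow> int" and r :: "'x word" and p\<^sub>0 :: int and a c :: 'x and d :: int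
  assumes r_in: "r \<in> lists (X \<times> UNIV)" and a_in: "a \<in> X"
    and closed: "height_end \<theta> p\<^sub>0 r = p\<^sub>0"
    and nonneg: "\<And>x j. (x, j) \<in> set (edges \<theta> p\<^sub>0 r) \<Longrightarrow> 0 \<le> j"
    and top: "\<And>j. (a, j) \<in> set (edges \<theta> p\<^sub>0 r) \<Longrightarrow> j \<le> d"
    and count_top: "count_list (edges \<theta> p\<^sub>0 r) (a, d) = 1"
    and count_bottom: "count_list (edges \<theta> p\<^sub>0 r) (c, 0) = 1"
    and a_eq_c: "a = c \<Longrightarrow> 0 < d"
begin

lemma d_nonneg: "0 \<le> d"
  using nonneg[of a d] count_top by (metis count_list_0_iff zero_neq_one)

text \<open>If \<open>a \<noteq> c\<close>, both sequences of edge values are read off a single sequence \<open>u\<close>, with an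
  offset \<open>T\<close> so large that the initial values for \<open>a\<close> and for \<open>c\<close> do not interfere.\<close>

lemma periodic_edge_values:
  fixes N :: int
  assumes P: "group P" and e: "\<And>x. e x \<in> carrier P" and t: "t \<in> carrier P"
  obtains E q where "\<And>x j. E x j \<in> carrier P" "q \<ge> 0" "finite (carrier P) \<Longrightarrow> q > 0"
    "\<And>x j. E x (j + q) = E x j" "\<And>n. path_val P \<theta> E (p\<^sub>0 + n) r = t"
    "\<And>x j. 0 \<le> j \<Longrightarrow> j \<le> N \<Longrightarrow> \<not> (x = a \<and> d \<le> j) \<Longrightarrow> E x j = e x"
proof -
  let ?es = "set (edges \<theta> p\<^sub>0 r)"
  \<comment> \<open>For \<open>a \<noteq> c\<close>: \<open>N < T\<close> leaves room for the
    initial values of \<open>c\<close> up to height \<open>N\<close>; \<open>T\<close> above all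
    edges of type \<open>c\<close> keeps these away from index \<open>K\<close>;
    \<open>0 < T\<close> keeps the edges of type \<open>a\<close> away from index 0.\<close>
  obtain T where T: "T \<ge> 0" "a = c \<Longrightarrow> T = 0" "a \<noteq> c \<Longrightarrow> N < T \<and> 0 < T \<and> (\<forall>j. (c, j) \<in> ?es \<longrightarrow> j < T)"
  proof (cases "a = c")
    case False
    let ?M = "Max (insert N (insert 0 (snd ` ?es)))"
    have "N \<le> ?M" "0 \<le> ?M" "\<And>j. (c, j) \<in> ?es \<Longrightarrow> j \<le> ?M"
      by (rule Max_ge; force)+
    then show ?thesis using that[of "?M + 1"] False by (auto simp: zless_add1_eq le_less)
  qed (use that in auto)
  define ev where "ev u x j = (if x = a then u (j + T) else if x = c then u j else e x)" for u :: "int \<Rightarrow> _" and x j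
  define Q where "Q u = (path_val P \<theta> (ev u) p\<^sub>0 r = t)" for u
  \<comment> \<open>\<open>K\<close> is the index of the top edge \<open>(a, d)\<close>, and 0 is
    the index of the bottom edge \<open>(c, 0)\<close>. The window must have positive length, which
    for \<open>a = c\<close> is the assumption \<open>a_eq_c\<close>.\<close>
  define K where "K = d + T"
  have K: "K > 0"
    using T a_eq_c d_nonneg unfolding K_def by (cases "a = c") auto
  have local: "Q u = Q v" if "\<And>i. 0 \<le> i \<Longrightarrow> i \<le> K \<Longrightarrow> u i = v i" for u v
  proof -
    have "path_val P \<theta> (ev u) p\<^sub>0 r = path_val P \<theta> (ev v) p\<^sub>0 r"
    proof (rule path_val_cong)
      fix x j assume xj: "(x, j) \<in> ?es"
      then show "ev u x j = ev v x j"
        using nonneg[OF xj] top[of j] T d_nonneg that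
        by (cases "a = c") (auto simp: ev_def K_def less_imp_le add_increasing)
    qed
    then show ?thesis by (simp add: Q_def)
  qed
  have up: "\<exists>!v. v \<in> carrier P \<and> Q (u(K := v))" if u: "\<And>i. u i \<in> carrier P" for u
  proof -
    have "path_val P \<theta> (ev (u(K := v))) p\<^sub>0 r =
        path_val P \<theta> (\<lambda>x j. if x = a \<and> j = d then v else ev u x j) p\<^sub>0 r" for v
    proof (rule path_val_cong)
      fix x j assume xj: "(x, j) \<in> ?es"
      then show "ev (u(K := v)) x j = (if x = a \<and> j = d then v else ev u x j)"
        using T(2,3) d_nonneg by (cases "a = c") (force simp: ev_def K_def)+
    qed
    moreover have "ev u x j \<in> carrier P" for x j
      using u e by (simp add: ev_def)
    ultimately show ?thesis
      using path_val_solve[OF P _ t count_top, of "ev u"] by (simp add: Q_def)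
  qed
  have down: "\<exists>!v. v \<in> carrier P \<and> Q (u(0 := v))" if u: "\<And>i. u i \<in> carrier P" for u
  proof -
    have "path_val P \<theta> (ev (u(0 := v))) p\<^sub>0 r =
        path_val P \<theta> (\<lambda>x j. if x = c \<and> j = 0 then v else ev u x j) p\<^sub>0 r" for v
    proof (rule path_val_cong)
      fix x j assume xj: "(x, j) \<in> ?es"
      then show "ev (u(0 := v)) x j = (if x = c \<and> j = 0 then v else ev u x j)"
        using T nonneg[OF xj] by (auto simp: ev_def)
    qed
    moreover have "ev u x j \<in> carrier P" for x j
      using u e by (simp add: ev_def)
    ultimately show ?thesis
      using path_val_solve[OF P _ t count_bottom, of "ev u"] by (simp add: Q_def)
  qed
  \<comment> \<open>Initial data: the indices below \<open>T\<close> hold type \<open>c\<close> at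
    heights 0 to \<open>T - 1\<close>, those from \<open>T\<close> to \<open>K - 1\<close> hold type
    \<open>a\<close> at heights 0 to \<open>d - 1\<close>.\<close>
  obtain u q where u: "\<And>i. u i \<in> carrier P"
    "\<And>i. 0 \<le> i \<Longrightarrow> i < K \<Longrightarrow> u i = (if T \<le> i then e a else e c)"
    "\<And>n. Q (\<lambda>i. u (n + i))" "q \<ge> 0" "finite (carrier P) \<Longrightarrow> q > 0" "\<And>n. u (n + q) = u n"
    using reversible_recurrence[where Q = Q and u\<^sub>0 = "\<lambda>i. if T \<le> i then e a else e c", OF K local up down] e
    by metis
  show ?thesis
  proof (rule that[of "ev u" q])
    show "ev u x (j + q) = ev u x j" for x j
      using u(6)[of "j + T"] u(6)[of j] by (simp add: ev_def algebra_simps)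
    show "path_val P \<theta> (ev u) (p\<^sub>0 + n) r = t" for n
    proof -
      have "(\<lambda>x j. ev u x (j + n)) = ev (\<lambda>i. u (n + i))"
        by (auto simp: ev_def fun_eq_iff algebra_simps)
      then show ?thesis
        using u(3)[of n] by (simp add: path_val_shift Q_def)
    qed
    show "ev u x j = e x" if "0 \<le> j" "j \<le> N" "\<not> (x = a \<and> d \<le> j)" for x j
      using that u(2)[of "j + T"] u(2)[of j] T d_nonneg by (auto simp: ev_def K_def)
  qed (use u e in \<open>auto simp: ev_def\<close>)
qed

text \<open>An edge of type \<open>a\<close> at a height \<open>j \<ge> d\<close> is the top edge of
  the relator translated by \<open>j - d\<close>. The edges left over are those that can carry
  initial data in \<open>periodic_edge_values\<close>.\<close>

definition allowed :: "'x \<Rightarrow> int \<Rightarrow> bool" where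
  "allowed x j \<longleftrightarrow> 0 \<le> j \<and> \<not> (x = a \<and> d \<le> j)"

definition allowed_path :: "int \<Rightarrow> 'x word \<Rightarrow> bool" where
  "allowed_path p w \<longleftrightarrow> (\<forall>(x, j) \<in> set (edges \<theta> p w). allowed x j)"

lemma allowed_path_Nil [simp]: "allowed_path p []"
  by (simp add: allowed_path_def)

lemma allowed_path_append:
  "allowed_path p (u @ v) \<longleftrightarrow> allowed_path p u \<and> allowed_path (height_end \<theta> p u) v"
  by (auto simp: allowed_path_def edges_append)

end

section \<open>Normal forms\<close>

lemma edges_split:
  assumes "count_list (edges \<theta> p w) (y, k) = 1"
  obtains u b v where "w = u @ (y, b) # v" "(y, k) \<notin> set (edges \<theta> p u)"
    "k = min (height_end \<theta> p u) (height_end \<theta> p (u @ [(y, b)]))"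
    "(y, k) \<notin> set (edges \<theta> (height_end \<theta> p (u @ [(y, b)])) v)"
  using assms
proof (induction \<theta> p w arbitrary: thesis rule: edges.induct)
  case (2 \<theta> p x b w)
  define p' where "p' = p + (if b then \<theta> x else - \<theta> x)"
  have es: "edges \<theta> p ((x, b) # w) = (x, min p p') # edges \<theta> p' w"
    by (simp add: Let_def p'_def)
  show ?case
  proof (cases "x = y \<and> min p p' = k")
    case True
    then have "(y, k) \<notin> set (edges \<theta> p' w)"
      using 2(3) unfolding es by (auto simp: count_list_0_iff)
    then show ?thesis
      using True by (intro 2(2)[of "[]" b w]) (auto simp: p'_def)
  next
    case False
    then have "count_list (edges \<theta> p' w) (y, k) = 1"
      using 2(3) unfolding es by auto
    then obtain u b' v where uv: "w = u @ (y, b') # v" "(y, k) \<notin> set (edges \<theta> p' u)"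
      "k = min (height_end \<theta> p' u) (height_end \<theta> p' (u @ [(y, b')]))"
      "(y, k) \<notin> set (edges \<theta> (height_end \<theta> p' (u @ [(y, b')])) v)"
      using 2(1)[OF p'_def] by metis
    show ?thesis
      by (rule 2(2)[of "(x, b) # u" b' v]) (use uv False in \<open>auto simp: Let_def p'_def\<close>)
  qed
qed simp

lemma edges_shift_iff: "(x, j) \<in> set (edges \<theta> (p + n) w) \<longleftrightarrow> (x, j - n) \<in> set (edges \<theta> p w)"
  by (force simp: edges_shift)

text \<open>\<open>G\<close> is only asked to satisfy the relation and to be generated by the two
  images, which suffices for normal forms to exist. That no further relations hold enters later,
  through homomorphisms defined on \<open>G\<close> (\<open>Q_extension\<close>).\<close>

locale relative_quotient = relator_path X \<theta> r p\<^sub>0 a c d + K: group K + G: group G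
  for X :: "'x set" and \<theta> r p\<^sub>0 a c d and K :: "('k, 'm) monoid_scheme" (structure)
    and G :: "('g, 'n) monoid_scheme" (structure) +
  fixes \<iota> :: "'k \<Rightarrow> 'g" and \<xi> :: "'x \<Rightarrow> 'g" and \<zeta> :: 'k
  assumes iota_hom: "\<iota> \<in> hom K G" and xi: "\<xi> \<in> X \<rightarrow> carrier G" and zeta: "\<zeta> \<in> carrier K"
    and relator: "eval_word G \<xi> r = \<iota> \<zeta>"
    and generated: "carrier G = generate G (\<iota> ` carrier K \<union> \<xi> ` X)"
begin

sublocale iota: group_hom K G \<iota>
  by unfold_locales (rule iota_hom)

lemma xi_closed [simp]: "x \<in> X \<Longrightarrow> \<xi> x \<in> carrier G"
  using xi by auto

abbreviation exprs :: "('x, 'k) rel_expr set" where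
  "exprs \<equiv> lists ((X \<times> UNIV) \<times> carrier K)"

definition expr_val :: "('x, 'k) rel_expr \<Rightarrow> 'g" where
  "expr_val w = foldr (\<lambda>(l, h) g. eval_word G \<xi> [l] \<otimes>\<^bsub>G\<^esub> (\<iota> h \<otimes>\<^bsub>G\<^esub> g)) w \<one>\<^bsub>G\<^esub>"

lemma expr_val_Nil [simp]: "expr_val [] = \<one>\<^bsub>G\<^esub>"
  by (simp add: expr_val_def)

lemma expr_val_Cons [simp]:
  "expr_val ((l, h) # w) = eval_word G \<xi> [l] \<otimes>\<^bsub>G\<^esub> (\<iota> h \<otimes>\<^bsub>G\<^esub> expr_val w)"
  by (simp add: expr_val_def)

lemma eval_word_closed' [simp]: "w \<in> lists (X \<times> UNIV) \<Longrightarrow> eval_word G \<xi> w \<in> carrier G"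
  by (rule eval_word_closed[OF G.is_group xi])

lemma letter_closed: "l \<in> X \<times> UNIV \<Longrightarrow> eval_word G \<xi> [l] \<in> carrier G"
  by (rule eval_word_closed[OF G.is_group xi]) simp

lemma expr_val_closed: "w \<in> exprs \<Longrightarrow> expr_val w \<in> carrier G"
  by (induction w) (auto simp del: eval_word_Cons intro!: letter_closed)

lemma expr_val_append:
  "u \<in> exprs \<Longrightarrow> v \<in> exprs \<Longrightarrow> expr_val (u @ v) = expr_val u \<otimes>\<^bsub>G\<^esub> expr_val v"
proof (induction u rule: list.induct)
  case (Cons lh u)
  then show ?case
    using letter_closed[of "fst lh"] expr_val_closed[of u] expr_val_closed[of v]
    by (cases lh) (auto simp: G.m_assoc simp del: eval_word_Cons)
qed (simp add: expr_val_closed)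

text \<open>These elements label allowed paths from \<open>p\<close> to \<open>p'\<close>. Recording
  both ends makes them composable and invertible as in a groupoid, and \<open>n\<close> is the
  length that \<open>reduced_form\<close> minimises. An expression starts with a letter, hence the
  separate leading coefficient \<open>h\<close>.\<close>

definition reach :: "nat \<Rightarrow> int \<Rightarrow> int \<Rightarrow> 'g \<Rightarrow> bool" where
  "reach n p p' g \<longleftrightarrow> (\<exists>h w. h \<in> carrier K \<and> w \<in> exprs \<and> length w = n \<and>
    height_end \<theta> p (skeleton w) = p' \<and> allowed_path p (skeleton w) \<and>
    g = \<iota> h \<otimes>\<^bsub>G\<^esub> expr_val w)"

lemma reach_closed: "reach n p p' g \<Longrightarrow> g \<in> carrier G"
  by (auto simp: reach_def simp del: in_lists_conv_set intro!: expr_val_closed)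

lemma reach_coefficient: "h \<in> carrier K \<Longrightarrow> reach 0 p p (\<iota> h)"
  by (auto simp: reach_def skeleton_def intro!: exI[of _ h])

text \<open>The leading coefficient of the second factor is absorbed by the last coefficient of the
  first, so the lengths add.\<close>

lemma reach_mult:
  assumes "reach n p p' g" "reach m p' p'' g'"
  shows "reach (n + m) p p'' (g \<otimes>\<^bsub>G\<^esub> g')"
proof -
  obtain h w where hw: "h \<in> carrier K" "w \<in> exprs" "length w = n"
    "height_end \<theta> p (skeleton w) = p'" "allowed_path p (skeleton w)" "g = \<iota> h \<otimes>\<^bsub>G\<^esub> expr_val w"
    using assms(1) unfolding reach_def by blast
  have "reach (length w + m) p p'' (\<iota> h \<otimes>\<^bsub>G\<^esub> expr_val w \<otimes>\<^bsub>G\<^esub> g')"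
    using hw(1,2,4,5)
  proof (induction w arbitrary: p h)
    case Nil
    then obtain h' w' where w': "h' \<in> carrier K" "w' \<in> exprs" "length w' = m"
      "height_end \<theta> p (skeleton w') = p''" "allowed_path p (skeleton w')" "g' = \<iota> h' \<otimes>\<^bsub>G\<^esub> expr_val w'"
      using assms(2) unfolding reach_def skeleton_def by auto
    then show ?case
      using Nil expr_val_closed[of w'] unfolding reach_def
      by (intro exI[of _ "h \<otimes>\<^bsub>K\<^esub> h'"] exI[of _ w']) (auto simp: G.m_assoc)
  next
    case (Cons lh w)
    obtain x b k where lh: "lh = ((x, b), k)" by (cases lh) auto
    define q where "q = height_end \<theta> p [(x, b)]"
    have sk: "skeleton (lh # w) = [(x, b)] @ skeleton w"
      by (simp add: skeleton_def lh)
    have k: "x \<in> X" "k \<in> carrier K" "w \<in> exprs"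
      using Cons.prems lh by auto
    have "height_end \<theta> q (skeleton w) = p'" "allowed_path q (skeleton w)" "allowed_path p [(x, b)]"
      using Cons.prems(3,4) unfolding sk height_end_append allowed_path_append q_def by auto
    then obtain h' w' where w': "h' \<in> carrier K" "w' \<in> exprs" "length w' = length w + m"
      "height_end \<theta> q (skeleton w') = p''" "allowed_path q (skeleton w')"
      "\<iota> k \<otimes>\<^bsub>G\<^esub> expr_val w \<otimes>\<^bsub>G\<^esub> g' = \<iota> h' \<otimes>\<^bsub>G\<^esub> expr_val w'"
      using Cons.IH[OF k(2,3)] unfolding reach_def by blast
    have sk': "skeleton (((x, b), h') # w') = [(x, b)] @ skeleton w'"
      by (simp add: skeleton_def)
    have l: "eval_word G \<xi> [(x, b)] \<in> carrier G"
      using k letter_closed by simp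
    have "\<iota> h \<otimes>\<^bsub>G\<^esub> expr_val (lh # w) \<otimes>\<^bsub>G\<^esub> g'
        = \<iota> h \<otimes>\<^bsub>G\<^esub> (eval_word G \<xi> [(x, b)] \<otimes>\<^bsub>G\<^esub> (\<iota> k \<otimes>\<^bsub>G\<^esub> expr_val w \<otimes>\<^bsub>G\<^esub> g'))"
      using l k Cons.prems(1) expr_val_closed[OF k(3)] reach_closed[OF assms(2)]
      by (simp add: lh G.m_assoc del: eval_word_Cons)
    also have "\<dots> = \<iota> h \<otimes>\<^bsub>G\<^esub> expr_val (((x, b), h') # w')"
      by (simp add: w'(6))
    finally have "\<iota> h \<otimes>\<^bsub>G\<^esub> expr_val (lh # w) \<otimes>\<^bsub>G\<^esub> g' = \<iota> h \<otimes>\<^bsub>G\<^esub> expr_val (((x, b), h') # w')" .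
    moreover have "allowed_path p (skeleton (((x, b), h') # w'))"
      "height_end \<theta> p (skeleton (((x, b), h') # w')) = p''"
      using w'(4,5) \<open>allowed_path p [(x, b)]\<close>
      unfolding sk' allowed_path_append height_end_append q_def by auto
    ultimately show ?case
      using w'(1-3) k Cons.prems(1) unfolding reach_def
      by (intro exI[of _ h] exI[of _ "((x, b), h') # w'"]) auto
  qed
  then show ?thesis using hw by simp
qed

lemma reach_letter:
  assumes "x \<in> X" "allowed x (min p (height_end \<theta> p [(x, b)]))"
  shows "reach 1 p (height_end \<theta> p [(x, b)]) (eval_word G \<xi> [(x, b)])"
  using assms unfolding reach_def
  by (intro exI[of _ "\<one>\<^bsub>K\<^esub>"] exI[of _ "[((x, b), \<one>\<^bsub>K\<^esub>)]"])
    (auto simp: skeleton_def allowed_path_def Let_def)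

lemma inv_letter:
  assumes "x \<in> X"
  shows "inv\<^bsub>G\<^esub> (eval_word G \<xi> [(x, b)]) = eval_word G \<xi> [(x, \<not> b)]"
  using assms by simp

text \<open>The reversed path crosses the same edges.\<close>

lemma reach_inv:
  assumes "reach n p p' g"
  shows "reach n p' p (inv\<^bsub>G\<^esub> g)"
proof -
  obtain h w where hw: "h \<in> carrier K" "w \<in> exprs" "length w = n"
    "height_end \<theta> p (skeleton w) = p'" "allowed_path p (skeleton w)" "g = \<iota> h \<otimes>\<^bsub>G\<^esub> expr_val w"
    using assms(1) unfolding reach_def by blast
  have "reach (length w) p' p (inv\<^bsub>G\<^esub> (\<iota> h \<otimes>\<^bsub>G\<^esub> expr_val w))"
    using hw(1,2,4,5)
  proof (induction w arbitrary: p h)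
    case Nil
    then show ?case
      using reach_coefficient[of "inv\<^bsub>K\<^esub> h" p] by (simp add: skeleton_def)
  next
    case (Cons lh w)
    obtain x b k where lh: "lh = ((x, b), k)" by (cases lh) auto
    define q where "q = height_end \<theta> p [(x, b)]"
    have sk: "skeleton (lh # w) = [(x, b)] @ skeleton w"
      by (simp add: skeleton_def lh)
    have k: "x \<in> X" "k \<in> carrier K" "w \<in> exprs"
      using Cons.prems lh by auto
    have q: "height_end \<theta> q (skeleton w) = p'" "allowed_path q (skeleton w)" "allowed_path p [(x, b)]"
      using Cons.prems(3,4) unfolding sk height_end_append allowed_path_append q_def by auto
    have p: "height_end \<theta> q [(x, \<not> b)] = p"
      by (simp add: q_def)
    have "allowed x (min q p)"
      using q(3) by (simp add: allowed_path_def q_def Let_def min.commute)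
    then have l: "reach 1 q p (eval_word G \<xi> [(x, \<not> b)])"
      using reach_letter[of x q "\<not> b"] p k by metis
    have "reach (length w + (1 + 0)) p' p (inv\<^bsub>G\<^esub> (\<iota> k \<otimes>\<^bsub>G\<^esub> expr_val w) \<otimes>\<^bsub>G\<^esub>
        (eval_word G \<xi> [(x, \<not> b)] \<otimes>\<^bsub>G\<^esub> \<iota> (inv\<^bsub>K\<^esub> h)))"
      by (rule reach_mult[OF Cons.IH[OF k(2,3) q(1,2)] reach_mult[OF l reach_coefficient]])
        (simp add: Cons.prems(1))
    moreover have "inv\<^bsub>G\<^esub> (\<iota> h \<otimes>\<^bsub>G\<^esub> expr_val (lh # w)) = inv\<^bsub>G\<^esub> (\<iota> k \<otimes>\<^bsub>G\<^esub> expr_val w) \<otimes>\<^bsub>G\<^esub>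
        (eval_word G \<xi> [(x, \<not> b)] \<otimes>\<^bsub>G\<^esub> \<iota> (inv\<^bsub>K\<^esub> h))"
      using letter_closed[of "(x, b)"] k Cons.prems(1) expr_val_closed[OF k(3)] inv_letter[of x b]
      by (simp add: lh G.m_assoc G.inv_mult_group del: eval_word_Cons)
    ultimately show ?case by simp
  qed
  then show ?thesis using hw by simp
qed

lemma reach_word:
  assumes "w \<in> lists (X \<times> UNIV)"
    and "\<And>x q. x \<in> X \<Longrightarrow> (x, min q (q + \<theta> x)) \<in> set (edges \<theta> p w) \<Longrightarrow> \<exists>n. reach n q (q + \<theta> x) (\<xi> x)"
  shows "\<exists>n. reach n p (height_end \<theta> p w) (eval_word G \<xi> w)"
  using assms
proof (induction w arbitrary: p rule: list.induct)
  case Nil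
  then show ?case
    using reach_coefficient[of "\<one>\<^bsub>K\<^esub>" p] by auto
next
  case (Cons l w)
  obtain x b where l: "l = (x, b)" by (cases l)
  have x: "x \<in> X" "w \<in> lists (X \<times> UNIV)" using Cons.prems(1) l by auto
  define q where "q = height_end \<theta> p [(x, b)]"
  have es: "edges \<theta> p (l # w) = (x, min p q) # edges \<theta> q w" "height_end \<theta> p (l # w) = height_end \<theta> q w"
    by (simp_all add: Let_def q_def l)
  have "\<exists>n. reach n q (height_end \<theta> q w) (eval_word G \<xi> w)"
    using Cons.prems(2) x by (intro Cons.IH) (auto simp: es)
  then obtain n where n: "reach n q (height_end \<theta> q w) (eval_word G \<xi> w)" by blast
  have "\<exists>m. reach m p q (eval_word G \<xi> [(x, b)])"
  proof (cases b)
    case True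
    then show ?thesis
      using Cons.prems(2)[of x p] x by (auto simp: es q_def)
  next
    case False
    \<comment> \<open>An inverse letter from \<open>p\<close> to \<open>q\<close> is the reverse of
      the letter from \<open>q\<close> to \<open>p\<close>, over the same edge.\<close>
    then have "p = q + \<theta> x" by (simp add: q_def)
    moreover from this have "(x, min q (q + \<theta> x)) \<in> set (edges \<theta> p (l # w))"
      unfolding es by (simp add: min.commute)
    ultimately obtain m where "reach m q p (\<xi> x)"
      using Cons.prems(2)[of x q] x by blast
    then show ?thesis
      using reach_inv False x by fastforce
  qed
  then obtain m where m: "reach m p q (eval_word G \<xi> [(x, b)])" by blast
  have "eval_word G \<xi> (l # w) = eval_word G \<xi> [(x, b)] \<otimes>\<^bsub>G\<^esub> eval_word G \<xi> w"
    using x by (simp add: l)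
  then show ?case
    using reach_mult[OF m n] es(2) by metis
qed

text \<open>An edge of type \<open>a\<close> at a height \<open>j \<ge> d\<close> is eliminated with the translate of the relator in which
  it is the top edge; this leaves edges of type \<open>a\<close> at smaller heights only.\<close>

lemma reach_generator:
  assumes "x \<in> X" "0 \<le> min q (q + \<theta> x)"
  shows "\<exists>n. reach n q (q + \<theta> x) (\<xi> x)"
  using assms
proof (induction "nat (min q (q + \<theta> x))" arbitrary: x q rule: less_induct)
  case less
  define j where "j = min q (q + \<theta> x)"
  show ?case
  proof (cases "x = a \<and> d \<le> j")
    case False
    then show ?thesis
      using reach_letter[of x q True] less.prems by (auto simp: allowed_def j_def)
  next
    case True
    \<comment> \<open>Translation by \<open>k\<close> moves the top edge \<open>(a, d)\<close> of
      the relator onto the edge \<open>(a, j)\<close> at hand; \<open>0 \<le> k\<close> keeps the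
      translate at nonnegative heights.\<close>
    define k where "k = j - d"
    define p where "p = p\<^sub>0 + k"
    have k: "0 \<le> k" using True by (simp add: k_def)
    \<comment> \<open>Every other edge of the translate is reachable: one of type \<open>a\<close>
      at height at least \<open>d\<close> lies below \<open>j\<close>, so the induction hypothesis
      applies, and any remaining edge is allowed.\<close>
    have in_r: "\<exists>n. reach n q' (q' + \<theta> y) (\<xi> y)"
      if "y \<in> X" "(y, min q' (q' + \<theta> y)) \<in> set (edges \<theta> p r)" "(y, min q' (q' + \<theta> y)) \<noteq> (a, j)" for y q'
    proof (cases "y = a \<and> d \<le> min q' (q' + \<theta> y)")
      case True
      have "(a, min q' (q' + \<theta> y) - k) \<in> set (edges \<theta> p\<^sub>0 r)"
        using that True edges_shift_iff[of y _ \<theta> p\<^sub>0 k r] by (simp add: p_def)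
      then have "min q' (q' + \<theta> y) < j"
        using top that(3) True by (force simp: k_def)
      moreover from this have "nat (min q' (q' + \<theta> y)) < nat j"
        using True d_nonneg by linarith
      ultimately show ?thesis
        using less.hyps[of q' y] True that(1) d_nonneg by (auto simp: j_def)
    next
      case False
      have "(y, min q' (q' + \<theta> y) - k) \<in> set (edges \<theta> p\<^sub>0 r)"
        using that edges_shift_iff[of y _ \<theta> p\<^sub>0 k r] by (simp add: p_def)
      then have "allowed y (min q' (q' + \<theta> y))"
        using nonneg k False by (force simp: allowed_def)
      then show ?thesis
        using reach_letter[of y q' True] that(1) by auto
    qed
    obtain u b v where uv: "r = u @ (a, b) # v" "(a, d) \<notin> set (edges \<theta> p\<^sub>0 u)"
      "d = min (height_end \<theta> p\<^sub>0 u) (height_end \<theta> p\<^sub>0 (u @ [(a, b)]))"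
      "(a, d) \<notin> set (edges \<theta> (height_end \<theta> p\<^sub>0 (u @ [(a, b)])) v)"
      by (rule edges_split[OF count_top])
    define s\<^sub>1 s\<^sub>2 where "s\<^sub>1 = height_end \<theta> p u" and "s\<^sub>2 = height_end \<theta> p (u @ [(a, b)])"
    have s: "s\<^sub>1 = height_end \<theta> p\<^sub>0 u + k" "s\<^sub>2 = height_end \<theta> p\<^sub>0 (u @ [(a, b)]) + k"
      unfolding s\<^sub>1_def s\<^sub>2_def p_def by (rule height_end_shift)+
    have j: "j = min s\<^sub>1 s\<^sub>2"
      using uv(3) by (simp add: s k_def flip: min_add_distrib_left)
    have s12: "s\<^sub>2 = (if b then s\<^sub>1 + \<theta> a else s\<^sub>1 - \<theta> a)"
      by (simp add: s\<^sub>1_def s\<^sub>2_def height_end_append)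
    have words: "u \<in> lists (X \<times> UNIV)" "v \<in> lists (X \<times> UNIV)"
      using r_in uv(1) by auto
    have es: "edges \<theta> p r = edges \<theta> p u @ (a, j) # edges \<theta> s\<^sub>2 v"
    proof -
      have "r = u @ [(a, b)] @ v" using uv(1) by simp
      then show ?thesis
        by (simp add: edges_append height_end_append s\<^sub>2_def j s\<^sub>1_def Let_def)
    qed
    have end_r: "height_end \<theta> s\<^sub>2 v = p"
    proof -
      have "height_end \<theta> p ((u @ [(a, b)]) @ v) = p"
        using closed height_end_shift[of \<theta> p\<^sub>0 k r] uv(1) by (simp add: p_def)
      then show ?thesis
        unfolding height_end_append[of \<theta> p "u @ [(a, b)]"] s\<^sub>2_def .
    qed
    have aj: "(a, j) \<notin> set (edges \<theta> p u)" "(a, j) \<notin> set (edges \<theta> s\<^sub>2 v)"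
      using uv(2,4) edges_shift_iff[of a j \<theta> _ k] by (auto simp: s p_def k_def)
    have "\<exists>n. reach n p (height_end \<theta> p u) (eval_word G \<xi> u)"
      by (rule reach_word[OF words(1)], rule in_r) (use aj es in auto)
    moreover have "\<exists>n. reach n s\<^sub>2 (height_end \<theta> s\<^sub>2 v) (eval_word G \<xi> v)"
      by (rule reach_word[OF words(2)], rule in_r) (use aj es in auto)
    ultimately obtain n m where nm: "reach n p s\<^sub>1 (eval_word G \<xi> u)" "reach m s\<^sub>2 p (eval_word G \<xi> v)"
      unfolding s\<^sub>1_def[symmetric] end_r by blast
    let ?l = "eval_word G \<xi> [(a, b)]"
    have "reach (n + (0 + m)) s\<^sub>1 s\<^sub>2 (inv\<^bsub>G\<^esub> (eval_word G \<xi> u) \<otimes>\<^bsub>G\<^esub> (\<iota> \<zeta> \<otimes>\<^bsub>G\<^esub> inv\<^bsub>G\<^esub> (eval_word G \<xi> v)))"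
      by (rule reach_mult[OF reach_inv[OF nm(1)] reach_mult[OF reach_coefficient[OF zeta] reach_inv[OF nm(2)]]])
    \<comment> \<open>The relation says that \<open>u\<close>, the letter and \<open>v\<close>
      multiply to \<open>\<iota> \<zeta>\<close>; it is solved for the letter.\<close>
    moreover have "inv\<^bsub>G\<^esub> (eval_word G \<xi> u) \<otimes>\<^bsub>G\<^esub> (\<iota> \<zeta> \<otimes>\<^bsub>G\<^esub> inv\<^bsub>G\<^esub> (eval_word G \<xi> v)) = ?l"
    proof -
      have l: "?l \<in> carrier G" using letter_closed a_in by simp
      have "\<iota> \<zeta> = eval_word G \<xi> (u @ [(a, b)] @ v)"
        using relator uv(1) by simp
      also have "\<dots> = eval_word G \<xi> u \<otimes>\<^bsub>G\<^esub> (?l \<otimes>\<^bsub>G\<^esub> eval_word G \<xi> v)"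
        using words a_in
        by (subst eval_word_append[OF G.is_group xi], simp, simp)
          (subst eval_word_append[OF G.is_group xi], auto)
      finally show ?thesis
        using l words eval_word_closed'
        by (simp add: G.m_assoc G.inv_solve_left' del: eval_word_Cons)
    qed
    ultimately have l: "reach (n + m) s\<^sub>1 s\<^sub>2 ?l" by simp
    show ?thesis
    proof (cases b)
      case b: True
      then have "s\<^sub>1 = q" using j s12 True by (simp add: j_def min_def split: if_splits)
      then show ?thesis using l s12 b True a_in by auto
    next
      case b: False
      then have "s\<^sub>2 = q" using j s12 True by (simp add: j_def min_def split: if_splits)
      moreover have "s\<^sub>1 = q + \<theta> a" using s12 b calculation by simp
      ultimately have "reach (n + m) q (q + \<theta> a) (inv\<^bsub>G\<^esub> ?l)"
        using reach_inv[OF l] by simp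
      then show ?thesis using b True a_in by auto
    qed
  qed
qed

text \<open>Allowed paths avoid negative heights, so the claim is strengthened: the element is
  reachable from all sufficiently large starting heights, with a fixed shift. In this form it passes
  to products.\<close>

lemma reach_element:
  assumes "g \<in> carrier G"
  shows "\<exists>n p p'. reach n p p' g"
proof -
  have "\<exists>\<delta> B. \<forall>p \<ge> B. \<exists>n. reach n p (p + \<delta>) g"
    using assms[unfolded generated]
  proof (induction rule: generate.induct)
    case one
    then show ?case
      using reach_coefficient[of "\<one>\<^bsub>K\<^esub>"] by (intro exI[of _ 0]) auto
  next
    case (incl g)
    then show ?case
    proof
      assume "g \<in> \<iota> ` carrier K"
      then show ?thesis
        using reach_coefficient by (intro exI[of _ 0]) auto
    next
      assume "g \<in> \<xi> ` X"
      then obtain x where x: "x \<in> X" "g = \<xi> x" by blast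
      have "\<exists>n. reach n p (p + \<theta> x) g" if "p \<ge> \<bar>\<theta> x\<bar>" for p
        using reach_generator[OF x(1), of p] that x by fastforce
      then show ?thesis by blast
    qed
  next
    case (inv g)
    then show ?case
    proof
      assume "g \<in> \<iota> ` carrier K"
      then obtain h where h: "h \<in> carrier K" "g = \<iota> h" by blast
      then show ?thesis
        using reach_coefficient[of "inv\<^bsub>K\<^esub> h"] by (intro exI[of _ 0]) auto
    next
      assume "g \<in> \<xi> ` X"
      then obtain x where x: "x \<in> X" "g = \<xi> x" by blast
      have "\<exists>n. reach n p (p + - \<theta> x) (inv\<^bsub>G\<^esub> g)" if "p \<ge> \<bar>\<theta> x\<bar>" for p
        using reach_generator[OF x(1), of "p - \<theta> x"] reach_inv that x by fastforce
      then show ?thesis by blast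
    qed
  next
    case (eng g g')
    obtain \<delta> B \<delta>' B' where IH: "\<And>p. p \<ge> B \<Longrightarrow> \<exists>n. reach n p (p + \<delta>) g"
      "\<And>p. p \<ge> B' \<Longrightarrow> \<exists>n. reach n p (p + \<delta>') g'"
      using eng.IH by blast
    have "\<exists>n. reach n p (p + (\<delta> + \<delta>')) (g \<otimes>\<^bsub>G\<^esub> g')" if "p \<ge> max B (B' - \<delta>)" for p
      using IH(1)[of p] IH(2)[of "p + \<delta>"] that reach_mult[of _ p "p + \<delta>" g _ "p + \<delta> + \<delta>'" g']
      by (auto simp: add.assoc)
    then show ?case by blast
  qed
  then show ?thesis by blast
qed

text \<open>A shortest representation works: two cancelling letters with a trivial coefficient
  between them could be removed, which would shorten it by two.\<close>

lemma reduced_form: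
  assumes "g \<in> carrier G" "g \<noteq> \<one>\<^bsub>G\<^esub>"
  obtains p h w where "h \<in> carrier K" "w \<in> exprs" "allowed_path p (skeleton w)"
    "g = \<iota> h \<otimes>\<^bsub>G\<^esub> expr_val w" "w = [] \<Longrightarrow> h \<noteq> \<one>\<^bsub>K\<^esub>"
    "\<And>i. Suc i < length w \<Longrightarrow> cancelling (fst (w ! i)) (fst (w ! Suc i)) \<Longrightarrow> snd (w ! i) \<noteq> \<one>\<^bsub>K\<^esub>"
proof -
  define n where "n = (LEAST n. \<exists>p p'. reach n p p' g)"
  have "\<exists>p p'. reach n p p' g"
    unfolding n_def using reach_element[OF assms(1)] by (rule LeastI_ex)
  then obtain p h w where hw: "h \<in> carrier K" "w \<in> exprs" "length w = n"
    "allowed_path p (skeleton w)" "g = \<iota> h \<otimes>\<^bsub>G\<^esub> expr_val w"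
    unfolding reach_def by blast
  have "snd (w ! i) \<noteq> \<one>\<^bsub>K\<^esub>" if i: "Suc i < length w" "cancelling (fst (w ! i)) (fst (w ! Suc i))" for i
  proof
    assume one: "snd (w ! i) = \<one>\<^bsub>K\<^esub>"
    obtain x b where xb: "w ! i = ((x, b), \<one>\<^bsub>K\<^esub>)" using one by (cases "w ! i") auto
    obtain k where k: "w ! Suc i = ((x, \<not> b), k)"
      using i(2) xb by (cases "w ! Suc i") (auto simp: cancelling_def)
    define u v where "u = take i w" and "v = drop (Suc (Suc i)) w"
    have w: "w = u @ [((x, b), \<one>\<^bsub>K\<^esub>), ((x, \<not> b), k)] @ v"
      using i xb k id_take_nth_drop[of i w] Cons_nth_drop_Suc[of "Suc i" w]
      by (simp add: u_def v_def)
    have uv: "u \<in> exprs" "v \<in> exprs" "x \<in> X" "k \<in> carrier K"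
      using hw(2) w by auto
    define s where "s = height_end \<theta> p (skeleton u)"
    have sk: "skeleton w = skeleton u @ [(x, b), (x, \<not> b)] @ skeleton v"
      using w by (simp add: skeleton_def)
    \<comment> \<open>The backtracking pair returns to height \<open>s\<close>, so the rest of the
      path is unchanged and still allowed.\<close>
    have he: "height_end \<theta> s [(x, b), (x, \<not> b)] = s" by simp
    have "allowed_path p (skeleton u)" "allowed_path (height_end \<theta> s [(x, b), (x, \<not> b)]) (skeleton v)"
      using hw(4) unfolding sk allowed_path_append s_def by blast+
    then have al: "allowed_path p (skeleton u)" "allowed_path s (skeleton v)"
      by (simp_all only: he)
    have 1: "reach (length u) p s (\<iota> h \<otimes>\<^bsub>G\<^esub> expr_val u)"
      using hw(1) uv al unfolding reach_def s_def by blast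
    have 2: "reach (length v) s (height_end \<theta> s (skeleton v)) (\<iota> k \<otimes>\<^bsub>G\<^esub> expr_val v)"
      using uv al unfolding reach_def by blast
    have "expr_val w = expr_val u \<otimes>\<^bsub>G\<^esub> (\<iota> k \<otimes>\<^bsub>G\<^esub> expr_val v)"
    proof -
      have l: "eval_word G \<xi> [(x, b)] \<in> carrier G" using uv letter_closed by simp
      have "expr_val ([((x, b), \<one>\<^bsub>K\<^esub>), ((x, \<not> b), k)] @ v) = \<iota> k \<otimes>\<^bsub>G\<^esub> expr_val v"
        using l uv expr_val_closed[OF uv(2)] inv_letter[OF uv(3), of b, symmetric]
        by (simp add: G.m_assoc[symmetric] del: eval_word_Cons)
      then show ?thesis
        using expr_val_append[of u "[((x, b), \<one>\<^bsub>K\<^esub>), ((x, \<not> b), k)] @ v"] uv w by simp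
    qed
    then have "g = (\<iota> h \<otimes>\<^bsub>G\<^esub> expr_val u) \<otimes>\<^bsub>G\<^esub> (\<iota> k \<otimes>\<^bsub>G\<^esub> expr_val v)"
      using hw uv expr_val_closed by (simp add: G.m_assoc)
    then have "reach (length u + length v) p (height_end \<theta> s (skeleton v)) g"
      using reach_mult[OF 1 2] by simp
    then have "n \<le> length u + length v"
      unfolding n_def by (intro Least_le) blast
    then show False
      using hw(3) i by (simp add: u_def v_def)
  qed
  moreover have "h \<noteq> \<one>\<^bsub>K\<^esub>" if "w = []"
    using that hw(5) assms(2) by auto
  ultimately show ?thesis
    using that hw by blast
qed

end

section \<open>Permutation representations\<close>

text \<open>Permutations are composed from left to right, so that words act in reading order.\<close>

definition perm_group :: "'s set \<Rightarrow> ('s \<Rightarrow> 's) monoid" where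
  "perm_group S = \<lparr>carrier = {f. f permutes S}, monoid.mult = (\<lambda>f g. g \<circ> f), one = id\<rparr>"

lemma carrier_perm_group [simp]: "f \<in> carrier (perm_group S) \<longleftrightarrow> f permutes S"
  and mult_perm_group [simp]: "f \<otimes>\<^bsub>perm_group S\<^esub> g = g \<circ> f"
  and one_perm_group [simp]: "\<one>\<^bsub>perm_group S\<^esub> = id"
  by (simp_all add: perm_group_def)

lemma group_perm_group: "group (perm_group S)"
proof (rule groupI)
  fix f assume "f \<in> carrier (perm_group S)"
  then show "\<exists>g \<in> carrier (perm_group S). g \<otimes>\<^bsub>perm_group S\<^esub> f = \<one>\<^bsub>perm_group S\<^esub>"
    by (intro bexI[of _ "inv_into UNIV f"]) (auto simp: permutes_inv permutes_inv_o)
qed (auto simp: permutes_compose permutes_id comp_assoc)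

lemma inv_perm_group: "f permutes S \<Longrightarrow> inv\<^bsub>perm_group S\<^esub> f = inv_into UNIV f"
  by (rule group.inv_equality[OF group_perm_group]) (auto simp: permutes_inv permutes_inv_o)

lemma finite_perm_group: "finite S \<Longrightarrow> finite (carrier (perm_group S))"
  by (simp add: perm_group_def finite_permutations)

text \<open>A partial injection of a finite set leaves equally many points outside its domain and
  outside its range; any bijection between these complements completes it.\<close>

lemma permutes_extends_partial:
  assumes "finite S" "r \<subseteq> S \<times> S"
    and inj: "\<And>u v u' v'. (u, v) \<in> r \<Longrightarrow> (u', v') \<in> r \<Longrightarrow> u = u' \<longleftrightarrow> v = v'"
  shows "\<exists>f. f permutes S \<and> (\<forall>(u, v) \<in> r. f u = v)"
proof -
  define g where "g u = (THE v. (u, v) \<in> r)" for u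
  have g: "g u = v" if "(u, v) \<in> r" for u v
    unfolding g_def using that inj by (intro the_equality) blast+
  have bij_g: "bij_betw g (Domain r) (Range r)"
    using g inj by (auto simp: bij_betw_def inj_on_def image_iff Domain_iff)
  have sub: "Domain r \<subseteq> S" "Range r \<subseteq> S" using assms(2) by auto
  then have "card (S - Domain r) = card (S - Range r)"
    using assms(1) bij_betw_same_card[OF bij_g] by (simp add: card_Diff_subset finite_subset)
  then obtain h where h: "bij_betw h (S - Domain r) (S - Range r)"
    using finite_same_card_bij assms(1) by blast
  let ?f = "\<lambda>u. if u \<in> Domain r then g u else if u \<in> S then h u else u"
  have "bij_betw ?f (Domain r) (Range r)"
    using bij_g by (rule bij_betw_cong[THEN iffD1, rotated]) auto
  moreover have "bij_betw ?f (S - Domain r) (S - Range r)"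
    using h by (rule bij_betw_cong[THEN iffD1, rotated]) auto
  ultimately have "bij_betw ?f (Domain r \<union> (S - Domain r)) (Range r \<union> (S - Range r))"
    by (rule bij_betw_combine) auto
  then have "bij_betw ?f S S"
    using sub by (simp add: Un_absorb1 Un_Diff_cancel)
  then have "?f permutes S"
    using sub by (intro bij_imp_permutes) auto
  moreover have "?f u = v" if "(u, v) \<in> r" for u v
    using g[OF that] that by (auto intro: DomainI)
  ultimately show ?thesis
    by blast
qed

lemma periodic_mod_eq:
  fixes E :: "int \<Rightarrow> 'v" and q :: int
  assumes "\<And>j. E (j + q) = E j" "i mod q = j mod q"
  shows "E i = E j"
proof -
  have "E (j + m * q) = E j" for m
  proof (induction m rule: int_induct[where k = 0])
    case (step1 m)
    then show ?case
      using assms(1)[of "j + m * q"] by (simp add: algebra_simps)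
  next
    case (step2 m)
    then show ?case
      using assms(1)[of "j + (m - 1) * q"] by (simp add: algebra_simps)
  qed simp
  moreover have "\<exists>m. i = j + m * q"
    using assms(2) by (metis mod_eqE mult.commute)
  ultimately show ?thesis by blast
qed

section \<open>Actions built from edge values\<close>

context relator_path
begin

text \<open>The heights are reduced modulo the period \<open>q\<close>. Since \<open>n mod 0 = n\<close>, the value \<open>q = 0\<close> covers
  the case without a period.\<close>

lemma permutation_representation:
  fixes \<alpha> :: "'k \<Rightarrow> 's \<Rightarrow> 's" and e :: "'x \<Rightarrow> 's \<Rightarrow> 's" and K :: "('k, 'm) monoid_scheme" and N :: int
  assumes K: "group K" and alpha: "\<alpha> \<in> hom K (perm_group \<Omega>)" and zeta: "\<zeta> \<in> carrier K"
    and e: "\<And>x. e x permutes \<Omega>"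
  obtains q :: int and S :: "(int \<times> 's) set" and \<rho> f
  where "finite \<Omega> \<Longrightarrow> finite S" "\<rho> \<in> hom K (perm_group S)" "\<And>x. f x permutes S"
    "eval_word (perm_group S) f r = \<rho> \<zeta>"
    "\<And>k n \<omega>. k \<in> carrier K \<Longrightarrow> \<omega> \<in> \<Omega> \<Longrightarrow> \<rho> k (n mod q, \<omega>) = (n mod q, \<alpha> k \<omega>)"
    "\<And>x b n \<omega>. \<omega> \<in> \<Omega> \<Longrightarrow> allowed x (min n (height_end \<theta> n [(x, b)])) \<Longrightarrow>
      min n (height_end \<theta> n [(x, b)]) \<le> N \<Longrightarrow>
      eval_word (perm_group S) f [(x, b)] (n mod q, \<omega>) =
        (height_end \<theta> n [(x, b)] mod q, (if b then e x else inv_into UNIV (e x)) \<omega>)"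
proof -
  interpret K: group K by (rule K)
  have az: "\<alpha> k permutes \<Omega>" if "k \<in> carrier K" for k
    using alpha that by (auto simp: hom_def)
  obtain E q where E: "\<And>x j. E x j permutes \<Omega>" "q \<ge> 0" "finite (carrier (perm_group \<Omega>)) \<Longrightarrow> q > 0"
    "\<And>x j. E x (j + q) = E x j" "\<And>n. path_val (perm_group \<Omega>) \<theta> E (p\<^sub>0 + n) r = \<alpha> \<zeta>"
    "\<And>x j. 0 \<le> j \<Longrightarrow> j \<le> N \<Longrightarrow> \<not> (x = a \<and> d \<le> j) \<Longrightarrow> E x j = e x"
    using periodic_edge_values[OF group_perm_group, of e \<Omega> "\<alpha> \<zeta>" N] e az[OF zeta] by auto
  define Z where "Z = range (\<lambda>n. n mod q)"
  define S where "S = Z \<times> \<Omega>"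
  have mod_Z: "n mod q \<in> Z" for n by (simp add: Z_def)
  have Z_mod: "n mod q = n" if "n \<in> Z" for n
    using that by (auto simp: Z_def)
  have fin: "finite S" if "finite \<Omega>"
  proof -
    have "q > 0" using E(3) finite_perm_group[OF that] .
    then have "Z \<subseteq> {0..<q}" by (auto simp: Z_def)
    then show ?thesis using that by (auto simp: S_def intro: finite_subset)
  qed
  \<comment> \<open>The letter \<open>x\<close> shifts the height by \<open>\<theta> x\<close> and
    applies the value of the edge it crosses; \<open>f'\<close> goes back over the same
    edge.\<close>
  define f where "f x = (\<lambda>(n, \<omega>). if (n, \<omega>) \<in> S then ((n + \<theta> x) mod q, E x (min n (n + \<theta> x)) \<omega>) else (n, \<omega>))" for x
  define f' where "f' x = (\<lambda>(n, \<omega>). if (n, \<omega>) \<in> S then ((n - \<theta> x) mod q, inv_into UNIV (E x (min n (n - \<theta> x))) \<omega>) else (n, \<omega>))" for x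
  have E_mod: "E x (min (n mod q) (n mod q + t)) = E x (min n (n + t))" for x n t
  proof (rule periodic_mod_eq[where E = "E x", OF E(4)])
    have "min (n mod q) (n mod q + t) = n mod q + min 0 t" "min n (n + t) = n + min 0 t" by auto
    then show "min (n mod q) (n mod q + t) mod q = min n (n + t) mod q"
      by (simp add: mod_add_left_eq)
  qed
  have f_mod: "f x (n mod q, \<omega>) = ((n + \<theta> x) mod q, E x (min n (n + \<theta> x)) \<omega>)" if "\<omega> \<in> \<Omega>" for x n \<omega>
    using that by (simp add: f_def S_def mod_Z E_mod mod_add_left_eq)
  have f'_mod: "f' x (n mod q, \<omega>) = ((n - \<theta> x) mod q, inv_into UNIV (E x (min n (n - \<theta> x))) \<omega>)" if "\<omega> \<in> \<Omega>" for x n \<omega>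
    using that E_mod[of x n "- \<theta> x"] by (simp add: f'_def S_def mod_Z mod_diff_left_eq)
  have E_in: "E x j \<omega> \<in> \<Omega> \<longleftrightarrow> \<omega> \<in> \<Omega>" "inv_into UNIV (E x j) \<omega> \<in> \<Omega> \<longleftrightarrow> \<omega> \<in> \<Omega>" for x j \<omega>
    using permutes_in_image[OF E(1)] permutes_in_image[OF permutes_inv[OF E(1)]] by metis+
  have ff': "f x (f' x s) = s" "f' x (f x s) = s" for x s
  proof -
    show "f x (f' x s) = s"
    proof (cases "s \<in> S")
      case True
      then obtain n \<omega> where s: "s = (n, \<omega>)" "n mod q = n" "\<omega> \<in> \<Omega>" by (auto simp: S_def Z_mod)
      then show ?thesis
        using f'_mod[of \<omega> x n] f_mod[of "inv_into UNIV (E x (min n (n - \<theta> x))) \<omega>" x "n - \<theta> x"] E_in(2)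
          permutes_inverses(1)[OF E(1)] by (simp add: min.commute)
    qed (auto simp: f_def f'_def split: prod.splits)
    show "f' x (f x s) = s"
    proof (cases "s \<in> S")
      case True
      then obtain n \<omega> where s: "s = (n, \<omega>)" "n mod q = n" "\<omega> \<in> \<Omega>" by (auto simp: S_def Z_mod)
      then show ?thesis
        using f_mod[of \<omega> x n] f'_mod[of "E x (min n (n + \<theta> x)) \<omega>" x "n + \<theta> x"] E_in(1)
          permutes_inverses(2)[OF E(1)] by (simp add: min.commute)
    qed (auto simp: f_def f'_def split: prod.splits)
  qed
  have f_perm: "f x permutes S" for x
  proof (rule bij_imp_permutes)
    have "f x s \<in> S" "f' x s \<in> S" if "s \<in> S" for s
      using that E_in mod_Z by (auto simp: f_def f'_def S_def)
    then show "bij_betw (f x) S S"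
      using ff' by (intro bij_betw_byWitness[where f' = "f' x"]) auto
  qed (auto simp: f_def)
  have inv_f: "inv\<^bsub>perm_group S\<^esub> (f x) = f' x" for x
    using inv_perm_group[OF f_perm] ff' by (metis inv_equality)
  \<comment> \<open>On the second coordinate a word acts by the value of the path that it
    describes.\<close>
  have word: "eval_word (perm_group S) f w (n mod q, \<omega>) =
      (height_end \<theta> n w mod q, path_val (perm_group \<Omega>) \<theta> E n w \<omega>)" if "\<omega> \<in> \<Omega>" for w n \<omega>
    using that
  proof (induction w arbitrary: n \<omega>)
    case (Cons l w)
    obtain x b where l: "l = (x, b)" by (cases l)
    show ?case
      using Cons by (simp add: l f_mod f'_mod inv_f inv_perm_group[OF E(1)] E_in Let_def)
  qed simp
  define \<rho> where "\<rho> k = (\<lambda>(n, \<omega>). if n \<in> Z then (n, \<alpha> k \<omega>) else (n, \<omega>))" for k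
  have rho_perm: "\<rho> k permutes S" if k: "k \<in> carrier K" for k
  proof (rule bij_imp_permutes)
    show "bij_betw (\<rho> k) S S"
      using permutes_inverses[OF az[OF k]] permutes_in_image[OF az[OF k]]
        permutes_in_image[OF permutes_inv[OF az[OF k]]]
      by (intro bij_betw_byWitness[where f' = "\<lambda>(n, \<omega>). (n, inv_into UNIV (\<alpha> k) \<omega>)"]) (auto simp: \<rho>_def S_def)
  next
    fix s assume "s \<notin> S"
    then show "\<rho> k s = s"
      using permutes_not_in[OF az[OF k]] by (cases s) (auto simp: \<rho>_def S_def)
  qed
  have rho_hom: "\<rho> \<in> hom K (perm_group S)"
  proof (rule homI)
    fix k k' assume k: "k \<in> carrier K" "k' \<in> carrier K"
    then have "\<alpha> (k \<otimes>\<^bsub>K\<^esub> k') = \<alpha> k' \<circ> \<alpha> k"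
      using hom_mult[OF alpha k] by simp
    then show "\<rho> (k \<otimes>\<^bsub>K\<^esub> k') = \<rho> k \<otimes>\<^bsub>perm_group S\<^esub> \<rho> k'"
      by (auto simp: \<rho>_def fun_eq_iff)
  qed (simp add: rho_perm)
  \<comment> \<open>From every height the relator is a closed path of value
    \<open>\<alpha> \<zeta>\<close>, and \<open>\<rho> \<zeta>\<close> also fixes the height and
    acts as \<open>\<alpha> \<zeta>\<close>.\<close>
  have rel: "eval_word (perm_group S) f r = \<rho> \<zeta>"
  proof
    fix s
    have perm: "eval_word (perm_group S) f r permutes S"
      using eval_word_closed[OF group_perm_group, of f X S r] f_perm r_in by auto
    show "eval_word (perm_group S) f r s = \<rho> \<zeta> s"
    proof (cases "s \<in> S")
      case True
      then obtain n \<omega> where s: "s = (n, \<omega>)" "n mod q = n" "\<omega> \<in> \<Omega>" "n \<in> Z" by (auto simp: S_def Z_mod)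
      have "height_end \<theta> n r = n"
        using closed height_end_shift[of \<theta> p\<^sub>0 "n - p\<^sub>0" r] by simp
      moreover have "path_val (perm_group \<Omega>) \<theta> E n r = \<alpha> \<zeta>"
        using E(5)[of "n - p\<^sub>0"] by simp
      ultimately show ?thesis
        using word[OF s(3), of r n] s by (simp add: \<rho>_def)
    next
      case False
      then show ?thesis
        using permutes_not_in[OF perm] permutes_not_in[OF rho_perm[OF zeta]] by metis
    qed
  qed
  show ?thesis
  proof (rule that[of S \<rho> f q])
    fix x b n \<omega>
    let ?m = "height_end \<theta> n [(x, b)]"
    assume *: "\<omega> \<in> \<Omega>" "allowed x (min n ?m)" "min n ?m \<le> N"
    then have "E x (min n ?m) = e x"
      using E(6)[of "min n ?m" x] by (auto simp: allowed_def)
    then show "eval_word (perm_group S) f [(x, b)] (n mod q, \<omega>) =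
        (?m mod q, (if b then e x else inv_into UNIV (e x)) \<omega>)"
      using word[OF *(1), of "[(x, b)]" n] by (cases b) (simp_all add: Let_def inv_perm_group[OF E(1)])
  qed (use fin rho_hom f_perm rel mod_Z in \<open>auto simp: \<rho>_def\<close>)
qed

lemma coefficients_embed:
  fixes K :: "('k, 'm) monoid_scheme"
  assumes K: "group K" and zeta: "\<zeta> \<in> carrier K" and k: "k \<in> carrier K" "k \<noteq> \<one>\<^bsub>K\<^esub>"
  obtains S :: "(int \<times> 'k) set" and \<rho> f
  where "\<rho> \<in> hom K (perm_group S)" "\<And>x. f x permutes S"
    "eval_word (perm_group S) f r = \<rho> \<zeta>" "\<rho> k \<noteq> id"
proof -
  interpret K: group K by (rule K)
  define \<alpha> where "\<alpha> k = (\<lambda>\<omega>. if \<omega> \<in> carrier K then \<omega> \<otimes>\<^bsub>K\<^esub> k else \<omega>)" for k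
  have "\<alpha> k permutes carrier K" if "k \<in> carrier K" for k
  proof (rule bij_imp_permutes)
    show "bij_betw (\<alpha> k) (carrier K) (carrier K)"
      using that by (intro bij_betw_byWitness[where f' = "\<alpha> (inv\<^bsub>K\<^esub> k)"]) (auto simp: \<alpha>_def K.m_assoc)
  qed (auto simp: \<alpha>_def)
  then have "\<alpha> \<in> hom K (perm_group (carrier K))"
    by (intro homI) (auto simp: \<alpha>_def fun_eq_iff K.m_assoc)
  \<comment> \<open>All letters get the identity as initial value; what counts is how
    \<open>k\<close> acts at height 0.\<close>
  then obtain q :: int and S :: "(int \<times> 'k) set" and \<rho> f where *:
    "\<rho> \<in> hom K (perm_group S)" "\<And>x. f x permutes S" "eval_word (perm_group S) f r = \<rho> \<zeta>"
    "\<And>k n \<omega>. k \<in> carrier K \<Longrightarrow> \<omega> \<in> carrier K \<Longrightarrow> \<rho> k (n mod q, \<omega>) = (n mod q, \<alpha> k \<omega>)"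
    using permutation_representation[OF K _ zeta permutes_id, of \<alpha> "carrier K"] by metis
  have "\<rho> k (0 mod q, \<one>\<^bsub>K\<^esub>) = (0 mod q, k)"
    using *(4)[OF k(1) K.one_closed, of 0] k by (simp add: \<alpha>_def)
  then have "\<rho> k \<noteq> id" using k by auto
  then show ?thesis using that * by blast
qed

end

section \<open>Finite representations that detect a given element\<close>

context relative_quotient
begin

text \<open>The conclusion speaks of all homomorphisms that extend \<open>\<rho>\<close> and
  \<open>f\<close>, because the existence of one depends on a presentation of \<open>G\<close>,
  which the locale does not fix. The representation is built so that the word of \<open>g\<close>
  carries a point at position 0 to one at the last position.\<close>

lemma separating_representation:
  assumes rf: "residually_finite K" and g: "g \<in> carrier G" "g \<noteq> \<one>\<^bsub>G\<^esub>"
  obtains S :: "(int \<times> nat \<times> 'k set) set" and \<rho> f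
  where "finite S" "\<rho> \<in> hom K (perm_group S)" "\<And>x. f x permutes S"
    "eval_word (perm_group S) f r = \<rho> \<zeta>"
    "\<forall>F \<in> hom G (perm_group S). (\<forall>k \<in> carrier K. F (\<iota> k) = \<rho> k) \<longrightarrow>
      (\<forall>x \<in> X. F (\<xi> x) = f x) \<longrightarrow> F g \<noteq> id"
proof -
  obtain p h w where hw: "h \<in> carrier K" "w \<in> exprs" "allowed_path p (skeleton w)"
    "g = \<iota> h \<otimes>\<^bsub>G\<^esub> expr_val w" "w = [] \<Longrightarrow> h \<noteq> \<one>\<^bsub>K\<^esub>"
    "\<And>i. Suc i < length w \<Longrightarrow> cancelling (fst (w ! i)) (fst (w ! Suc i)) \<Longrightarrow> snd (w ! i) \<noteq> \<one>\<^bsub>K\<^esub>"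
    using reduced_form[OF g] by metis
  define s where "s = length w"
  \<comment> \<open>All coefficients in order: \<open>H 0\<close> is the leading one,
    \<open>H (Suc i)\<close> follows the letter of index \<open>i\<close>.\<close>
  define H where "H i = (case i of 0 \<Rightarrow> h | Suc i \<Rightarrow> snd (w ! i))" for i
  have snd_K: "snd (w ! i) \<in> carrier K" and fst_X: "fst (fst (w ! i)) \<in> X" if "i < s" for i
    using hw(2) that nth_mem[of i w] by (auto simp: s_def subset_iff mem_Times_iff)
  have H_K: "H i \<in> carrier K" if "i \<le> s" for i
    using that hw(1) snd_K by (auto simp: H_def split: nat.split)
  have "finite (H ` {..s} - {\<one>\<^bsub>K\<^esub>})" "H ` {..s} - {\<one>\<^bsub>K\<^esub>} \<subseteq> carrier K - {\<one>\<^bsub>K\<^esub>}"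
    using H_K by auto
  then obtain M where M: "M \<lhd> K" "finite (carrier (K Mod M))" "(H ` {..s} - {\<one>\<^bsub>K\<^esub>}) \<inter> M = {}"
    using residually_finite_finite_set[OF rf] by metis
  interpret M: normal M K by (rule M)
  interpret KM: group "K Mod M" by (rule M.factorgroup_is_group)
  define \<pi> where "\<pi> k = M #>\<^bsub>K\<^esub> k" for k
  have pi_hom: "\<pi> \<in> hom K (K Mod M)"
    using M.r_coset_hom_Mod by (simp add: \<pi>_def[abs_def])
  interpret pi: group_hom K "K Mod M" \<pi> by unfold_locales (rule pi_hom)
  have pi_M: "\<pi> k = \<one>\<^bsub>K Mod M\<^esub> \<longleftrightarrow> k \<in> M" if "k \<in> carrier K" for k
    using that K.coset_join1[of M k] K.coset_join2[of k M] M.subgroup_axioms M.subset by (auto simp: \<pi>_def)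
  have H_one: "H i = \<one>\<^bsub>K\<^esub>" if "i \<le> s" "\<pi> (H i) = \<one>\<^bsub>K Mod M\<^esub>" for i
    using that pi_M[OF H_K] M(3) by blast
  define \<Omega> where "\<Omega> = {..s} \<times> carrier (K Mod M)"
  define \<alpha> where "\<alpha> k = (\<lambda>(i, C). if (i, C) \<in> \<Omega> then (i, C \<otimes>\<^bsub>K Mod M\<^esub> \<pi> k) else (i, C))" for k
  have alpha_perm: "\<alpha> k permutes \<Omega>" if k: "k \<in> carrier K" for k
  proof (rule bij_imp_permutes)
    show "bij_betw (\<alpha> k) \<Omega> \<Omega>"
      using k pi.hom_closed by (intro bij_betw_byWitness[where f' = "\<alpha> (inv\<^bsub>K\<^esub> k)"])
        (auto simp: \<alpha>_def \<Omega>_def KM.m_assoc simp del: mult_FactGroup one_FactGroup)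
  qed (auto simp: \<alpha>_def)
  have alpha: "\<alpha> \<in> hom K (perm_group \<Omega>)"
  proof (rule homI)
    fix k k' assume "k \<in> carrier K" "k' \<in> carrier K"
    then show "\<alpha> (k \<otimes>\<^bsub>K\<^esub> k') = \<alpha> k \<otimes>\<^bsub>perm_group \<Omega>\<^esub> \<alpha> k'"
      using pi.hom_closed
      by (auto simp: \<alpha>_def \<Omega>_def fun_eq_iff KM.m_assoc simp del: mult_FactGroup one_FactGroup)
  qed (simp add: alpha_perm)
  \<comment> \<open>The itinerary of one point: position \<open>i\<close> is entered at
    \<open>A i\<close>, the coefficient \<open>H i\<close> moves it to \<open>B i\<close>, and the
    next letter takes it to \<open>A (Suc i)\<close>.\<close>
  define A B where "A i = (i, \<one>\<^bsub>K Mod M\<^esub>)" and "B i = (i, \<pi> (H i))" for i :: nat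
  have AB: "A i \<in> \<Omega>" "B i \<in> \<Omega>" if "i \<le> s" for i
    using that H_K KM.one_closed pi.hom_closed
    by (auto simp: A_def B_def \<Omega>_def simp del: one_FactGroup)
  \<comment> \<open>The moves demanded of the generator \<open>x\<close>; an inverse letter demands
    its move in the opposite direction.\<close>
  define rel where "rel x = {(if b then B i else A (Suc i), if b then A (Suc i) else B i) | i b.
      i < s \<and> fst (w ! i) = (x, b)}" for x
  \<comment> \<open>Two demands on \<open>x\<close> can clash only where a letter is followed by its
    inverse and the coefficient between them leaves the point in place; reducedness excludes
    this.\<close>
  have no_turn: "B (Suc i) \<noteq> A (Suc i)" if "Suc i < s" "cancelling (fst (w ! i)) (fst (w ! Suc i))" for i
  proof
    assume "B (Suc i) = A (Suc i)"
    then have "H (Suc i) = \<one>\<^bsub>K\<^esub>"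
      using H_one[of "Suc i"] that by (simp add: A_def B_def)
    then show False
      using hw(6)[of i] that by (simp add: H_def s_def)
  qed
  have "\<exists>e. e permutes \<Omega> \<and> (\<forall>(u, v) \<in> rel x. e u = v)" for x
  proof -
    have "u = u' \<longleftrightarrow> v = v'" if "(u, v) \<in> rel x" "(u', v') \<in> rel x" for u v u' v'
    proof -
      have no_eq: "B i \<noteq> A (Suc j)" "A (Suc i) \<noteq> B j"
        if "i < s" "fst (w ! i) = (x, True)" "j < s" "fst (w ! j) = (x, False)" for i j
        using no_turn[of i] no_turn[of j] that
        by (auto simp: A_def B_def cancelling_def)
      obtain i b where ib: "i < s" "fst (w ! i) = (x, b)"
        "u = (if b then B i else A (Suc i))" "v = (if b then A (Suc i) else B i)"
        using \<open>(u, v) \<in> rel x\<close> unfolding rel_def by blast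
      obtain j b' where jb: "j < s" "fst (w ! j) = (x, b')"
        "u' = (if b' then B j else A (Suc j))" "v' = (if b' then A (Suc j) else B j)"
        using \<open>(u', v') \<in> rel x\<close> unfolding rel_def by blast
      have "B i = B j \<longleftrightarrow> i = j" "A (Suc i) = A (Suc j) \<longleftrightarrow> i = j"
        by (auto simp: A_def B_def)
      then show ?thesis
        using ib jb no_eq[of i j] no_eq[of j i] by (cases b; cases b') auto
    qed
    moreover have "rel x \<subseteq> \<Omega> \<times> \<Omega>"
      using AB by (force simp: rel_def)
    moreover have "finite \<Omega>"
      using M(2) by (simp add: \<Omega>_def)
    ultimately show ?thesis
      by (intro permutes_extends_partial) auto
  qed
  then obtain e where "\<forall>x. e x permutes \<Omega> \<and> (\<forall>(u, v) \<in> rel x. e x u = v)"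
    using choice[of "\<lambda>x e. e permutes \<Omega> \<and> (\<forall>(u, v) \<in> rel x. e u = v)"] by blast
  then have e: "\<And>x. e x permutes \<Omega>" "\<And>x u v. (u, v) \<in> rel x \<Longrightarrow> e x u = v"
    by auto
  \<comment> \<open>The edge values have to be the prescribed ones along the whole path of
    \<open>w\<close>.\<close>
  define N where "N = Max (insert 0 (snd ` set (edges \<theta> p (skeleton w))))"
  have N: "j \<le> N" if "(x, j) \<in> set (edges \<theta> p (skeleton w))" for x j
    unfolding N_def using that by (intro Max_ge) force+
  obtain q :: int and S :: "(int \<times> nat \<times> 'k set) set" and \<rho> f where S:
    "finite \<Omega> \<Longrightarrow> finite S" "\<rho> \<in> hom K (perm_group S)" "\<And>x. f x permutes S"
    "eval_word (perm_group S) f r = \<rho> \<zeta>"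
    "\<And>k n \<omega>. k \<in> carrier K \<Longrightarrow> \<omega> \<in> \<Omega> \<Longrightarrow> \<rho> k (n mod q, \<omega>) = (n mod q, \<alpha> k \<omega>)"
    "\<And>x b n \<omega>. \<omega> \<in> \<Omega> \<Longrightarrow> allowed x (min n (height_end \<theta> n [(x, b)])) \<Longrightarrow>
      min n (height_end \<theta> n [(x, b)]) \<le> N \<Longrightarrow>
      eval_word (perm_group S) f [(x, b)] (n mod q, \<omega>) =
        (height_end \<theta> n [(x, b)] mod q, (if b then e x else inv_into UNIV (e x)) \<omega>)"
    using permutation_representation[OF K.is_group alpha zeta, of e N] e(1) by metis
  have separates: "F g \<noteq> id" if F: "F \<in> hom G (perm_group S)" "\<And>k. k \<in> carrier K \<Longrightarrow> F (\<iota> k) = \<rho> k"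
    "\<And>x. x \<in> X \<Longrightarrow> F (\<xi> x) = f x" for F
  proof -
    have F_mult: "F (u \<otimes>\<^bsub>G\<^esub> v) = F v \<circ> F u" if "u \<in> carrier G" "v \<in> carrier G" for u v
      using hom_mult[OF F(1) that] by simp
    have alpha_AB: "\<alpha> (H i) (A i) = B i" if "i \<le> s" for i
      using AB[OF that] H_K[OF that] pi.hom_closed[of "H i"] KM.l_one[of "\<pi> (H i)"]
      by (simp add: \<alpha>_def A_def B_def del: one_FactGroup mult_FactGroup)
    have "F (\<iota> h \<otimes>\<^bsub>G\<^esub> expr_val (take i w)) (p mod q, A 0) =
        (height_end \<theta> p (skeleton (take i w)) mod q, B i)" if "i \<le> s" for i
      using that
    proof (induction i)
      case 0
      then show ?case
        using S(5)[OF hw(1) AB(1), of 0 p] alpha_AB[of 0] F(2) hw(1) by (simp add: skeleton_def H_def)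
    next
      case (Suc i)
      obtain x b k where wi: "w ! i = ((x, b), k)" by (cases "w ! i") auto
      have i: "i < s" using Suc by simp
      have xk: "x \<in> X" "k \<in> carrier K" "k = H (Suc i)"
        using snd_K[OF i] fst_X[OF i] wi by (auto simp: H_def)
      have tk: "take (Suc i) w = take i w @ [((x, b), k)]"
        using i wi by (simp add: take_Suc_conv_app_nth s_def)
      define n where "n = height_end \<theta> p (skeleton (take i w))"
      have he: "height_end \<theta> p (skeleton (take (Suc i) w)) = height_end \<theta> n [(x, b)]"
        unfolding tk n_def skeleton_def by (simp add: height_end_append)
      have "skeleton w = skeleton (take i w) @ [(x, b)] @ skeleton (drop (Suc i) w)"
        using arg_cong[OF id_take_nth_drop[of i w], of skeleton] i wi by (simp add: s_def skeleton_def)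
      then have "(x, min n (height_end \<theta> n [(x, b)])) \<in> set (edges \<theta> p (skeleton w))"
        by (simp add: edges_append n_def Let_def)
      then have al: "allowed x (min n (height_end \<theta> n [(x, b)]))" "min n (height_end \<theta> n [(x, b)]) \<le> N"
        using hw(3) N unfolding allowed_path_def by blast+
      have rel_i: "(if b then B i else A (Suc i), if b then A (Suc i) else B i) \<in> rel x"
        using i wi unfolding rel_def by (intro CollectI exI[of _ i] exI[of _ b]) simp
      have move: "(if b then e x else inv_into UNIV (e x)) (B i) = A (Suc i)"
      proof (cases b)
        case True
        then show ?thesis using e(2)[OF rel_i] by simp
      next
        case False
        then have "e x (A (Suc i)) = B i" using e(2)[OF rel_i] by simp
        then show ?thesis using permutes_inverses(2)[OF e(1)] False by metis
      qed
      let ?l = "eval_word G \<xi> [(x, b)]"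
      have l: "?l \<in> carrier G" using xk letter_closed by simp
      have tw: "take i w \<in> exprs"
        using hw(2) by (metis append_in_lists_conv append_take_drop_id)
      have tl: "[((x, b), k)] \<in> exprs"
        using xk by simp
      have "\<iota> h \<otimes>\<^bsub>G\<^esub> expr_val (take (Suc i) w) = (\<iota> h \<otimes>\<^bsub>G\<^esub> expr_val (take i w)) \<otimes>\<^bsub>G\<^esub> (?l \<otimes>\<^bsub>G\<^esub> \<iota> k)"
        using expr_val_append[OF tw tl] expr_val_closed[OF tw] l hw(1) xk
        by (simp add: tk G.m_assoc del: eval_word_Cons)
      then have "F (\<iota> h \<otimes>\<^bsub>G\<^esub> expr_val (take (Suc i) w)) (p mod q, A 0)
          = F (\<iota> k) (F ?l (F (\<iota> h \<otimes>\<^bsub>G\<^esub> expr_val (take i w)) (p mod q, A 0)))"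
        using F_mult l xk hw(1) expr_val_closed[OF tw] by (simp del: eval_word_Cons)
      also have "\<dots> = F (\<iota> k) (F ?l (n mod q, B i))"
        using Suc by (simp add: n_def del: eval_word_Cons)
      also have "F ?l = eval_word (perm_group S) f [(x, b)]"
      proof -
        have "F ?l = eval_word (perm_group S) (F \<circ> \<xi>) [(x, b)]"
          using xk by (intro hom_eval_word[OF G.is_group group_perm_group F(1) xi]) simp
        also have "\<dots> = eval_word (perm_group S) f [(x, b)]"
          using F(3) xk by (intro eval_word_cong) simp
        finally show ?thesis .
      qed
      also have "eval_word (perm_group S) f [(x, b)] (n mod q, B i) = (height_end \<theta> n [(x, b)] mod q, A (Suc i))"
        using S(6)[OF AB(2) al] i move by simp
      also have "F (\<iota> k) (height_end \<theta> n [(x, b)] mod q, A (Suc i)) = (height_end \<theta> n [(x, b)] mod q, B (Suc i))"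
        using F(2)[OF xk(2)] S(5)[OF xk(2) AB(1)[OF Suc.prems]] alpha_AB[OF Suc.prems] xk(3) by simp
      finally show ?case by (simp only: he)
    qed
    from this[of s] have "F g (p mod q, A 0) = (height_end \<theta> p (skeleton w) mod q, B s)"
      by (simp add: s_def hw(4))
    \<comment> \<open>The positions differ unless \<open>s = 0\<close>; in that case
      \<open>h\<close> is nontrivial, and \<open>M\<close> was chosen to keep it so in the
      quotient.\<close>
    moreover have "B s \<noteq> A 0"
    proof
      assume "B s = A 0"
      then have "s = 0" "H 0 = \<one>\<^bsub>K\<^esub>"
        using H_one[of 0] by (auto simp: A_def B_def)
      then show False using hw(5) by (simp add: s_def H_def)
    qed
    ultimately show ?thesis by auto
  qed
  have "finite S"
    using S(1) M(2) by (simp add: \<Omega>_def)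
  show ?thesis
    by (rule that[OF \<open>finite S\<close> S(2-4)]) (intro ballI impI separates; blast)
qed

end

section \<open>The unique max-min property\<close>

text \<open>Generators of the coefficient group become letters of weight 0.\<close>

definition expand :: "('h \<Rightarrow> 'b word) \<Rightarrow> ('a, 'h) rel_expr \<Rightarrow> ('a + 'b) word" where
  "expand wd R = concat (map (\<lambda>(l, h). map_prod Inl id l # map (map_prod Inr id) (wd h)) R)"

lemma expand_Nil [simp]: "expand wd [] = []"
  by (simp add: expand_def)

lemma expand_Cons:
  "expand wd (((x, b), h) # R) = [(Inl x, b)] @ map (map_prod Inr id) (wd h) @ expand wd R"
  by (simp add: expand_def)

lemma expand_in_lists:
  assumes "R \<in> lists ((A \<times> UNIV) \<times> C)" "\<And>h. h \<in> C \<Longrightarrow> wd h \<in> lists (B \<times> UNIV)"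
  shows "expand wd R \<in> lists ((Inl ` A \<union> Inr ` B) \<times> UNIV)"
  using assms by (force simp: expand_def)

lemma weight_zero_segment:
  "height_end (case_sum \<theta> (\<lambda>_. 0)) p (map (map_prod Inr id) v) = p"
  "edges (case_sum \<theta> (\<lambda>_. 0)) p (map (map_prod Inr id) v) = map (\<lambda>(y, _). (Inr y, p)) v"
  by (induction v) auto

lemma skeleton_Cons: "skeleton ((l, h) # R) = l # skeleton R"
  by (simp add: skeleton_def)

lemma height_end_expand:
  "height_end (case_sum \<theta> (\<lambda>_. 0)) p (expand wd R) = height_end \<theta> p (skeleton R)"
proof (induction R arbitrary: p)
  case (Cons lh R)
  then show ?case
    by (cases lh; cases "fst lh") (simp add: expand_Cons skeleton_Cons height_end_append weight_zero_segment)
qed (simp add: skeleton_def)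

lemma count_edges_expand:
  "count_list (edges (case_sum \<theta> (\<lambda>_. 0)) p (expand wd R)) (Inl x, j) =
    count_list (edges \<theta> p (skeleton R)) (x, j)"
proof (induction R arbitrary: p)
  case (Cons lh R)
  obtain y b h where lh: "lh = ((y, b), h)" by (cases lh) auto
  have "count_list (map (\<lambda>(y, _). (Inr y, q)) (wd h)) (Inl x, j) = 0" for q :: int
    by (auto simp: count_list_0_iff)
  then show ?case
    using Cons by (auto simp: lh expand_Cons skeleton_Cons edges_append height_end_append
        weight_zero_segment Let_def)
qed (simp add: skeleton_def)

text \<open>Letters of weight 0 contribute edges only at heights that the skeleton visits
  anyway.\<close>

lemma edges_expand_lower_bound:
  assumes "\<And>i. i \<le> length R \<Longrightarrow> m \<le> height_end \<theta> p (take i (skeleton R))"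
    and "(y, j) \<in> set (edges (case_sum \<theta> (\<lambda>_. 0)) p (expand wd R))"
  shows "m \<le> j"
  using assms
proof (induction R arbitrary: p)
  case (Cons lh R)
  obtain x b h where lh: "lh = ((x, b), h)" by (cases lh) auto
  define q where "q = height_end \<theta> p [(x, b)]"
  have es: "edges (case_sum \<theta> (\<lambda>_. 0)) p (expand wd (lh # R)) = (Inl x, min p q) #
      map (\<lambda>(y, _). (Inr y, q)) (wd h) @ edges (case_sum \<theta> (\<lambda>_. 0)) q (expand wd R)"
    by (simp add: lh expand_Cons edges_append height_end_append weight_zero_segment Let_def q_def)
  have bound: "m \<le> height_end \<theta> q (take i (skeleton R))" if "i \<le> length R" for i
    using Cons.prems(1)[of "Suc i"] that by (simp add: lh skeleton_Cons q_def)
  have "m \<le> p" "m \<le> q"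
    using Cons.prems(1)[of 0] bound[of 0] by simp_all
  moreover have "m \<le> j" if "(y, j) \<in> set (edges (case_sum \<theta> (\<lambda>_. 0)) q (expand wd R))"
    using Cons.IH[OF bound that] .
  moreover have "(y, j) = (Inl x, min p q) \<or> (y, j) \<in> set (map (\<lambda>(y, _). (Inr y, q)) (wd h)) \<or>
      (y, j) \<in> set (edges (case_sum \<theta> (\<lambda>_. 0)) q (expand wd R))"
    using Cons.prems(2) unfolding es by simp
  ultimately show ?case
    by fastforce
qed simp

section \<open>From unique extrema of the skeleton to edges crossed once\<close>

lemma count_list_eq_1I:
  assumes "i < length xs" "xs ! i = y" "\<And>j. j < length xs \<Longrightarrow> xs ! j = y \<Longrightarrow> j = i"
  shows "count_list xs y = 1"
proof -
  have "{j. j < length xs \<and> y = xs ! j} = {i}"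
    using assms(1) assms(2)[symmetric] assms(3)[OF _ sym] by blast
  then show ?thesis
    by (simp add: count_list_eq_length_filter length_filter_conv_card)
qed

lemma length_edges: "length (edges \<theta> p w) = length w"
  by (induction \<theta> p w rule: edges.induct) (auto simp: Let_def)

lemma nth_edges:
  assumes "i < length w"
  shows "edges \<theta> p w ! i =
    (fst (w ! i), min (height_end \<theta> p (take i w)) (height_end \<theta> p (take (Suc i) w)))"
  using assms
proof (induction w arbitrary: p i)
  case (Cons l w)
  then show ?case
    by (cases l; cases i) (auto simp: Let_def)
qed simp

lemma height_end_take_Suc:
  assumes "i < length w"
  shows "height_end \<theta> p (take (Suc i) w) =
    height_end \<theta> p (take i w) + (if snd (w ! i) then \<theta> (fst (w ! i)) else - \<theta> (fst (w ! i)))"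
  using assms by (cases "w ! i") (simp add: take_Suc_conv_app_nth height_end_append)

lemma partial_weight_height_end:
  "j \<le> length w \<Longrightarrow> partial_weight \<theta> w j = height_end \<theta> 0 (take j w)"
proof (induction j)
  case (Suc j)
  then show ?case
    by (simp add: partial_weight_def height_end_take_Suc)
qed (simp add: partial_weight_def)

text \<open>An edge ending at the maximal height is crossed only directly before or after a visit
  there. Up to closing the path there is one visit; letter \<open>k\<close> leads to it and the
  letter after it has another type, so the edge of letter \<open>k\<close> is crossed once. The
  minimum is symmetric.\<close>

lemma unique_max_min_relator_path:
  assumes umm: "unique_max_min A (skeleton R)"
    and R: "R \<in> lists ((A \<times> UNIV) \<times> C)" and wd: "\<And>h. h \<in> C \<Longrightarrow> wd h \<in> lists (B \<times> UNIV)"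
  obtains \<theta> p\<^sub>0 a c d where "relator_path (Inl ` A \<union> Inr ` B) \<theta> (expand wd R) p\<^sub>0 a c d"
proof -
  define W where "W = skeleton R"
  define n where "n = length W"
  obtain \<theta> k l where adm: "admissible \<theta> W" and kl: "k \<in> {1..n}" "l \<in> {1..n}"
    and mx: "\<forall>j \<in> {1..n} - {k}. partial_weight \<theta> W j < partial_weight \<theta> W k"
    and mn: "\<forall>j \<in> {1..n} - {l}. partial_weight \<theta> W j > partial_weight \<theta> W l"
    and turn: "fst (W ! (k - 1)) \<noteq> fst (W ! (k mod n))" "fst (W ! (l - 1)) \<noteq> fst (W ! (l mod n))"
    using umm unfolding unique_max_min_def W_def[symmetric] Let_def n_def[symmetric] by blast
  define \<phi> where "\<phi> j = height_end \<theta> 0 (take j W)" for j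
  have pw: "partial_weight \<theta> W j = \<phi> j" if "j \<le> n" for j
    using partial_weight_height_end that by (simp add: n_def \<phi>_def)
  have max: "\<phi> j < \<phi> k" if "j \<in> {1..n}" "j \<noteq> k" for j
    using bspec[OF mx, of j] kl that pw[of j] pw[of k] by auto
  have min: "\<phi> l < \<phi> j" if "j \<in> {1..n}" "j \<noteq> l" for j
    using bspec[OF mn, of j] kl that pw[of j] pw[of l] by auto
  have phi_0: "\<phi> 0 = 0" "\<phi> n = 0"
    using adm pw[of n] by (simp_all add: \<phi>_def admissible_def n_def)
  \<comment> \<open>The path is closed, so a maximum attained at \<open>n\<close> is also attained
    at index 0, which \<open>{1..n}\<close> does not list.\<close>
  have top_visit: "i = k \<or> i = 0 \<and> k = n" if "\<phi> i = \<phi> k" "i \<le> n" for i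
    using max[of i] max[of n] that phi_0 kl by (cases "i = 0") auto
  have bottom_visit: "i = l \<or> i = 0 \<and> l = n" if "\<phi> i = \<phi> l" "i \<le> n" for i
    using min[of i] min[of n] that phi_0 kl by (cases "i = 0") auto
  have le_max: "\<phi> i \<le> \<phi> k" if "i \<le> n" for i
    using max[of i] max[of n] that phi_0 kl by (cases "i = 0"; cases "i = k"; cases "k = n") force+
  have ge_min: "\<phi> l \<le> \<phi> i" if "i \<le> n" for i
    using min[of i] min[of n] that phi_0 kl by (cases "i = 0"; cases "i = l"; cases "l = n") force+
  define a c where "a = fst (W ! (k - 1))" and "c = fst (W ! (l - 1))"
  have after_top: "fst (W ! i) \<noteq> a" if "\<phi> i = \<phi> k" "i < n" for i
    using top_visit[of i] that turn(1) by (auto simp: a_def)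
  have after_bottom: "fst (W ! i) \<noteq> c" if "\<phi> i = \<phi> l" "i < n" for i
    using bottom_visit[of i] that turn(2) by (auto simp: c_def)
  define p\<^sub>0 where "p\<^sub>0 = - \<phi> l"
  \<comment> \<open>Letter \<open>k\<close> climbs to the maximum, so its edge has lower end
    \<open>\<phi> (k - 1)\<close>; subtracting \<open>\<phi> l\<close> puts the minimum at height
    0.\<close>
  define d where "d = \<phi> (k - 1) - \<phi> l"
  have height: "height_end \<theta> p\<^sub>0 (take i W) = \<phi> i - \<phi> l" for i
    using height_end_shift[of \<theta> 0 p\<^sub>0 "take i W"] by (simp add: \<phi>_def p\<^sub>0_def)
  have edge: "edges \<theta> p\<^sub>0 W ! i = (fst (W ! i), min (\<phi> i) (\<phi> (Suc i)) - \<phi> l)" if "i < n" for i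
    using that nth_edges[of i W \<theta> p\<^sub>0] height by (simp add: n_def min_diff_distrib_left)
  have span: "\<bar>\<phi> (Suc i) - \<phi> i\<bar> = \<bar>\<theta> (fst (W ! i))\<bar>" if "i < n" for i
    using that height_end_take_Suc[of i W \<theta> 0] by (simp add: \<phi>_def n_def)
  have k: "Suc (k - 1) = k" "k - 1 < n" and l: "Suc (l - 1) = l" "l - 1 < n"
    using kl by auto
  \<comment> \<open>Equality would make \<open>k - 1\<close> a visit to the maximum followed by a
    letter of type \<open>a\<close>.\<close>
  have up_k: "\<phi> (k - 1) < \<phi> k"
    using le_max[of "k - 1"] after_top[of "k - 1"] k a_def by fastforce
  have edge_k: "edges \<theta> p\<^sub>0 W ! (k - 1) = (a, d)"
    using edge[OF k(2)] up_k k(1) by (simp add: a_def d_def)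
  have edge_l: "edges \<theta> p\<^sub>0 W ! (l - 1) = (c, 0)"
    using edge[OF l(2)] ge_min[of "l - 1"] l by (simp add: c_def min_def)
  have span_a: "\<bar>\<theta> a\<bar> = \<phi> k - \<phi> (k - 1)"
    using span[OF k(2)] up_k k(1) by (simp add: a_def)
  have ct: "count_list (edges \<theta> p\<^sub>0 W) (a, d) = 1"
  proof (rule count_list_eq_1I[OF _ edge_k])
    fix i assume "i < length (edges \<theta> p\<^sub>0 W)" and i: "edges \<theta> p\<^sub>0 W ! i = (a, d)"
    then have "i < n" by (simp add: length_edges n_def)
    then have "fst (W ! i) = a" "min (\<phi> i) (\<phi> (Suc i)) = \<phi> (k - 1)"
      using i edge by (auto simp: d_def)
    then have "\<phi> i = \<phi> k \<or> \<phi> (Suc i) = \<phi> k"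
      using span[OF \<open>i < n\<close>] span_a by (auto simp: min_def split: if_splits)
    then show "i = k - 1"
      using after_top[of i] top_visit[of "Suc i"] \<open>fst (W ! i) = a\<close> \<open>i < n\<close> by auto
  qed (use k in \<open>simp add: length_edges n_def\<close>)
  have cb: "count_list (edges \<theta> p\<^sub>0 W) (c, 0) = 1"
  proof (rule count_list_eq_1I[OF _ edge_l])
    fix i assume "i < length (edges \<theta> p\<^sub>0 W)" and i: "edges \<theta> p\<^sub>0 W ! i = (c, 0)"
    then have "i < n" by (simp add: length_edges n_def)
    then have "fst (W ! i) = c" "min (\<phi> i) (\<phi> (Suc i)) = \<phi> l"
      using i edge by auto
    then have "\<phi> i = \<phi> l \<or> \<phi> (Suc i) = \<phi> l"
      by (auto simp: min_def split: if_splits)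
    then show "i = l - 1"
      using after_bottom[of i] bottom_visit[of "Suc i"] \<open>fst (W ! i) = c\<close> \<open>i < n\<close> by auto
  qed (use l in \<open>simp add: length_edges n_def\<close>)
  show ?thesis
  proof (rule that, unfold_locales)
    let ?\<theta> = "case_sum \<theta> (\<lambda>_. 0)" and ?es = "edges (case_sum \<theta> (\<lambda>_. 0)) p\<^sub>0 (expand wd R)"
    show "expand wd R \<in> lists ((Inl ` A \<union> Inr ` B) \<times> UNIV)"
      using R wd by (rule expand_in_lists)
    have "W ! (k - 1) \<in> A \<times> UNIV"
    proof -
      have "W ! (k - 1) \<in> set W" using k by (simp add: n_def)
      then show ?thesis using R by (auto simp: W_def skeleton_def)
    qed
    then show "Inl a \<in> Inl ` A \<union> Inr ` B"
      by (auto simp: a_def)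
    have "height_end \<theta> p\<^sub>0 W = p\<^sub>0"
      using height[of n] phi_0 by (simp add: n_def p\<^sub>0_def)
    then show "height_end ?\<theta> p\<^sub>0 (expand wd R) = p\<^sub>0"
      by (simp add: height_end_expand W_def)
    show "0 \<le> j" if "(x, j) \<in> set ?es" for x j
    proof (rule edges_expand_lower_bound[OF _ that])
      fix i assume "i \<le> length R"
      then have "i \<le> n" by (simp add: n_def W_def skeleton_def)
      then show "0 \<le> height_end \<theta> p\<^sub>0 (take i (skeleton R))"
        using ge_min height by (simp flip: W_def)
    qed
    show "j \<le> d" if "(Inl a, j) \<in> set ?es" for j
    proof -
      have "(a, j) \<in> set (edges \<theta> p\<^sub>0 W)"
        using that count_edges_expand[of \<theta> p\<^sub>0 wd R a j] by (metis W_def count_list_0_iff)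
      then obtain i where i: "i < n" "edges \<theta> p\<^sub>0 W ! i = (a, j)"
        by (auto simp: in_set_conv_nth length_edges n_def)
      then have "fst (W ! i) = a" "j = min (\<phi> i) (\<phi> (Suc i)) - \<phi> l"
        using edge by auto
      then show ?thesis
        using span[OF i(1)] span_a le_max[of i] le_max[of "Suc i"] i(1) by (auto simp: d_def min_def)
    qed
    show "count_list ?es (Inl a, d) = 1" "count_list ?es (Inl c, 0) = 1"
      using ct cb by (simp_all add: count_edges_expand W_def)
    show "0 < d" if "Inl a = Inl c"
    proof (rule ccontr)
      assume "\<not> 0 < d"
      \<comment> \<open>Letter \<open>k\<close>, of type \<open>a = c\<close>, would start at the
        minimum, where no letter of type \<open>c\<close> starts.\<close>
      then have "\<phi> (k - 1) = \<phi> l"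
        using ge_min[of "k - 1"] k by (simp add: d_def)
      then show False
        using after_bottom[of "k - 1"] k that by (simp add: a_def)
    qed
  qed
qed

section \<open>Universal properties\<close>

lemma hom_eq_on_generate:
  assumes "group G" "group T" "h \<in> hom G T" "h' \<in> hom G T" "S \<subseteq> carrier G"
    and "\<And>s. s \<in> S \<Longrightarrow> h s = h' s" and "g \<in> generate G S"
  shows "h g = h' g"
proof -
  interpret G: group G by fact
  interpret T: group T by fact
  interpret h: group_hom G T h by unfold_locales fact
  interpret h': group_hom G T h' by unfold_locales fact
  show ?thesis
    using assms(7)
  proof (induction rule: generate.induct)
    case (inv s)
    then show ?case using assms(5,6) by (simp add: subset_iff)
  next
    case (eng u v)
    then show ?case using G.generate_incl[OF assms(5)] by (simp add: subset_iff)
  qed (use assms(6) in auto)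
qed

lemma eval_word_in_generate:
  assumes "group G" "f ` X \<subseteq> S" "S \<subseteq> carrier G" "w \<in> lists (X \<times> UNIV)"
  shows "eval_word G f w \<in> generate G S"
proof -
  interpret group G by fact
  interpret subgroup "generate G S" G by (rule generate_is_subgroup[OF assms(3)])
  show ?thesis
    using assms(4)
  proof (induction w rule: list.induct)
    case (Cons l w)
    then have "f (fst l) \<in> S"
      using assms(2) by auto
    then have "f (fst l) \<in> generate G S"
      by (rule generate.incl)
    then show ?case
      using Cons by (cases l) auto
  qed (simp add: generate.one)
qed

lemma eval_word_map: "eval_word G f (map (map_prod g id) w) = eval_word G (f \<circ> g) w"
  by (induction w) auto

lemma eval_word_free_gen_single:
  assumes "group T" "f x \<in> carrier T"
  shows "eval_word T f (free_gen x) = f x"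
proof -
  interpret group T by fact
  show ?thesis using assms(2) by (simp add: free_gen_def)
qed

lemma generate_free_gen: "carrier (free_group X) = generate (free_group X) (free_gen ` X)"
proof
  interpret group "free_group X" by (rule group_free_group)
  have sub: "free_gen ` X \<subseteq> carrier (free_group X)"
    by (intro image_subsetI free_gen_closed)
  show "generate (free_group X) (free_gen ` X) \<subseteq> carrier (free_group X)"
    by (rule generate_incl[OF sub])
  show "carrier (free_group X) \<subseteq> generate (free_group X) (free_gen ` X)"
  proof
    fix w assume "w \<in> carrier (free_group X)"
    then show "w \<in> generate (free_group X) (free_gen ` X)"
      using eval_word_in_generate[OF is_group _ sub, of free_gen X w] eval_word_free_gen[of w X]
      by (simp add: free_group_def)
  qed
qed

lemma generate_free_product:
  assumes "group G" "group H"
  shows "carrier (free_product G H) =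
    generate (free_product G H) (fp_inl G ` carrier G \<union> fp_inr H ` carrier H)" (is "_ = generate ?P ?S")
proof
  interpret group ?P by (rule group_free_product[OF assms])
  have sub: "?S \<subseteq> carrier ?P"
    using fp_inl_mon[OF assms] fp_inr_mon[OF assms] by (auto simp: mon_def hom_def)
  show "generate ?P ?S \<subseteq> carrier ?P"
    by (rule generate_incl[OF sub])
  show "carrier ?P \<subseteq> generate ?P ?S"
  proof
    fix w assume "w \<in> carrier ?P"
    then show "w \<in> generate ?P ?S"
    proof (induction w)
      case Nil
      then show ?case using generate.one[of ?P ?S] by (simp add: free_product_def)
    next
      case (Cons l w)
      then have l: "l \<in> fp_letters G H" and w: "w \<in> carrier ?P"
        and alt: "alternating (l # w)"
        by (auto simp: free_product_def alternating_def successively_Cons)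
      have "[l] \<in> ?S"
        using l by (auto simp: fp_letters_def fp_inl_def fp_inr_def)
      moreover have "[l] \<otimes>\<^bsub>?P\<^esub> w = l # w"
        using alt by (cases w; cases l; cases "hd w") (auto simp: free_product_def alternating_def)
      ultimately show ?case
        using Cons.IH[OF w] by (metis generate.eng generate.incl)
    qed
  qed
qed

section \<open>Generators and relations of a one-relator presentation\<close>

definition presented_gen :: "'a set \<Rightarrow> 'a word \<Rightarrow> 'a \<Rightarrow> 'a word set" where
  "presented_gen X w x = quot_map (free_group X) (word_in_free_group X w) (free_gen x)"

context
  fixes X :: "'a set" and w :: "'a word"
  assumes w: "w \<in> lists (X \<times> UNIV)"
begin

lemma word_in_free_group_closed: "word_in_free_group X w \<in> carrier (free_group X)"
  unfolding word_in_free_group_def by (rule eval_word_closed[OF group_free_group free_gen_funcset w])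

lemma group_one_relator_presented: "group (one_relator_presented X w)"
  unfolding one_relator_presented_def
  by (rule group.group_add_relator[OF group_free_group word_in_free_group_closed])

lemma quot_map_presented_hom:
  "quot_map (free_group X) (word_in_free_group X w) \<in> hom (free_group X) (one_relator_presented X w)"
  unfolding one_relator_presented_def
  by (rule quot_map_hom[OF group_free_group word_in_free_group_closed])

lemma presented_gen_closed: "presented_gen X w \<in> X \<rightarrow> carrier (one_relator_presented X w)"
  using quot_map_presented_hom free_gen_closed by (fastforce simp: presented_gen_def hom_def)

lemma presented_relation:
  "eval_word (one_relator_presented X w) (presented_gen X w) w = \<one>\<^bsub>one_relator_presented X w\<^esub>"
proof -
  have "eval_word (one_relator_presented X w) (presented_gen X w) w =
      quot_map (free_group X) (word_in_free_group X w) (eval_word (free_group X) free_gen w)"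
    using hom_eval_word[OF group_free_group group_one_relator_presented quot_map_presented_hom
        free_gen_funcset w]
    by (simp add: presented_gen_def[abs_def] comp_def)
  then show ?thesis
    using quot_map_relator[OF group_free_group word_in_free_group_closed]
    by (simp add: one_relator_presented_def word_in_free_group_def)
qed

lemma generate_presented_gen:
  "carrier (one_relator_presented X w) = generate (one_relator_presented X w) (presented_gen X w ` X)"
proof -
  interpret q: group_hom "free_group X" "one_relator_presented X w" "quot_map (free_group X) (word_in_free_group X w)"
    using group_free_group group_one_relator_presented quot_map_presented_hom
    by (simp add: group_hom_def group_hom_axioms_def)
  have "carrier (one_relator_presented X w) =
      quot_map (free_group X) (word_in_free_group X w) ` generate (free_group X) (free_gen ` X)"
    using carrier_add_relator generate_free_gen by (metis one_relator_presented_def)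
  also have "\<dots> = generate (one_relator_presented X w)
      (quot_map (free_group X) (word_in_free_group X w) ` (free_gen ` X))"
    by (rule q.generate_img[symmetric]) (intro image_subsetI free_gen_closed)
  finally show ?thesis
    by (simp add: image_image presented_gen_def)
qed

lemma presented_universal:
  assumes T: "group T" and f: "f \<in> X \<rightarrow> carrier T" and rel: "eval_word T f w = \<one>\<^bsub>T\<^esub>"
  obtains F where "F \<in> hom (one_relator_presented X w) T" "\<And>x. x \<in> X \<Longrightarrow> F (presented_gen X w x) = f x"
proof -
  have hom: "eval_word T f \<in> hom (free_group X) T"
    by (rule free_group_universal[OF T f])
  have gen: "eval_word T f (free_gen x) = f x" if "x \<in> X" for x
    using f that by (intro eval_word_free_gen_single T) auto
  have "eval_word T f (word_in_free_group X w) = eval_word T (eval_word T f \<circ> free_gen) w"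
    unfolding word_in_free_group_def
    by (rule hom_eval_word[OF group_free_group T hom free_gen_funcset w])
  also have "\<dots> = eval_word T f w"
    using w gen by (intro eval_word_cong) auto
  finally obtain F where "F \<in> hom (one_relator_presented X w) T"
    "\<And>g. g \<in> carrier (free_group X) \<Longrightarrow>
      F (quot_map (free_group X) (word_in_free_group X w) g) = eval_word T f g"
    using add_relator_universal[OF group_free_group word_in_free_group_closed T hom] rel
    unfolding one_relator_presented_def by metis
  then show ?thesis
    using that gen free_gen_closed by (metis presented_gen_def)
qed

end

text \<open>One generator with trivial \<open>n\<close>-th power leaves finitely many elements.
  Exponent 1 serves for \<open>rel_group\<close>, larger ones for
  \<open>rel_power_group\<close>.\<close>

lemma residually_finite_cyclic:
  fixes n :: nat
  assumes "n > 0"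
  shows "residually_finite (one_relator_presented {z} (replicate n (z, True)))" (is "residually_finite ?K")
proof -
  have w: "replicate n (z, True) \<in> lists ({z} \<times> UNIV)"
    by auto
  interpret group ?K by (rule group_one_relator_presented[OF w])
  define g where "g = presented_gen {z} (replicate n (z, True)) z"
  have g: "g \<in> carrier ?K"
    using presented_gen_closed[OF w] by (auto simp: g_def)
  have "g [^]\<^bsub>?K\<^esub> n = \<one>\<^bsub>?K\<^esub>"
    using presented_relation[OF w] eval_word_replicate[OF is_group, of "presented_gen {z} (replicate n (z, True))" z n] g
    by (simp add: g_def)
  then have gn: "g [^]\<^bsub>?K\<^esub> (int n) = \<one>\<^bsub>?K\<^esub>"
    by (simp add: int_pow_int)
  have "carrier ?K \<subseteq> (\<lambda>k :: int. g [^]\<^bsub>?K\<^esub> k) ` {0..<int n}"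
  proof
    fix u assume "u \<in> carrier ?K"
    then obtain k :: int where k: "u = g [^]\<^bsub>?K\<^esub> k"
      using generate_presented_gen[OF w] generate_pow[OF g] by (auto simp: g_def)
    also have "g [^]\<^bsub>?K\<^esub> k = g [^]\<^bsub>?K\<^esub> (int n * (k div int n) + k mod int n)" by simp
    also have "\<dots> = (g [^]\<^bsub>?K\<^esub> int n) [^]\<^bsub>?K\<^esub> (k div int n) \<otimes>\<^bsub>?K\<^esub> g [^]\<^bsub>?K\<^esub> (k mod int n)"
      using g by (simp only: int_pow_mult int_pow_pow)
    finally have "u = g [^]\<^bsub>?K\<^esub> (k mod int n)"
      using g by (simp add: gn)
    moreover have "k mod int n \<in> {0..<int n}"
      using assms by simp
    ultimately show "u \<in> (\<lambda>k :: int. g [^]\<^bsub>?K\<^esub> k) ` {0..<int n}"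
      by (rule image_eqI)
  qed
  then show ?thesis
    using residually_finite_finite[OF is_group] finite_subset by blast
qed

section \<open>Transport of quotients along isomorphisms\<close>

lemma iso_by_inverse:
  assumes "F \<in> hom G H" "F' \<in> hom H G"
    and "\<And>g. g \<in> carrier G \<Longrightarrow> F' (F g) = g" "\<And>h. h \<in> carrier H \<Longrightarrow> F (F' h) = h"
  shows "F \<in> iso G H"
  using assms by (intro isoI bij_betw_byWitness[where f' = F']) (auto simp: hom_def)

lemma add_relator_iso:
  assumes G: "group G" and H: "group H" and \<eta>: "\<eta> \<in> iso G H" and r: "r \<in> carrier G"
  shows "add_relator G r \<cong> add_relator H (\<eta> r)"
proof -
  define \<eta>' where "\<eta>' = inv_into (carrier G) \<eta>"
  have \<eta>': "\<eta>' \<in> iso H G" unfolding \<eta>'_def by (rule group.iso_set_sym[OF G \<eta>])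
  have inv: "\<eta>' (\<eta> g) = g" "\<eta> (\<eta>' h) = h" if "g \<in> carrier G" "h \<in> carrier H" for g h
    using \<eta> that by (auto simp: \<eta>'_def iso_def bij_betw_def f_inv_into_f)
  have hom: "\<eta> \<in> hom G H" "\<eta>' \<in> hom H G"
    using \<eta> \<eta>' by (auto simp: iso_def)
  have s: "\<eta> r \<in> carrier H" using hom r by (auto simp: hom_def)
  obtain F where F: "F \<in> hom (add_relator G r) (add_relator H (\<eta> r))"
    "\<And>g. g \<in> carrier G \<Longrightarrow> F (quot_map G r g) = (quot_map H (\<eta> r) \<circ> \<eta>) g"
    using add_relator_universal[OF G r group.group_add_relator[OF H s]
        Group.hom_compose[OF hom(1) quot_map_hom[OF H s]]] quot_map_relator[OF H s]
    by (metis comp_apply)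
  obtain F' where F': "F' \<in> hom (add_relator H (\<eta> r)) (add_relator G r)"
    "\<And>h. h \<in> carrier H \<Longrightarrow> F' (quot_map H (\<eta> r) h) = (quot_map G r \<circ> \<eta>') h"
    using add_relator_universal[OF H s group.group_add_relator[OF G r]
        Group.hom_compose[OF hom(2) quot_map_hom[OF G r]]] quot_map_relator[OF G r] inv(1)[OF r s]
    by (metis comp_apply)
  have "F \<in> iso (add_relator G r) (add_relator H (\<eta> r))"
  proof (rule iso_by_inverse[OF F(1) F'(1)])
    fix g assume "g \<in> carrier (add_relator G r)"
    then obtain g0 where "g0 \<in> carrier G" "g = quot_map G r g0" by (auto simp: carrier_add_relator)
    then show "F' (F g) = g" using F(2) F'(2) inv(1)[OF _ s] hom by (auto simp: hom_def Pi_iff)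
  next
    fix h assume "h \<in> carrier (add_relator H (\<eta> r))"
    then obtain h0 where "h0 \<in> carrier H" "h = quot_map H (\<eta> r) h0" by (auto simp: carrier_add_relator)
    then show "F (F' h) = h" using F(2) F'(2) inv(2)[OF r] hom by (auto simp: hom_def Pi_iff)
  qed
  then show ?thesis by (auto simp: is_iso_def)
qed

section \<open>Free coefficient groups\<close>

text \<open>Freeness in coordinates: with \<open>wd\<close> a coefficient is spelled out in the
  basis, which turns a relator over \<open>\<Phi>\<close> into a plain word.\<close>

locale free_coefficients = group \<Phi> for \<Phi> :: "('h, 'm) monoid_scheme" (structure) +
  fixes B :: "'b set" and wd :: "'h \<Rightarrow> 'b word" and y :: "'b \<Rightarrow> 'h"
  assumes y: "y \<in> B \<rightarrow> carrier \<Phi>" and wd_hom: "wd \<in> hom \<Phi> (free_group B)"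
    and wd_y: "\<And>b. b \<in> B \<Longrightarrow> wd (y b) = free_gen b"
    and eval_wd: "\<And>h. h \<in> carrier \<Phi> \<Longrightarrow> eval_word \<Phi> y (wd h) = h"
begin

lemma wd_lists: "h \<in> carrier \<Phi> \<Longrightarrow> wd h \<in> lists (B \<times> UNIV)"
  using wd_hom by (auto simp: hom_def free_group_def)

lemma fp_inl_hom: "fp_inl \<Phi> \<in> hom \<Phi> (ambient A \<Phi>)"
  using fp_inl_mon[OF is_group group_free_group[of A]] by (simp add: mon_def ambient_def)

definition letter_val :: "'a set \<Rightarrow> 'a + 'b \<Rightarrow> ('h + 'a word) list" where
  "letter_val A = case_sum (ambient_gen A) (\<lambda>b. fp_inl \<Phi> (y b))"

lemma letter_val_closed: "letter_val A \<in> Inl ` A \<union> Inr ` B \<rightarrow> carrier (ambient A \<Phi>)"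
  using ambient_gen_closed[OF is_group] fp_inl_hom y by (fastforce simp: letter_val_def hom_def)

lemma fp_inl_eval:
  assumes "h \<in> carrier \<Phi>"
  shows "fp_inl \<Phi> h = eval_word (ambient A \<Phi>) (\<lambda>b. fp_inl \<Phi> (y b)) (wd h)"
  using hom_eval_word[OF is_group group_ambient[OF is_group] fp_inl_hom y wd_lists[OF assms]]
    eval_wd[OF assms] by (simp add: comp_def)

text \<open>Both factors are free, so a map on the letters extends to each of them and then to their
  free product.\<close>

lemma ambient_universal:
  assumes T: "group T" and f: "f \<in> Inl ` A \<union> Inr ` B \<rightarrow> carrier T"
  obtains F where "F \<in> hom (ambient A \<Phi>) T" "\<And>x. x \<in> Inl ` A \<union> Inr ` B \<Longrightarrow> F (letter_val A x) = f x"
proof -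
  have f': "f \<circ> Inr \<in> B \<rightarrow> carrier T" "f \<circ> Inl \<in> A \<rightarrow> carrier T" using f by auto
  have h1: "eval_word T (f \<circ> Inr) \<circ> wd \<in> hom \<Phi> T"
    by (rule Group.hom_compose[OF wd_hom free_group_universal[OF T f'(1)]])
  have h2: "eval_word T (f \<circ> Inl) \<in> hom (free_group A) T"
    by (rule free_group_universal[OF T f'(2)])
  note U = free_product_universal[OF is_group group_free_group[of A] T h1 h2, folded ambient_def]
  show ?thesis
  proof (rule that[OF U(1)], safe)
    fix x assume "x \<in> A"
    then show "foldr (\<lambda>l a. case_sum (eval_word T (f \<circ> Inr) \<circ> wd) (eval_word T (f \<circ> Inl)) l \<otimes>\<^bsub>T\<^esub> a)
        (letter_val A (Inl x)) \<one>\<^bsub>T\<^esub> = f (Inl x)"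
      using U(3)[OF free_gen_closed, of x] eval_word_free_gen_single[OF T, of "f \<circ> Inl" x] funcset_mem[OF f, of "Inl x"]
      by (auto simp: letter_val_def ambient_gen_def)
  next
    fix b assume "b \<in> B"
    then show "foldr (\<lambda>l a. case_sum (eval_word T (f \<circ> Inr) \<circ> wd) (eval_word T (f \<circ> Inl)) l \<otimes>\<^bsub>T\<^esub> a)
        (letter_val A (Inr b)) \<one>\<^bsub>T\<^esub> = f (Inr b)"
      using U(2)[of "y b"] eval_word_free_gen_single[OF T, of "f \<circ> Inr" b] funcset_mem[OF f, of "Inr b"] y wd_y[of b]
      by (auto simp: letter_val_def)
  qed
qed

lemma generate_letter_val:
  "carrier (ambient A \<Phi>) = generate (ambient A \<Phi>) (letter_val A ` (Inl ` A \<union> Inr ` B))" (is "_ = ?U")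
proof
  interpret A: group "ambient A \<Phi>" by (rule group_ambient[OF is_group])
  have sub: "letter_val A ` (Inl ` A \<union> Inr ` B) \<subseteq> carrier (ambient A \<Phi>)"
    using letter_val_closed by blast
  show "?U \<subseteq> carrier (ambient A \<Phi>)"
    by (rule A.generate_incl[OF sub])
  have "fp_inl \<Phi> h \<in> ?U" if "h \<in> carrier \<Phi>" for h
    unfolding fp_inl_eval[OF that, of A]
    by (rule eval_word_in_generate[OF A.is_group _ sub wd_lists[OF that]]) (force simp: letter_val_def)
  moreover have "fp_inr (free_group A) w \<in> ?U" if w: "w \<in> carrier (free_group A)" for w
  proof -
    have "fp_inr (free_group A) \<in> hom (free_group A) (ambient A \<Phi>)"
      using fp_inr_mon[OF is_group group_free_group[of A]] by (simp add: mon_def ambient_def)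
    then have "fp_inr (free_group A) w = eval_word (ambient A \<Phi>) (fp_inr (free_group A) \<circ> free_gen) w"
      using w by (rule hom_free_group_eq[OF A.is_group])
    also have "\<dots> \<in> ?U"
      using w by (intro eval_word_in_generate[OF A.is_group _ sub, of _ A])
        (force simp: letter_val_def ambient_gen_def free_group_def)+
    finally show ?thesis .
  qed
  ultimately have "generate (ambient A \<Phi>) (fp_inl \<Phi> ` carrier \<Phi> \<union> fp_inr (free_group A) ` carrier (free_group A)) \<subseteq> ?U"
    by (intro A.generate_subgroup_incl A.generate_is_subgroup[OF sub]) auto
  then show "carrier (ambient A \<Phi>) \<subseteq> ?U"
    using generate_free_product[OF is_group group_free_group, of A] by (simp add: ambient_def)
qed

lemma rel_element_expand:
  assumes "R \<in> lists ((A' \<times> UNIV) \<times> carrier \<Phi>)" "A' \<subseteq> A"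
  shows "rel_element A \<Phi> R = eval_word (ambient A \<Phi>) (letter_val A) (expand wd R)"
  using assms(1)
proof (induction R rule: list.induct)
  case Nil
  then show ?case by (simp add: rel_element_def)
next
  case (Cons lh R)
  obtain x b h where lh: "lh = ((x, b), h)" by (cases lh) auto
  interpret A: group "ambient A \<Phi>" by (rule group_ambient[OF is_group])
  have h: "h \<in> carrier \<Phi>" "x \<in> A" and R: "R \<in> lists ((A' \<times> UNIV) \<times> carrier \<Phi>)"
    using Cons.prems lh assms(2) by auto
  let ?L = "lists ((Inl ` A \<union> Inr ` B) \<times> UNIV) :: ('a + 'b) word set"
  have "R \<in> lists ((A \<times> UNIV) \<times> carrier \<Phi>)"
    using R assms(2) by auto
  then have L: "expand wd R \<in> ?L"
    by (rule expand_in_lists) (rule wd_lists)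
  have L': "[(Inl x, b)] \<in> ?L" "map (map_prod Inr id) (wd h) \<in> ?L"
    using h wd_lists[OF h(1)] by fastforce+
  have "rel_element A \<Phi> (lh # R) = eval_word (ambient A \<Phi>) (ambient_gen A) [(x, b)] \<otimes>\<^bsub>ambient A \<Phi>\<^esub>
      (fp_inl \<Phi> h \<otimes>\<^bsub>ambient A \<Phi>\<^esub> rel_element A \<Phi> R)"
    by (simp add: rel_element_def lh)
  also have "eval_word (ambient A \<Phi>) (ambient_gen A) [(x, b)] =
      eval_word (ambient A \<Phi>) (letter_val A) [(Inl x, b)]"
    by (simp add: letter_val_def)
  also have "fp_inl \<Phi> h = eval_word (ambient A \<Phi>) (letter_val A) (map (map_prod Inr id) (wd h))"
    using fp_inl_eval[OF h(1)] by (simp add: eval_word_map letter_val_def comp_def)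
  also have "rel_element A \<Phi> R = eval_word (ambient A \<Phi>) (letter_val A) (expand wd R)"
    by (rule Cons.IH[OF R])
  finally show ?case
    unfolding lh expand_Cons using L L'
    by (simp only: eval_word_append[OF A.is_group letter_val_closed] append_in_lists_conv)
qed

text \<open>The injection \<open>j\<close> will realise the basis in the element type that \<^const>\<open>one_relator_group\<close>
  prescribes.\<close>

lemma ambient_free:
  fixes A :: "'a set" and j :: "'a + 'b \<Rightarrow> 'c"
  assumes j: "inj j"
  obtains \<eta> where "\<eta> \<in> iso (ambient A \<Phi>) (free_group (j ` (Inl ` A \<union> Inr ` B)))"
proof -
  let ?X = "Inl ` A \<union> Inr ` B :: ('a + 'b) set"
  have grp: "group (ambient A \<Phi>)" "group (free_group (j ` ?X))"
    by (rule group_ambient[OF is_group], rule group_free_group)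
  have "free_gen \<circ> j \<in> ?X \<rightarrow> carrier (free_group (j ` ?X))"
    by (auto intro!: free_gen_closed)
  then obtain F where F: "F \<in> hom (ambient A \<Phi>) (free_group (j ` ?X))"
    "\<And>x. x \<in> ?X \<Longrightarrow> F (letter_val A x) = (free_gen \<circ> j) x"
    using ambient_universal[OF grp(2)] by metis
  define k where "k = letter_val A \<circ> inv_into UNIV j"
  have k: "k \<in> j ` ?X \<rightarrow> carrier (ambient A \<Phi>)"
    using letter_val_closed j by (auto simp: k_def Pi_iff inv_f_f)
  define F' where "F' = eval_word (ambient A \<Phi>) k"
  have F': "F' \<in> hom (free_group (j ` ?X)) (ambient A \<Phi>)"
    unfolding F'_def by (rule free_group_universal[OF grp(1) k])
  have F'_gen: "F' (free_gen (j x)) = letter_val A x" if "x \<in> ?X" for x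
    using eval_word_free_gen_single[OF grp(1), of k "j x"] k that j
    by (auto simp: F'_def k_def Pi_iff inv_f_f)
  have id: "(\<lambda>u. u) \<in> hom G G" for G :: "('e, 'f) monoid_scheme" by (simp add: hom_def)
  have "F \<in> iso (ambient A \<Phi>) (free_group (j ` ?X))"
  proof (rule iso_by_inverse[OF F(1) F'])
    fix g assume g: "g \<in> carrier (ambient A \<Phi>)"
    have "(F' \<circ> F) g = (\<lambda>u. u) g"
    proof (rule hom_eq_on_generate[OF grp(1,1) Group.hom_compose[OF F(1) F'] id])
      show "letter_val A ` ?X \<subseteq> carrier (ambient A \<Phi>)"
        using letter_val_closed by blast
      show "g \<in> generate (ambient A \<Phi>) (letter_val A ` ?X)"
        by (simp only: g flip: generate_letter_val)
    qed (use F(2) F'_gen in \<open>auto simp del: image_Un\<close>)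
    then show "F' (F g) = g" by simp
  next
    fix g assume g: "g \<in> carrier (free_group (j ` ?X))"
    have "(F \<circ> F') g = (\<lambda>u. u) g"
    proof (rule hom_eq_on_generate[OF grp(2,2) Group.hom_compose[OF F' F(1)] id])
      show "free_gen ` j ` ?X \<subseteq> carrier (free_group (j ` ?X))"
        by (intro image_subsetI free_gen_closed)
      show "g \<in> generate (free_group (j ` ?X)) (free_gen ` j ` ?X)"
        using g generate_free_gen by blast
    qed (use F(2) F'_gen in \<open>auto simp del: image_Un\<close>)
    then show "F (F' g) = g" by simp
  qed
  then show ?thesis by (rule that)
qed

end

lemma is_free_group_coefficients:
  fixes \<Phi> :: "('h, 'm) monoid_scheme"
  assumes "is_free_group \<Phi>"
  obtains B :: "'h set" and wd y where "free_coefficients \<Phi> B wd y"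
proof -
  interpret group \<Phi> using assms by (simp add: is_free_group_def)
  obtain B :: "'h set" and wd where wd: "wd \<in> iso \<Phi> (free_group B)"
    using assms by (auto simp: is_free_group_def is_iso_def)
  define i where "i = inv_into (carrier \<Phi>) wd"
  have i: "i \<in> iso (free_group B) \<Phi>" unfolding i_def by (rule iso_set_sym[OF wd])
  have "free_coefficients \<Phi> B wd (i \<circ> free_gen)"
  proof unfold_locales
    show "wd \<in> hom \<Phi> (free_group B)" using wd by (simp add: iso_def)
    show "i \<circ> free_gen \<in> B \<rightarrow> carrier \<Phi>"
      using i free_gen_closed by (fastforce simp: iso_def hom_def)
    show "wd ((i \<circ> free_gen) b) = free_gen b" if "b \<in> B" for b
      using wd free_gen_closed[OF that] by (simp add: i_def iso_def bij_betw_def f_inv_into_f)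
    show "eval_word \<Phi> (i \<circ> free_gen) (wd h) = h" if "h \<in> carrier \<Phi>" for h
    proof -
      have "wd h \<in> carrier (free_group B)" using wd that by (auto simp: iso_def hom_def)
      then have "i (wd h) = eval_word \<Phi> (i \<circ> free_gen) (wd h)"
        using i by (intro hom_free_group_eq[OF is_group]) (simp_all add: iso_def)
      then show ?thesis using wd that by (simp add: i_def iso_def bij_betw_def)
    qed
  qed
  then show ?thesis by (rule that)
qed

section \<open>Substituting the relator\<close>

text \<open>\<open>z\<close> may lie in \<open>A\<close>: inside \<open>S\<close> it is redirected
  to the relator by \<open>subst_val\<close>, while \<open>\<kappa> z\<close> lives in
  \<open>K\<close>. The case of powers relies on this, since \<open>A\<close> may exhaust its
  type.\<close>

locale relator_substitution = free_coefficients \<Phi> B wd y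
  for \<Phi> :: "('h, 'm) monoid_scheme" and B :: "'b set" and wd y +
  fixes A Y :: "'a set" and z :: 'a and R :: "('a, 'h) rel_expr" and S :: "'a word"
  assumes R: "R \<in> lists ((A \<times> UNIV) \<times> carrier \<Phi>)"
    and S: "S \<in> lists (insert z Y \<times> UNIV)"
    and z: "z \<notin> Y" and disjoint: "A \<inter> Y = {}"
begin

abbreviation "amb \<equiv> ambient (A \<union> Y) \<Phi>"
abbreviation "K \<equiv> one_relator_presented (insert z Y) S"
abbreviation "\<kappa> \<equiv> presented_gen (insert z Y) S"

definition subst_val :: "'a \<Rightarrow> ('h + 'a word) list" where
  "subst_val = (ambient_gen (A \<union> Y))(z := rel_element (A \<union> Y) \<Phi> R)"

definition relator :: "('h + 'a word) list" where
  "relator = eval_word amb subst_val S"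

definition \<pi> :: "('h + 'a word) list \<Rightarrow> ('h + 'a word) list set" where
  "\<pi> = quot_map amb relator"

abbreviation Q :: "('h + 'a word) list set monoid" where
  "Q \<equiv> add_relator amb relator"

lemma rel_subst_group_eq: "rel_subst_group A Y z \<Phi> R S = Q"
  by (simp add: rel_subst_group_def rel_subst_element_def relator_def subst_val_def)

lemma group_amb: "group amb"
  by (rule group_ambient[OF is_group])

lemma group_K: "group K"
  by (rule group_one_relator_presented[OF S])

lemma rel_element_eq: "rel_element (A \<union> Y) \<Phi> R = eval_word amb (letter_val (A \<union> Y)) (expand wd R)"
  by (rule rel_element_expand[OF R]) simp

abbreviation letters :: "('a + 'b) set" where
  "letters \<equiv> Inl ` A \<union> Inr ` B"

lemma expand_letters: "expand wd R \<in> lists (letters \<times> UNIV)"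
  by (rule expand_in_lists[OF R wd_lists])

lemma expand_letters': "expand wd R \<in> lists ((Inl ` (A \<union> Y) \<union> Inr ` B) \<times> UNIV)"
  using expand_letters by auto

lemma rel_element_amb: "rel_element (A \<union> Y) \<Phi> R \<in> carrier amb"
  unfolding rel_element_eq by (rule eval_word_closed[OF group_amb letter_val_closed expand_letters'])

lemma subst_val_closed: "subst_val \<in> insert z Y \<rightarrow> carrier amb"
  using rel_element_amb ambient_gen_closed[OF is_group, of _ "A \<union> Y"] by (auto simp: subst_val_def)

lemma relator_closed: "relator \<in> carrier amb"
  unfolding relator_def by (rule eval_word_closed[OF group_amb subst_val_closed S])

lemma group_Q: "group Q"
  by (rule group.group_add_relator[OF group_amb relator_closed])

lemma pi_hom: "\<pi> \<in> hom amb Q"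
  unfolding \<pi>_def by (rule quot_map_hom[OF group_amb relator_closed])

definition \<iota> :: "'a word set \<Rightarrow> ('h + 'a word) list set" where
  "\<iota> = (SOME F. F \<in> hom K Q \<and> (\<forall>c \<in> insert z Y. F (\<kappa> c) = \<pi> (subst_val c)))"

text \<open>Substituting into \<open>S\<close> gives the relator of \<open>Q\<close>, so von Dyck's
  theorem yields the homomorphism.\<close>

lemma iota: "\<iota> \<in> hom K Q" "\<And>c. c \<in> insert z Y \<Longrightarrow> \<iota> (\<kappa> c) = \<pi> (subst_val c)"
proof -
  have closed: "\<pi> \<circ> subst_val \<in> insert z Y \<rightarrow> carrier Q"
    using subst_val_closed pi_hom by (auto simp: hom_def Pi_iff)
  have "eval_word Q (\<pi> \<circ> subst_val) S = \<pi> relator"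
    using hom_eval_word[OF group_amb group_Q pi_hom subst_val_closed S] by (simp only: relator_def)
  then have rel: "eval_word Q (\<pi> \<circ> subst_val) S = \<one>\<^bsub>Q\<^esub>"
    using quot_map_relator[OF group_amb relator_closed] by (simp add: \<pi>_def)
  have "\<exists>F. F \<in> hom K Q \<and> (\<forall>c \<in> insert z Y. F (\<kappa> c) = \<pi> (subst_val c))"
    by (rule presented_universal[OF S group_Q closed rel]) auto
  then have "\<iota> \<in> hom K Q \<and> (\<forall>c \<in> insert z Y. \<iota> (\<kappa> c) = \<pi> (subst_val c))"
    unfolding \<iota>_def by (rule someI_ex)
  then show "\<iota> \<in> hom K Q" "\<And>c. c \<in> insert z Y \<Longrightarrow> \<iota> (\<kappa> c) = \<pi> (subst_val c)"
    by blast+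
qed

definition \<xi> :: "'a + 'b \<Rightarrow> ('h + 'a word) list set" where
  "\<xi> x = \<pi> (letter_val (A \<union> Y) x)"

lemma xi_closed: "\<xi> \<in> letters \<rightarrow> carrier Q"
proof
  fix x assume "x \<in> letters"
  then have "letter_val (A \<union> Y) x \<in> carrier amb"
    by (intro funcset_mem[OF letter_val_closed]) auto
  then show "\<xi> x \<in> carrier Q"
    using pi_hom by (auto simp: \<xi>_def hom_def)
qed

lemma eval_expand: "eval_word Q \<xi> (expand wd R) = \<iota> (\<kappa> z)"
proof -
  have "\<pi> (rel_element (A \<union> Y) \<Phi> R) = eval_word Q (\<pi> \<circ> letter_val (A \<union> Y)) (expand wd R)"
    unfolding rel_element_eq
    by (rule hom_eval_word[OF group_amb group_Q pi_hom letter_val_closed expand_letters'])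
  then show ?thesis
    using iota(2)[of z] by (simp add: subst_val_def \<xi>_def[abs_def] comp_def)
qed

lemma generate_Q: "carrier Q = generate Q (\<iota> ` carrier K \<union> \<xi> ` letters)"
proof
  interpret q: group_hom amb Q \<pi>
    using group_amb group_Q pi_hom by (simp add: group_hom_def group_hom_axioms_def)
  let ?L = "Inl ` (A \<union> Y) \<union> Inr ` B :: ('a + 'b) set"
  have sub: "\<iota> ` carrier K \<union> \<xi> ` letters \<subseteq> carrier Q"
    using iota(1) xi_closed by (auto simp: hom_def Pi_iff)
  show "generate Q (\<iota> ` carrier K \<union> \<xi> ` letters) \<subseteq> carrier Q"
    by (rule q.H.generate_incl[OF sub])
  have "\<pi> ` letter_val (A \<union> Y) ` ?L \<subseteq> \<iota> ` carrier K \<union> \<xi> ` letters"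
  proof
    fix u assume "u \<in> \<pi> ` letter_val (A \<union> Y) ` ?L"
    then obtain x where x: "x \<in> ?L" "u = \<xi> x" by (auto simp: \<xi>_def)
    show "u \<in> \<iota> ` carrier K \<union> \<xi> ` letters"
    proof (cases "x \<in> letters")
      case False
      then obtain v where v: "x = Inl v" "v \<in> Y" using x by auto
      then have "u = \<iota> (\<kappa> v)"
        using iota(2)[of v] z x by (auto simp: \<xi>_def subst_val_def letter_val_def)
      moreover have "\<kappa> v \<in> carrier K"
        using funcset_mem[OF presented_gen_closed[OF S]] v by auto
      ultimately show ?thesis by blast
    qed (use x in blast)
  qed
  then have "generate Q (\<pi> ` letter_val (A \<union> Y) ` ?L) \<subseteq> generate Q (\<iota> ` carrier K \<union> \<xi> ` letters)"
    by (rule q.H.mono_generate)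
  moreover have "carrier Q = generate Q (\<pi> ` letter_val (A \<union> Y) ` ?L)"
  proof -
    have "letter_val (A \<union> Y) ` ?L \<subseteq> carrier amb"
      using letter_val_closed by blast
    then have "generate Q (\<pi> ` letter_val (A \<union> Y) ` ?L) = \<pi> ` generate amb (letter_val (A \<union> Y) ` ?L)"
      by (rule q.generate_img)
    also have "\<dots> = carrier Q"
      by (simp only: carrier_add_relator \<pi>_def flip: generate_letter_val)
    finally show ?thesis ..
  qed
  ultimately show "carrier Q \<subseteq> generate Q (\<iota> ` carrier K \<union> \<xi> ` letters)"
    by simp
qed

text \<open>Seen over \<open>K\<close>, the group \<open>Q\<close> is the quotient of the free
  product of \<open>K\<close> and the free group on \<open>letters\<close> by the one relation
  equating the expanded \<open>R\<close> with \<open>\<kappa> z\<close>. This is its universal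
  property, which supplies the homomorphisms that the representations above call for.\<close>

lemma Q_extension:
  assumes T: "group T" and \<rho>: "\<rho> \<in> hom K T" and f: "\<And>x. f x \<in> carrier T"
    and rel: "eval_word T f (expand wd R) = \<rho> (\<kappa> z)"
  obtains F where "F \<in> hom Q T" "\<And>k. k \<in> carrier K \<Longrightarrow> F (\<iota> k) = \<rho> k"
    "\<And>x. x \<in> letters \<Longrightarrow> F (\<xi> x) = f x"
proof -
  let ?L = "Inl ` (A \<union> Y) \<union> Inr ` B :: ('a + 'b) set"
  \<comment> \<open>Letters of \<open>Y\<close> come from \<open>K\<close> and must follow
    \<open>\<rho>\<close>; as \<open>A\<close> and \<open>Y\<close> are disjoint, the two
    prescriptions do not collide.\<close>
  define g where "g x = (case x of Inl v \<Rightarrow> if v \<in> A then f x else \<rho> (\<kappa> v) | Inr b \<Rightarrow> f x)" for x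
  have kappa: "\<kappa> c \<in> carrier K" if "c \<in> insert z Y" for c
    using funcset_mem[OF presented_gen_closed[OF S] that] .
  have "g \<in> ?L \<rightarrow> carrier T"
    using f kappa \<rho> by (auto simp: g_def hom_def)
  then obtain F0 where F0: "F0 \<in> hom amb T" "\<And>x. x \<in> ?L \<Longrightarrow> F0 (letter_val (A \<union> Y) x) = g x"
    using ambient_universal[OF T] by metis
  have "F0 (rel_element (A \<union> Y) \<Phi> R) = eval_word T (F0 \<circ> letter_val (A \<union> Y)) (expand wd R)"
    unfolding rel_element_eq by (rule hom_eval_word[OF group_amb T F0(1) letter_val_closed expand_letters'])
  also have "\<dots> = eval_word T f (expand wd R)"
    using F0(2) expand_letters by (intro eval_word_cong) (force simp: g_def)
  finally have F0_R: "F0 (rel_element (A \<union> Y) \<Phi> R) = \<rho> (\<kappa> z)"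
    using rel by simp
  have F0_subst: "F0 (subst_val c) = \<rho> (\<kappa> c)" if "c \<in> insert z Y" for c
  proof (cases "c = z")
    case False
    then have "c \<in> Y" "c \<notin> A" using that disjoint by auto
    then show ?thesis
      using F0(2)[of "Inl c"] False by (simp add: subst_val_def letter_val_def g_def)
  qed (simp add: subst_val_def F0_R)
  have "F0 relator = eval_word T (F0 \<circ> subst_val) S"
    unfolding relator_def by (rule hom_eval_word[OF group_amb T F0(1) subst_val_closed S])
  also have "\<dots> = eval_word T (\<rho> \<circ> \<kappa>) S"
    using F0_subst S by (intro eval_word_cong) force
  also have "\<dots> = \<rho> (eval_word K \<kappa> S)"
    by (rule hom_eval_word[OF group_K T \<rho> presented_gen_closed[OF S] S, symmetric])
  also have "\<dots> = \<one>\<^bsub>T\<^esub>"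
    using hom_one[OF \<rho> group_K T] by (simp only: presented_relation[OF S])
  finally obtain F where F: "F \<in> hom Q T" "\<And>g. g \<in> carrier amb \<Longrightarrow> F (\<pi> g) = F0 g"
    using add_relator_universal[OF group_amb relator_closed T F0(1)] unfolding \<pi>_def by metis
  have "(F \<circ> \<iota>) k = \<rho> k" if "k \<in> carrier K" for k
  proof (rule hom_eq_on_generate[OF group_K T Group.hom_compose[OF iota(1) F(1)] \<rho>])
    show "\<kappa> ` insert z Y \<subseteq> carrier K" using kappa by blast
    show "k \<in> generate K (\<kappa> ` insert z Y)" using that generate_presented_gen[OF S] by blast
    fix u assume "u \<in> \<kappa> ` insert z Y"
    then obtain c where c: "c \<in> insert z Y" "u = \<kappa> c" by blast
    then have "subst_val c \<in> carrier amb" using funcset_mem[OF subst_val_closed] by blast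
    then show "(F \<circ> \<iota>) u = \<rho> u"
      using iota(2)[OF c(1)] F(2) F0_subst[OF c(1)] c(2) by simp
  qed
  moreover have "F (\<xi> x) = f x" if "x \<in> letters" for x
  proof -
    have "x \<in> ?L" using that by auto
    then have "F (\<xi> x) = g x"
      using F(2)[OF funcset_mem[OF letter_val_closed]] F0(2) by (simp only: \<xi>_def)
    then show ?thesis using that by (auto simp: g_def)
  qed
  ultimately show ?thesis
    using that[OF F(1)] by simp
qed

section \<open>The quotient as a one-relator group, and its residual finiteness\<close>

lemma one_relator_group_Q:
  assumes j: "inj (j :: 'a + 'b \<Rightarrow> ('h + 'a word) list set)"
  shows "one_relator_group Q"
proof -
  obtain \<eta> where \<eta>: "\<eta> \<in> iso amb (free_group (j ` (Inl ` (A \<union> Y) \<union> Inr ` B)))" (is "_ \<in> iso _ (free_group ?X)")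
    by (rule ambient_free[OF j])
  have "\<eta> relator \<in> carrier (free_group ?X)"
    using \<eta> relator_closed by (auto simp: iso_def hom_def)
  then have "word_in_free_group ?X (\<eta> relator) = \<eta> relator" "\<eta> relator \<in> lists (?X \<times> UNIV)"
    unfolding word_in_free_group_def by (rule eval_word_free_gen, simp add: free_group_def)
  moreover from this have "Q \<cong> one_relator_presented ?X (\<eta> relator)"
    using add_relator_iso[OF group_amb group_free_group \<eta> relator_closed]
    by (simp add: one_relator_presented_def)
  ultimately show ?thesis
    using group_Q unfolding one_relator_group_def by blast
qed

lemma relative_quotient_Q:
  assumes "relator_path letters \<theta> (expand wd R) p\<^sub>0 a c d"
  shows "relative_quotient letters \<theta> (expand wd R) p\<^sub>0 a c d K Q \<iota> \<xi> (\<kappa> z)"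
proof -
  interpret relator_path letters \<theta> "expand wd R" p\<^sub>0 a c d by fact
  interpret K: group K by (rule group_K)
  interpret Q: group Q by (rule group_Q)
  show ?thesis
    by unfold_locales
      (use iota(1) xi_closed eval_expand generate_Q funcset_mem[OF presented_gen_closed[OF S]] in auto)
qed

lemma residually_finite_Q_iff:
  assumes "unique_max_min A (skeleton R)"
  shows "residually_finite Q \<longleftrightarrow> residually_finite K"
proof -
  obtain \<theta> p\<^sub>0 a c d where path: "relator_path letters \<theta> (expand wd R) p\<^sub>0 a c d"
    by (rule unique_max_min_relator_path[OF assms R wd_lists])
  interpret rq: relative_quotient letters \<theta> "expand wd R" p\<^sub>0 a c d K Q \<iota> \<xi> "\<kappa> z"
    by (rule relative_quotient_Q[OF path])
  show ?thesis
  proof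
    assume rf: "residually_finite Q"
    show "residually_finite K"
    proof (rule residually_finite_inj_hom[OF group_K rf iota(1)])
      fix k assume k: "k \<in> carrier K" "k \<noteq> \<one>\<^bsub>K\<^esub>"
      obtain U :: "(int \<times> 'a word set) set" and \<rho> f where U: "\<rho> \<in> hom K (perm_group U)"
        "\<And>x. f x permutes U" "eval_word (perm_group U) f (expand wd R) = \<rho> (\<kappa> z)" "\<rho> k \<noteq> id"
        by (rule rq.coefficients_embed[OF group_K rq.zeta k]) (rule that)
      obtain F where F: "F \<in> hom Q (perm_group U)" "\<And>k. k \<in> carrier K \<Longrightarrow> F (\<iota> k) = \<rho> k"
        using Q_extension[OF group_perm_group U(1) _ U(3)] U(2) by (metis carrier_perm_group)
      show "\<iota> k \<noteq> \<one>\<^bsub>Q\<^esub>"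
        using hom_one[OF F(1) group_Q group_perm_group] F(2)[OF k(1)] U(4) by auto
    qed
  next
    assume rf: "residually_finite K"
    show "residually_finite Q"
    proof (rule residually_finiteI[OF group_Q])
      fix g assume g: "g \<in> carrier Q" "g \<noteq> \<one>\<^bsub>Q\<^esub>"
      obtain U :: "(int \<times> nat \<times> 'a word set set) set" and \<rho> f where U: "finite U"
        "\<rho> \<in> hom K (perm_group U)" "\<And>x. f x permutes U"
        "eval_word (perm_group U) f (expand wd R) = \<rho> (\<kappa> z)"
        "\<forall>F \<in> hom Q (perm_group U). (\<forall>k \<in> carrier K. F (\<iota> k) = \<rho> k) \<longrightarrow>
          (\<forall>x \<in> letters. F (\<xi> x) = f x) \<longrightarrow> F g \<noteq> id"
        by (rule rq.separating_representation[OF rf g]) (rule that)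
      obtain F where F: "F \<in> hom Q (perm_group U)" "\<And>k. k \<in> carrier K \<Longrightarrow> F (\<iota> k) = \<rho> k"
        "\<And>x. x \<in> letters \<Longrightarrow> F (\<xi> x) = f x"
        using Q_extension[OF group_perm_group U(2) _ U(4)] U(3) by (metis carrier_perm_group)
      show "\<exists>N. N \<lhd> Q \<and> finite (carrier (Q Mod N)) \<and> g \<notin> N"
        using finite_hom_separates[OF group_Q group_perm_group finite_perm_group[OF U(1)] F(1) g(1)]
          U(5) F by auto
    qed
  qed
qed

end

theorem theorem4:
  fixes \<Phi> :: "('h, 'm) monoid_scheme"
    and A :: "'a set"
    and R :: "('a, 'h) rel_expr"
  assumes "is_free_group \<Phi>"
    and "M_presentation A \<Phi> R"
  shows "(residually_finite (rel_group A \<Phi> R) \<and> one_relator_group (rel_group A \<Phi> R)) \<and>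
    (\<forall>(B :: 'a set) z S.
        z \<notin> B \<and> A \<inter> insert z B = {} \<and> S \<in> lists (insert z B \<times> UNIV) \<longrightarrow>
        one_relator_group (rel_subst_group A B z \<Phi> R S) \<and>
        (residually_finite (rel_subst_group A B z \<Phi> R S) \<longleftrightarrow>
         residually_finite (one_relator_presented (insert z B) S))) \<and>
    (\<forall>n :: nat. n > 1 \<longrightarrow> residually_finite (rel_power_group A \<Phi> R n))"
proof -
  obtain Bas :: "'h set" and wd y where free: "free_coefficients \<Phi> Bas wd y"
    by (rule is_free_group_coefficients[OF assms(1)])
  have rel: "relative_presentation A \<Phi> R" "R \<in> lists ((A \<times> UNIV) \<times> carrier \<Phi>)" "unique_max_min A (skeleton R)"
    using assms(2) by (auto simp: M_presentation_def relative_presentation_def)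
  interpret free_coefficients \<Phi> Bas wd y by (rule free)
  \<comment> \<open>Only the element type matters: these singletons are pairwise distinct, whether
    or not they are cosets.\<close>
  define j :: "'a + 'h \<Rightarrow> ('h + 'a word) list set" where
    "j = case_sum (\<lambda>x. {[Inr (free_gen x)]}) (\<lambda>h. {[Inl h]})"
  have j: "inj j"
    by (auto simp: inj_def j_def free_gen_def split: sum.splits)
  have subst: "one_relator_group (rel_subst_group A B z \<Phi> R S) \<and>
        (residually_finite (rel_subst_group A B z \<Phi> R S) \<longleftrightarrow>
         residually_finite (one_relator_presented (insert z B) S))"
    if "z \<notin> B" "A \<inter> B = {}" "S \<in> lists (insert z B \<times> UNIV)" for B z S
  proof -
    interpret relator_substitution \<Phi> Bas wd y A B z R S
      by unfold_locales (use that rel in auto)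
    show ?thesis
      unfolding rel_subst_group_eq using one_relator_group_Q[OF j] residually_finite_Q_iff[OF rel(3)] by simp
  qed
  have power: "residually_finite (rel_power_group A \<Phi> R n) \<and> one_relator_group (rel_power_group A \<Phi> R n)"
    if "n > 0" for n
  proof -
    interpret amb: group "ambient A \<Phi>" by (rule group_ambient[OF is_group])
    \<comment> \<open>Any element of the type will do, even one of \<open>A\<close>; the set
      \<open>Y\<close> is empty here.\<close>
    define z :: 'a where "z = undefined"
    have "rel_subst_element A {} z \<Phi> R (replicate n (z, True)) = rel_element A \<Phi> R [^]\<^bsub>ambient A \<Phi>\<^esub> n"
      using rel_element_closed[OF rel(1)] unfolding rel_subst_element_def
      by (subst eval_word_replicate) (auto simp: amb.is_group)
    then have "rel_subst_group A {} z \<Phi> R (replicate n (z, True)) = rel_power_group A \<Phi> R n"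
      by (simp add: rel_subst_group_def rel_power_group_def)
    moreover have "replicate n (z, True) \<in> lists (insert z {} \<times> UNIV)"
      by auto
    ultimately show ?thesis
      using subst[of z "{}" "replicate n (z, True)"] residually_finite_cyclic[OF that, of z] by simp
  qed
  have "rel_power_group A \<Phi> R 1 = rel_group A \<Phi> R"
  proof -
    interpret amb: group "ambient A \<Phi>" by (rule group_ambient[OF is_group])
    show ?thesis
      using rel_element_closed[OF rel(1), of A] by (simp add: rel_power_group_def rel_group_def)
  qed
  then show ?thesis
    using power[of 1] power subst by auto
qed

end
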